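(* Let $M$ be a paracompact smooth manifold, $\mathbb{A}$ a Weil algebra, $M^{\mathbb{A}}$ the associated Weil bundle, and let $(\mathfrak{X}(M^{\mathbb{A}}),\rho)$ be a Lie-Rinehart structure on $M^{\mathbb{A}}$. Then there exists an $\mathbb{A}$-differential form of degree $1$ on $M^{\mathbb{A}}$, $$\alpha:\mathfrak{X}(M^{\mathbb{A}})\longrightarrow C^{\infty}(M^{\mathbb{A}},\mathbb{A}),$$ such that for all $X\in\mathfrak{X}(M^{\mathbb{A}})$ and all $\varphi\in C^{\infty}(M^{\mathbb{A}},\mathbb{A})$, $$\rho(X)(\varphi)=X(\varphi)+\varphi\cdot\alpha(X).$$
   Context: A Weil algebra $\mathbb{A}$ is a finite-dimensional associative commutative unital $\mathbb{R}$-algebra with a unique maximal ideal $\mathfrak{m}$, of codimension $1$, so $\mathbb{A}=\mathbb{R}\oplus\mathfrak{m}$ (with $\mathfrak{m}$ nilpotent). Let $M$ be a paracompact smooth ($C^\infty$) manifold of dimension $n$. A near point of $x\in M$ of kind $\mathbb{A}$ is a homomorphism of algebras $\xi:C^{\infty}(M)\to\mathbb{A}$ with $\xi(f)-f(x)\in\mathfrak{m}$ for all $f\in C^{\infty}(M)$. The Weil bundle $M^{\mathbb{A}}$ is the set of all near points of kind $\mathbb{A}$ of all points of $M$; it is a smooth manifold of dimension $n\cdot\dim\mathbb{A}$, with charts induced by local charts $(U;x_1,\dots,x_n)$ of $M$ via $U^{\mathbb{A}}\to\mathbb{A}^n$, $\xi\mapsto(\xi(x_1),\dots,\xi(x_n))$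 (a bijection onto an open subset of $\mathbb{A}^n$). $C^{\infty}(M^{\mathbb{A}},\mathbb{A})$ is the commutative unital $\mathbb{A}$-algebra of smooth functions $M^{\mathbb{A}}\to\mathbb{A}$ with pointwise operations; its unit is $1_{C^{\infty}(M^{\mathbb{A}},\mathbb{A})}$. $\mathfrak{X}(M^{\mathbb{A}})=\mathrm{Der}_{\mathbb{A}}[C^{\infty}(M^{\mathbb{A}},\mathbb{A})]$ is the $C^{\infty}(M^{\mathbb{A}},\mathbb{A})$-module of $\mathbb{A}$-linear derivations of $C^{\infty}(M^{\mathbb{A}},\mathbb{A})$; it is an $\mathbb{A}$-Lie algebra under $[X,Y]=X\circ Y-Y\circ X$, and $[X,\varphi Y]=X(\varphi)Y+\varphi[X,Y]$ for all $\varphi \in C^{\infty}(M^{\mathbb{A}},\mathbb{A})$. $\mathcal{D}_{\mathbb{A}}(M^{\mathbb{A}})$ is the set of $\mathbb{A}$-linear maps $D:C^{\infty}(M^{\mathbb{A}},\mathbb{A})\to C^{\infty}(M^{\mathbb{A}},\mathbb{A})$ such that $D(\varphi\psi)=D(\varphi)\psi+\varphi D(\psi)-\varphi\psi D(1_{C^{\infty}(M^{\mathbb{A}},\mathbb{A})})$ for all $\varphi,\psi$; it is a $C^{\infty}(M^{\mathbb{A}},\mathbb{A})$-module and an $\mathbb{A}$-Lie algebra under the commutator. A Lie-Rinehart structure $(\mathfrak{X}(M^{\mathbb{A}}),\rho)$ on $M^{\mathbb{A}}$ is given by a map $\rho:\mathfrak{X}(M^{\mathbb{A}})\to\mathcal{D}_{\mathbb{A}}(M^{\mathbb{A}})$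 that is a morphism of $C^{\infty}(M^{\mathbb{A}},\mathbb{A})$-modules and of Lie algebras over $\mathbb{A}$, such that for all $X,Y\in\mathfrak{X}(M^{\mathbb{A}})$ and $\varphi\in C^{\infty}(M^{\mathbb{A}},\mathbb{A})$, $$[X,\varphi\cdot Y]=\left[\rho(X)(\varphi)-\varphi\cdot\rho(X)(1_{C^{\infty}(M^{\mathbb{A}},\mathbb{A})})\right]\cdot Y+\varphi\cdot[X,Y].$$ An $\mathbb{A}$-differential form of degree $1$ on $M^{\mathbb{A}}$ is a $C^{\infty}(M^{\mathbb{A}},\mathbb{A})$-linear map $\mathfrak{X}(M^{\mathbb{A}})\to C^{\infty}(M^{\mathbb{A}},\mathbb{A})$. *)

theory Defs
  imports "HOL-Analysis.Analysis"
begin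

section \<open>Smooth functions on open subsets of n-fold powers\<close>

text \<open>
  For a Euclidean space \<open>E\<close> (in the sequel \<open>E\<close> is \<open>real\<close> or a Weil algebra) the space \<open>E\<^sup>n\<close>
  consists of the functions \<open>x :: nat \<Rightarrow> E\<close> with \<open>x i = 0\<close> for all \<open>i \<ge> n\<close>, with the product
  topology. For \<open>E = real\<close> this is the library's \<^const>\<open>Euclidean_space\<close>. Keeping \<open>n\<close> a natural
  number, instead of a finite index type, includes the dimension \<open>n = 0\<close>.

  \<open>Ck_on k n S f\<close> says that \<open>f\<close> has continuous iterated partial derivatives of order up to \<open>k\<close>
  on \<open>S\<close>; it is meant for \<open>S\<close> open in \<open>E\<^sup>n\<close>. The real coordinates of \<open>E\<^sup>n\<close> are indexed by
  \<open>i < n\<close> and \<open>b \<in> Basis\<close>.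
\<close>

primrec Ck_on ::
  "nat \<Rightarrow> nat \<Rightarrow> (nat \<Rightarrow> 'e::euclidean_space) set \<Rightarrow> ((nat \<Rightarrow> 'e) \<Rightarrow> 'c::real_normed_vector) \<Rightarrow> bool"
where
  "Ck_on 0 n S f \<longleftrightarrow> continuous_on S f"
| "Ck_on (Suc k) n S f \<longleftrightarrow>
     continuous_on S f \<and>
     (\<forall>i<n. \<forall>b\<in>Basis. \<exists>g.
        (\<forall>x\<in>S. ((\<lambda>t. f (x(i := x i + t *\<^sub>R b))) has_vector_derivative g x) (at 0)) \<and>
        Ck_on k n S g)"

definition smooth_on ::
  "nat \<Rightarrow> (nat \<Rightarrow> 'e::euclidean_space) set \<Rightarrow> ((nat \<Rightarrow> 'e) \<Rightarrow> 'c::real_normed_vector) \<Rightarrow> bool"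
where
  "smooth_on n S f \<longleftrightarrow> (\<forall>k. Ck_on k n S f)"


section \<open>Paracompact smooth manifolds\<close>

definition paracompact_space :: "'p topology \<Rightarrow> bool" where
  "paracompact_space X \<longleftrightarrow>
     (\<forall>\<U>. (\<forall>U\<in>\<U>. openin X U) \<and> \<Union>\<U> = topspace X \<longrightarrow>
        (\<exists>\<V>. (\<forall>V\<in>\<V>. openin X V \<and> (\<exists>U\<in>\<U>. V \<subseteq> U)) \<and> \<Union>\<V> = topspace X \<and>
             locally_finite_in X \<V>))"

text \<open>A chart \<open>(U, c)\<close> consists of its domain and its coordinate map; \<open>c x i\<close>, for \<open>i < n\<close>, is the
  \<open>i\<close>-th coordinate of \<open>x\<close>. As usual, manifolds are Hausdorff.\<close>

locale smooth_manifold =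
  fixes X :: "'p topology"
    and n :: nat
    and \<A> :: "('p set \<times> ('p \<Rightarrow> nat \<Rightarrow> real)) set"
  assumes Hausdorff: "Hausdorff_space X"
    and chart_domain: "(U, c) \<in> \<A> \<Longrightarrow> openin X U"
    and chart_image: "(U, c) \<in> \<A> \<Longrightarrow> openin (Euclidean_space n) (c ` U)"
    and chart_homeomorphism: "(U, c) \<in> \<A> \<Longrightarrow>
          homeomorphic_map (subtopology X U) (subtopology (Euclidean_space n) (c ` U)) c"
    and charts_cover: "(\<Union>(U, c)\<in>\<A>. U) = topspace X"
    and charts_compatible: "(U, c) \<in> \<A> \<Longrightarrow> (V, d) \<in> \<A> \<Longrightarrow> i < n \<Longrightarrow>
          smooth_on n (c ` (U \<inter> V)) (\<lambda>x. d (inv_into U c x) i)"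

text \<open>
  A function on a set \<open>S\<close> that is given as a subset of a type is represented by its extension by
  zero outside \<open>S\<close>, so that functions on \<open>S\<close> are determined by their values on \<open>S\<close> and all
  algebraic operations are pointwise; the unit is \<open>unit_on S\<close>. The same convention is used below for
  near points, derivations and operators, as maps on a set of functions.
\<close>

definition unit_on :: "'q set \<Rightarrow> 'q \<Rightarrow> 'c::zero_neq_one" where
  "unit_on S = (\<lambda>p. if p \<in> S then 1 else 0)"

definition smooth_functions ::
  "'q set \<Rightarrow> nat \<Rightarrow> ('q set \<times> ('q \<Rightarrow> nat \<Rightarrow> 'e::euclidean_space)) set \<Rightarrow>
   ('q \<Rightarrow> 'c::real_normed_vector) set"
where
  "smooth_functions S n \<A> =
     {f. (\<forall>(U, c)\<in>\<A>. smooth_on n (c ` U) (\<lambda>x. f (inv_into U c x))) \<and> (\<forall>p. p \<notin> S \<longrightarrow> f p = 0)}"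

abbreviation real_functions ::
  "'p topology \<Rightarrow> nat \<Rightarrow> ('p set \<times> ('p \<Rightarrow> nat \<Rightarrow> real)) set \<Rightarrow> ('p \<Rightarrow> real) set"
where
  "real_functions X n \<A> \<equiv> smooth_functions (topspace X) n \<A>"


section \<open>Weil algebras\<close>

definition ideal_of_ring :: "'a::comm_ring_1 set \<Rightarrow> bool" where
  "ideal_of_ring I \<longleftrightarrow> 0 \<in> I \<and> (\<forall>x\<in>I. \<forall>y\<in>I. x + y \<in> I) \<and> (\<forall>a. \<forall>x\<in>I. a * x \<in> I)"

definition maximal_ideal_of_ring :: "'a::comm_ring_1 set \<Rightarrow> bool" where
  "maximal_ideal_of_ring I \<longleftrightarrow>
     ideal_of_ring I \<and> I \<noteq> UNIV \<and> (\<forall>J. ideal_of_ring J \<and> I \<subseteq> J \<longrightarrow> J = I \<or> J = UNIV)"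

text \<open>The class \<^class>\<open>euclidean_space\<close> provides finite dimension and the standard topology of the
  vector space \<open>'a\<close>. Its inner product is not related to the multiplication, and the notions below
  do not depend on its choice.\<close>

locale weil_algebra =
  fixes \<mm> :: "'a::{comm_ring_1, real_algebra_1, euclidean_space} set"
  assumes maximal: "maximal_ideal_of_ring \<mm>"
    and unique: "maximal_ideal_of_ring I \<Longrightarrow> I = \<mm>"
    and codimension_1: "dim \<mm> + 1 = DIM('a)"


section \<open>The Weil bundle\<close>

definition near_point ::
  "'p topology \<Rightarrow> nat \<Rightarrow> ('p set \<times> ('p \<Rightarrow> nat \<Rightarrow> real)) set \<Rightarrow>
   'a::{comm_ring_1, real_algebra_1, euclidean_space} set \<Rightarrow> 'p \<Rightarrow> (('p \<Rightarrow> real) \<Rightarrow> 'a) \<Rightarrow> bool"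
where
  "near_point X n \<A> \<mm> x \<xi> \<longleftrightarrow>
     (\<forall>f\<in>real_functions X n \<A>. \<forall>g\<in>real_functions X n \<A>. \<xi> (\<lambda>p. f p + g p) = \<xi> f + \<xi> g) \<and>
     (\<forall>f\<in>real_functions X n \<A>. \<forall>r. \<xi> (\<lambda>p. r * f p) = r *\<^sub>R \<xi> f) \<and>
     (\<forall>f\<in>real_functions X n \<A>. \<forall>g\<in>real_functions X n \<A>. \<xi> (\<lambda>p. f p * g p) = \<xi> f * \<xi> g) \<and>
     \<xi> (unit_on (topspace X)) = 1 \<and>
     (\<forall>f\<in>real_functions X n \<A>. \<xi> f - of_real (f x) \<in> \<mm>) \<and>
     (\<forall>f. f \<notin> real_functions X n \<A> \<longrightarrow> \<xi> f = 0)"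

definition near_points_over ::
  "'p topology \<Rightarrow> nat \<Rightarrow> ('p set \<times> ('p \<Rightarrow> nat \<Rightarrow> real)) set \<Rightarrow>
   'a::{comm_ring_1, real_algebra_1, euclidean_space} set \<Rightarrow> 'p set \<Rightarrow> (('p \<Rightarrow> real) \<Rightarrow> 'a) set"
where
  "near_points_over X n \<A> \<mm> U = {\<xi>. \<exists>x\<in>U. near_point X n \<A> \<mm> x \<xi>}"

definition weil_bundle ::
  "'p topology \<Rightarrow> nat \<Rightarrow> ('p set \<times> ('p \<Rightarrow> nat \<Rightarrow> real)) set \<Rightarrow>
   'a::{comm_ring_1, real_algebra_1, euclidean_space} set \<Rightarrow> (('p \<Rightarrow> real) \<Rightarrow> 'a) set"
where
  "weil_bundle X n \<A> \<mm> = near_points_over X n \<A> \<mm> (topspace X)"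

text \<open>
  The value \<open>\<xi>(h)\<close> of a near point \<open>\<xi>\<close> of \<open>x\<close> at a function \<open>h\<close> that is defined and smooth only
  near \<open>x\<close>, such as a local coordinate: \<open>\<xi> f\<close> depends only on the germ of \<open>f\<close> at \<open>x\<close>, and every
  germ at \<open>x\<close> is the germ of a global smooth function.
\<close>

definition near_point_value ::
  "'p topology \<Rightarrow> nat \<Rightarrow> ('p set \<times> ('p \<Rightarrow> nat \<Rightarrow> real)) set \<Rightarrow>
   'a::{comm_ring_1, real_algebra_1, euclidean_space} set \<Rightarrow>
   (('p \<Rightarrow> real) \<Rightarrow> 'a) \<Rightarrow> ('p \<Rightarrow> real) \<Rightarrow> 'a"
where
  "near_point_value X n \<A> \<mm> \<xi> h =
     (THE a. \<exists>x\<in>topspace X. \<exists>W. \<exists>f\<in>real_functions X n \<A>.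
        near_point X n \<A> \<mm> x \<xi> \<and> openin X W \<and> x \<in> W \<and> (\<forall>y\<in>W. f y = h y) \<and> a = \<xi> f)"

definition weil_chart ::
  "'p topology \<Rightarrow> nat \<Rightarrow> ('p set \<times> ('p \<Rightarrow> nat \<Rightarrow> real)) set \<Rightarrow>
   'a::{comm_ring_1, real_algebra_1, euclidean_space} set \<Rightarrow>
   ('p \<Rightarrow> nat \<Rightarrow> real) \<Rightarrow> (('p \<Rightarrow> real) \<Rightarrow> 'a) \<Rightarrow> nat \<Rightarrow> 'a"
where
  "weil_chart X n \<A> \<mm> c \<xi> =
     (\<lambda>i. if i < n then near_point_value X n \<A> \<mm> \<xi> (\<lambda>x. c x i) else 0)"

definition weil_atlas ::
  "'p topology \<Rightarrow> nat \<Rightarrow> ('p set \<times> ('p \<Rightarrow> nat \<Rightarrow> real)) set \<Rightarrow>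
   'a::{comm_ring_1, real_algebra_1, euclidean_space} set \<Rightarrow>
   ((('p \<Rightarrow> real) \<Rightarrow> 'a) set \<times> ((('p \<Rightarrow> real) \<Rightarrow> 'a) \<Rightarrow> nat \<Rightarrow> 'a)) set"
where
  "weil_atlas X n \<A> \<mm> = (\<lambda>(U, c). (near_points_over X n \<A> \<mm> U, weil_chart X n \<A> \<mm> c)) ` \<A>"

definition weil_functions ::
  "'p topology \<Rightarrow> nat \<Rightarrow> ('p set \<times> ('p \<Rightarrow> nat \<Rightarrow> real)) set \<Rightarrow>
   'a::{comm_ring_1, real_algebra_1, euclidean_space} set \<Rightarrow> ((('p \<Rightarrow> real) \<Rightarrow> 'a) \<Rightarrow> 'a) set"
where
  "weil_functions X n \<A> \<mm> = smooth_functions (weil_bundle X n \<A> \<mm>) n (weil_atlas X n \<A> \<mm>)"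


section \<open>Derivations, Lie-Rinehart structures and 1-forms\<close>

text \<open>In this section \<open>S\<close> is a set and \<open>F\<close> an algebra of functions on \<open>S\<close> with values in \<open>'a\<close>;
  they are instantiated with \<^const>\<open>weil_bundle\<close> and \<^const>\<open>weil_functions\<close>.\<close>

type_synonym ('q, 'a) operator = "('q \<Rightarrow> 'a) \<Rightarrow> 'q \<Rightarrow> 'a"

definition linear_operators :: "('q \<Rightarrow> 'a::comm_ring_1) set \<Rightarrow> ('q, 'a) operator set" where
  "linear_operators F =
     {D. (\<forall>\<phi>\<in>F. D \<phi> \<in> F) \<and> (\<forall>\<phi>. \<phi> \<notin> F \<longrightarrow> D \<phi> = (\<lambda>_. 0)) \<and>
         (\<forall>\<phi>\<in>F. \<forall>\<psi>\<in>F. D (\<lambda>p. \<phi> p + \<psi> p) = (\<lambda>p. D \<phi> p + D \<psi> p)) \<and>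
         (\<forall>a. \<forall>\<phi>\<in>F. D (\<lambda>p. a * \<phi> p) = (\<lambda>p. a * D \<phi> p))}"

definition derivations :: "('q \<Rightarrow> 'a::comm_ring_1) set \<Rightarrow> ('q, 'a) operator set" where
  "derivations F =
     {D \<in> linear_operators F. \<forall>\<phi>\<in>F. \<forall>\<psi>\<in>F.
        D (\<lambda>p. \<phi> p * \<psi> p) = (\<lambda>p. D \<phi> p * \<psi> p + \<phi> p * D \<psi> p)}"

definition differential_operators ::
  "'q set \<Rightarrow> ('q \<Rightarrow> 'a::comm_ring_1) set \<Rightarrow> ('q, 'a) operator set"
where
  "differential_operators S F =
     {D \<in> linear_operators F. \<forall>\<phi>\<in>F. \<forall>\<psi>\<in>F.
        D (\<lambda>p. \<phi> p * \<psi> p) =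
          (\<lambda>p. D \<phi> p * \<psi> p + \<phi> p * D \<psi> p - \<phi> p * \<psi> p * D (unit_on S) p)}"

definition op_add :: "('q, 'a::comm_ring_1) operator \<Rightarrow> ('q, 'a) operator \<Rightarrow> ('q, 'a) operator" where
  "op_add D E = (\<lambda>\<phi> p. D \<phi> p + E \<phi> p)"

definition op_mult :: "('q \<Rightarrow> 'a::comm_ring_1) \<Rightarrow> ('q, 'a) operator \<Rightarrow> ('q, 'a) operator" where
  "op_mult \<phi> D = (\<lambda>\<psi> p. \<phi> p * D \<psi> p)"

definition op_scale :: "'a::comm_ring_1 \<Rightarrow> ('q, 'a) operator \<Rightarrow> ('q, 'a) operator" where
  "op_scale a D = (\<lambda>\<psi> p. a * D \<psi> p)"

definition commutator :: "('q, 'a::comm_ring_1) operator \<Rightarrow> ('q, 'a) operator \<Rightarrow> ('q, 'a) operator" where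
  "commutator D E = (\<lambda>\<phi> p. D (E \<phi>) p - E (D \<phi>) p)"

locale lie_rinehart_structure =
  fixes S :: "'q set"
    and F :: "('q \<Rightarrow> 'a::comm_ring_1) set"
    and \<rho> :: "('q, 'a) operator \<Rightarrow> ('q, 'a) operator"
  assumes maps_to: "X \<in> derivations F \<Longrightarrow> \<rho> X \<in> differential_operators S F"
    and additive: "X \<in> derivations F \<Longrightarrow> Y \<in> derivations F \<Longrightarrow>
          \<rho> (op_add X Y) = op_add (\<rho> X) (\<rho> Y)"
    and module_linear: "\<phi> \<in> F \<Longrightarrow> X \<in> derivations F \<Longrightarrow> \<rho> (op_mult \<phi> X) = op_mult \<phi> (\<rho> X)"
    and scalar_linear: "X \<in> derivations F \<Longrightarrow> \<rho> (op_scale a X) = op_scale a (\<rho> X)"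
    and bracket: "X \<in> derivations F \<Longrightarrow> Y \<in> derivations F \<Longrightarrow>
          \<rho> (commutator X Y) = commutator (\<rho> X) (\<rho> Y)"
    and leibniz: "X \<in> derivations F \<Longrightarrow> Y \<in> derivations F \<Longrightarrow> \<phi> \<in> F \<Longrightarrow>
          commutator X (op_mult \<phi> Y) =
            op_add (op_mult (\<lambda>p. \<rho> X \<phi> p - \<phi> p * \<rho> X (unit_on S) p) Y) (op_mult \<phi> (commutator X Y))"

locale differential_1_form =
  fixes F :: "('q \<Rightarrow> 'a::comm_ring_1) set"
    and \<alpha> :: "('q, 'a) operator \<Rightarrow> 'q \<Rightarrow> 'a"
  assumes maps_to: "X \<in> derivations F \<Longrightarrow> \<alpha> X \<in> F"
    and additive: "X \<in> derivations F \<Longrightarrow> Y \<in> derivations F \<Longrightarrow>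
          \<alpha> (op_add X Y) = (\<lambda>p. \<alpha> X p + \<alpha> Y p)"
    and module_linear: "\<phi> \<in> F \<Longrightarrow> X \<in> derivations F \<Longrightarrow>
          \<alpha> (op_mult \<phi> X) = (\<lambda>p. \<phi> p * \<alpha> X p)"

end

theory Submission
  imports Defs
begin

text \<open>
  Put \<open>\<alpha>(X) = \<rho>(X)(1)\<close>. Since \<open>\<rho>\<close> is a module morphism, \<open>\<alpha>\<close> is a 1-form. Expanding \<open>[X, \<phi> Y]\<close>
  once by the derivation law of \<open>X\<close> and once by the compatibility condition of the
  Lie-Rinehart structure gives \<open>(\<rho>(X)(\<phi>) - \<phi> \<alpha>(X) - X(\<phi>)) Y = 0\<close> for every derivation \<open>Y\<close>. It remains
  to cancel \<open>Y\<close>, for which it is enough that at every point some derivation takes a unit of the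
  Weil algebra as a value on some function (\<open>one_form_of_separating_derivations\<close>). Nonzero values
  would not be enough, because a Weil algebra may have zero divisors; this is why the local
  structure of the Weil bundle enters.

  If \<open>n = 0\<close>, every function on the Weil bundle is smooth and the indicator functions of points are
  idempotents, so that all derivations vanish (\<open>derivation_zero_if_discrete\<close>) and there is nothing to
  cancel. If \<open>n > 0\<close>, the derivation is a coordinate vector field of a Weil chart multiplied by a bump
  function, in the direction of a basis vector of the Weil algebra that is a unit
  (\<open>derivation_with_unit_value\<close>). It acts on functions on the whole bundle, so one needs that the Weil
  charts are bijections onto open sets and that their transition maps are smooth.

  Both facts rest on the prolongation of a smooth function \<open>f\<close> to arguments in the Weil algebra: with
  \<open>a = x + \<nu>\<close>, where \<open>x\<close> is real and the entries of \<open>\<nu>\<close> are nilpotent, \<open>f(a)\<close> is the finite Taylor sum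
  of \<open>exp(\<Sum>i. \<nu>\<^sub>i \<partial>\<^sub>i) f\<close> at \<open>x\<close>. The exponential of a nilpotent derivation is multiplicative, so
  \<open>f \<mapsto> f(a)\<close> is a near point with coordinates \<open>a\<close> (\<open>np_near_point_at\<close>, \<open>wchart_near_point_at\<close>). Conversely,
  a near point is determined by its coordinates (\<open>near_point_eqI\<close>): by Hadamard's lemma the difference
  of two near points with equal coordinates takes values in every power of the ideal generated by \<open>\<nu>\<close>,
  hence vanishes. Consequently transition maps are prolongations of transition maps of \<open>M\<close>, and a
  prolongation is smooth since it is polynomial in \<open>\<nu>\<close> with coefficients smooth in \<open>x\<close>
  (\<open>smooth_on_prolong\<close>).
\<close>

section \<open>Reduction to the existence of derivations with unit values\<close>

text \<open>At a point \<open>p\<close> where \<open>Y \<psi> p\<close> is a unit, the identity \<open>(\<rho>(X)(\<phi>) - \<phi> \<alpha>(X) - X(\<phi>)) Y = 0\<close> can be divided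
  by \<open>Y \<psi> p\<close>. If the only derivation is zero, then \<open>\<rho>\<close> is zero by linearity and both sides vanish.\<close>
lemma one_form_of_separating_derivations:
  assumes LR: "lie_rinehart_structure S F \<rho>" and unit: "unit_on S \<in> F"
    and ext: "\<And>\<phi> p. \<phi> \<in> F \<Longrightarrow> p \<notin> S \<Longrightarrow> \<phi> p = 0"
    and sep: "(\<forall>Y\<in>derivations F. \<forall>\<phi>\<in>F. Y \<phi> = (\<lambda>_. 0)) \<or>
              (\<forall>p\<in>S. \<exists>Y\<in>derivations F. \<exists>\<psi>\<in>F. Y \<psi> p dvd 1)"
  shows "\<exists>\<alpha>. differential_1_form F \<alpha> \<and> (\<forall>Y\<in>derivations F. \<forall>\<phi>\<in>F. \<rho> Y \<phi> = (\<lambda>q. Y \<phi> q + \<phi> q * \<alpha> Y q))"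
proof (intro exI conjI ballI)
  interpret lie_rinehart_structure S F \<rho> by (rule LR)
  let ?\<alpha> = "\<lambda>Y. \<rho> Y (unit_on S)"
  have lin: "D \<phi> \<in> F" if "D \<in> linear_operators F" "\<phi> \<in> F" for D \<phi>
    using that by (auto simp: linear_operators_def)
  have \<rho>lin: "\<rho> Y \<in> linear_operators F" if "Y \<in> derivations F" for Y
    using maps_to[OF that] by (simp add: differential_operators_def)
  have dlin: "Y \<in> linear_operators F" if "Y \<in> derivations F" for Y
    using that by (simp add: derivations_def)
  show "differential_1_form F ?\<alpha>"
  proof
    fix Y assume Y: "Y \<in> derivations F"
    show "?\<alpha> Y \<in> F" by (rule lin[OF \<rho>lin[OF Y] unit])
    show "?\<alpha> (op_mult \<phi> Y) = (\<lambda>p. \<phi> p * ?\<alpha> Y p)" if "\<phi> \<in> F" for \<phi>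
      using module_linear[OF that Y] by (simp add: op_mult_def)
    show "?\<alpha> (op_add Y Z) = (\<lambda>p. ?\<alpha> Y p + ?\<alpha> Z p)" if "Z \<in> derivations F" for Z
      using additive[OF Y that] by (simp add: op_add_def)
  qed
  fix X \<phi> assume X: "X \<in> derivations F" and \<phi>: "\<phi> \<in> F"
  show "\<rho> X \<phi> = (\<lambda>q. X \<phi> q + \<phi> q * ?\<alpha> X q)"
    using sep
  proof
    assume zero: "\<forall>Y\<in>derivations F. \<forall>\<phi>\<in>F. Y \<phi> = (\<lambda>_. 0)"
    have "X \<psi> = (\<lambda>_. 0)" for \<psi>
      using zero X dlin[OF X] by (cases "\<psi> \<in> F") (auto simp: linear_operators_def)
    \<comment> \<open>\<open>\<rho>\<close> commutes with multiplication by the scalar \<open>0\<close>\<close>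
    then have "op_scale 0 X = X" by (simp add: op_scale_def fun_eq_iff)
    then have "\<rho> X = op_scale 0 (\<rho> X)" using scalar_linear[OF X, of 0] by simp
    then have "\<rho> X \<psi> = (\<lambda>_. 0)" for \<psi> by (metis mult_zero_left op_scale_def)
    then show ?thesis using \<open>\<And>\<psi>. X \<psi> = (\<lambda>_. 0)\<close> by simp
  next
    assume units: "\<forall>p\<in>S. \<exists>Y\<in>derivations F. \<exists>\<psi>\<in>F. Y \<psi> p dvd 1"
    show ?thesis
    proof
      fix p
      show "\<rho> X \<phi> p = X \<phi> p + \<phi> p * ?\<alpha> X p"
      proof (cases "p \<in> S")
        case False
        then show ?thesis
          using ext[OF \<phi>] ext[OF lin[OF dlin[OF X] \<phi>]] ext[OF lin[OF \<rho>lin[OF X] \<phi>]] by simp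
      next
        case True
        then obtain Y \<psi> where Y: "Y \<in> derivations F" and \<psi>: "\<psi> \<in> F" and u: "Y \<psi> p dvd 1"
          using units by blast
        \<comment> \<open>the factor by which \<open>Y \<psi> p\<close> is multiplied in the two expansions of the bracket\<close>
        let ?z = "\<rho> X \<phi> p - \<phi> p * ?\<alpha> X p - X \<phi> p"
        have "X (\<lambda>q. \<phi> q * Y \<psi> q) = (\<lambda>q. X \<phi> q * Y \<psi> q + \<phi> q * X (Y \<psi>) q)"
          using X \<phi> lin[OF dlin[OF Y] \<psi>] by (simp add: derivations_def)
        moreover have "commutator X (op_mult \<phi> Y) \<psi> p =
            op_add (op_mult (\<lambda>p. \<rho> X \<phi> p - \<phi> p * ?\<alpha> X p) Y) (op_mult \<phi> (commutator X Y)) \<psi> p"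
          by (simp only: leibniz[OF X Y \<phi>])
        ultimately have "?z * Y \<psi> p = 0"
          by (simp add: commutator_def op_mult_def op_add_def algebra_simps)
        moreover obtain v where "1 = Y \<psi> p * v" using u by (auto simp: dvd_def)
        ultimately have "?z = 0" by (metis mult.assoc mult.right_neutral mult_zero_left)
        then show ?thesis by (simp add: algebra_simps)
      qed
    qed
  qed
qed

section \<open>Iterated partial derivatives on open subsets of a power\<close>

text \<open>The carrier of the \<open>n\<close>-fold power on which \<open>Ck_on n\<close> is meant to be used. Open subsets are open
  relative to this carrier, which is not open in the full function type.\<close>
definition En :: "nat \<Rightarrow> (nat \<Rightarrow> 'e::euclidean_space) set" where
  "En n = {x. \<forall>i\<ge>n. x i = 0}"

abbreviation open_n :: "nat \<Rightarrow> (nat \<Rightarrow> 'e::euclidean_space) set \<Rightarrow> bool" where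
  "open_n n \<equiv> openin (top_of_set (En n))"

lemma tendsto_coordinatewise:
  fixes f :: "'t \<Rightarrow> 'i \<Rightarrow> 'b::topological_space"
  assumes "\<And>i. ((\<lambda>t. f t i) \<longlongrightarrow> l i) F"
  shows "(f \<longlongrightarrow> l) F"
proof -
  have "limitin (product_topology (\<lambda>i. euclidean) UNIV) f l F"
    using assms by (simp add: limitin_componentwise)
  then have "limitin euclidean f l F" by (simp only: euclidean_product_topology)
  then show ?thesis by simp
qed

lemma open_n_subset: "open_n n S \<Longrightarrow> x \<in> S \<Longrightarrow> i \<ge> n \<Longrightarrow> x i = 0"
  by (auto simp: openin_open En_def)

text \<open>Convergence in a power is coordinatewise, so this and \<open>tendsto_coordinatewise\<close> replace
  all arguments with basic open sets.\<close>
lemma eventually_in_open_n: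
  assumes "open_n n S" "x \<in> S" "(f \<longlongrightarrow> x) F" "\<forall>\<^sub>F t in F. f t \<in> En n"
  shows "\<forall>\<^sub>F t in F. f t \<in> S"
proof -
  obtain T where T: "open T" "S = En n \<inter> T" using assms(1) by (auto simp: openin_open)
  have "\<forall>\<^sub>F t in F. f t \<in> T"
    using topological_tendstoD[OF assms(3) T(1)] assms(2) T(2) by auto
  with assms(4) show ?thesis by eventually_elim (use T in auto)
qed

lemma tendsto_line:
  fixes x :: "nat \<Rightarrow> 'e::real_normed_vector"
  shows "((\<lambda>t. x(i := x i + t *\<^sub>R b)) \<longlongrightarrow> x) (nhds 0)"
proof (rule tendsto_coordinatewise)
  fix j
  have "((\<lambda>t. x i + t *\<^sub>R b) \<longlongrightarrow> x i + 0 *\<^sub>R b) (nhds 0)"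
    by (intro tendsto_intros filterlim_ident)
  then show "((\<lambda>t. (x(i := x i + t *\<^sub>R b)) j) \<longlongrightarrow> x j) (nhds 0)"
    by (cases "j = i") auto
qed

lemma eventually_line:
  assumes "open_n n S" "x \<in> S" "i < n"
  shows "\<forall>\<^sub>F t in nhds 0. x(i := x i + t *\<^sub>R b) \<in> S"
  using assms(1,2) tendsto_line
proof (rule eventually_in_open_n)
  show "\<forall>\<^sub>F t in nhds 0. x(i := x i + t *\<^sub>R b) \<in> En n"
    using assms by (intro always_eventually) (auto simp: En_def openin_open)
qed

lemma open_n_open_cube: "open_n n {y \<in> En n. \<forall>j<n. \<bar>y j - x j\<bar> < r}" for x :: "nat \<Rightarrow> real"
proof -
  have "open {y. \<forall>j\<in>{..<n}. y j \<in> ball (x j) r}"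
    by (rule product_topology_basis') auto
  moreover have "{y \<in> En n. \<forall>j<n. \<bar>y j - x j\<bar> < r} = En n \<inter> {y. \<forall>j\<in>{..<n}. y j \<in> ball (x j) r}"
    by (auto simp: dist_real_def abs_minus_commute)
  ultimately show ?thesis by (auto simp: openin_open)
qed

text \<open>If every cube around \<open>x\<close> left the open set, a sequence of points outside of it would converge
  to \<open>x\<close> coordinatewise.\<close>
lemma open_n_cube:
  fixes x :: "nat \<Rightarrow> real"
  assumes S: "open_n n S" "x \<in> S"
  obtains r where "r > 0" "{y \<in> En n. \<forall>j<n. \<bar>y j - x j\<bar> \<le> r} \<subseteq> S"
proof (rule ccontr)
  assume neg: "\<not> thesis"
  have "\<exists>y. y \<in> En n - S \<and> (\<forall>j<n. \<bar>y j - x j\<bar> \<le> inverse (real (Suc m)))" for m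
    using that[of "inverse (real (Suc m))"] neg by auto
  then obtain y where y: "\<And>m. y m \<in> En n - S" "\<And>m j. j < n \<Longrightarrow> \<bar>y m j - x j\<bar> \<le> inverse (real (Suc m))"
    by metis
  have "y \<longlonglongrightarrow> x"
  proof (rule tendsto_coordinatewise)
    fix j
    show "(\<lambda>m. y m j) \<longlonglongrightarrow> x j"
    proof (cases "j < n")
      case True
      have "(\<lambda>m. y m j - x j) \<longlonglongrightarrow> 0"
        by (rule Lim_null_comparison[OF _ LIMSEQ_inverse_real_of_nat]) (use y(2)[OF True] in auto)
      then show ?thesis by (simp add: LIM_zero_iff)
    next
      case False
      then show ?thesis using y(1) open_n_subset[OF S, of j] by (simp add: En_def)
    qed
  qed
  then have "\<forall>\<^sub>F m in sequentially. y m \<in> S"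
    by (rule eventually_in_open_n[OF S]) (use y(1) in auto)
  then show False using y(1) by (auto simp: eventually_sequentially)
qed

lemma compact_cube: "compact {y \<in> En n. \<forall>j<n. \<bar>y j - x j\<bar> \<le> r}" for x :: "nat \<Rightarrow> real"
proof -
  let ?C = "\<lambda>j. if j < n then {x j - r..x j + r} else {0}"
  have "compactin (product_topology (\<lambda>_. euclidean) UNIV) (PiE UNIV ?C)"
    unfolding compactin_PiE by simp
  moreover have "PiE UNIV ?C = {y \<in> En n. \<forall>j<n. \<bar>y j - x j\<bar> \<le> r}"
  proof (rule set_eqI)
    fix y
    have "y j \<in> ?C j \<longleftrightarrow> (if j < n then \<bar>y j - x j\<bar> \<le> r else y j = 0)" for j
      by (simp add: abs_diff_le_iff)
    then have "y \<in> PiE UNIV ?C \<longleftrightarrow> (\<forall>j. if j < n then \<bar>y j - x j\<bar> \<le> r else y j = 0)"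
      by (simp only: PiE_iff extensional_UNIV) simp
    also have "\<dots> \<longleftrightarrow> y \<in> {y \<in> En n. \<forall>j<n. \<bar>y j - x j\<bar> \<le> r}"
      by (auto simp: En_def not_less split: if_splits)
    finally show "y \<in> PiE UNIV ?C \<longleftrightarrow> y \<in> {y \<in> En n. \<forall>j<n. \<bar>y j - x j\<bar> \<le> r}" .
  qed
  ultimately show ?thesis by (simp add: euclidean_product_topology)
qed

lemma Euclidean_space_eq: "Euclidean_space n = top_of_set (En n)"
  by (simp add: Euclidean_space_def En_def euclidean_product_topology)

text \<open>A canonical choice for the existentially quantified derivatives in \<open>Ck_on\<close>.\<close>
definition pd :: "nat \<Rightarrow> 'e::euclidean_space \<Rightarrow> ((nat \<Rightarrow> 'e) \<Rightarrow> 'c::real_normed_vector) \<Rightarrow> (nat \<Rightarrow> 'e) \<Rightarrow> 'c"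
  where "pd i b f x = vector_derivative (\<lambda>t. f (x(i := x i + t *\<^sub>R b))) (at 0)"

abbreviation has_pd ::
  "((nat \<Rightarrow> 'e::euclidean_space) \<Rightarrow> 'c::real_normed_vector) \<Rightarrow> nat \<Rightarrow> 'e \<Rightarrow> (nat \<Rightarrow> 'e) \<Rightarrow> 'c \<Rightarrow> bool"
  where "has_pd f i b x D \<equiv> ((\<lambda>t. f (x(i := x i + t *\<^sub>R b))) has_vector_derivative D) (at 0)"

lemma has_pd_imp_pd: "has_pd f i b x D \<Longrightarrow> pd i b f x = D"
  by (simp add: pd_def vector_derivative_at)

lemma has_pd_cong:
  assumes "open_n n S" "\<And>y. y \<in> S \<Longrightarrow> f y = g y" "x \<in> S" "i < n"
  shows "has_pd f i b x D \<longleftrightarrow> has_pd g i b x D"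
proof (rule has_vector_derivative_cong_ev)
  show "\<forall>\<^sub>F t in nhds 0. t \<in> UNIV \<longrightarrow> f (x(i := x i + t *\<^sub>R b)) = g (x(i := x i + t *\<^sub>R b))"
    using eventually_line[OF assms(1,3,4)] by eventually_elim (use assms(2) in auto)
qed (use assms in auto)

lemma pd_cong:
  assumes "open_n n S" "\<And>y. y \<in> S \<Longrightarrow> f y = g y" "x \<in> S" "i < n"
  shows "pd i b f x = pd i b g x"
  unfolding pd_def vector_derivative_def
  using has_pd_cong[where f = f and g = g and b = b, OF assms] by simp

lemma Ck_on_cong:
  fixes f :: "(nat \<Rightarrow> 'e::euclidean_space) \<Rightarrow> 'c::real_normed_vector"
  assumes "open_n n S" "\<And>y. y \<in> S \<Longrightarrow> f y = g y"
  shows "Ck_on k n S f \<longleftrightarrow> Ck_on k n S g"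
proof (cases k)
  case 0
  then show ?thesis using assms(2) by (simp cong: continuous_on_cong)
next
  case (Suc k)
  have "(\<forall>x\<in>S. has_pd f i b x (h x)) \<longleftrightarrow> (\<forall>x\<in>S. has_pd g i b x (h x))" if "i < n" for i b h
    using has_pd_cong[where f = f and g = g and b = b, OF assms _ that] by blast
  moreover have "continuous_on S f \<longleftrightarrow> continuous_on S g"
    using assms(2) by (simp cong: continuous_on_cong)
  ultimately show ?thesis by (simp add: Suc)
qed

lemma Ck_on_congI:
  assumes "Ck_on k n S g" "open_n n S" "\<And>y. y \<in> S \<Longrightarrow> f y = g y"
  shows "Ck_on k n S f"
  using Ck_on_cong[where f = f and g = g, OF assms(2,3)] assms(1) by simp

lemma Ck_on_Suc_iff:
  fixes f :: "(nat \<Rightarrow> 'e::euclidean_space) \<Rightarrow> 'c::real_normed_vector"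
  assumes "open_n n S"
  shows "Ck_on (Suc k) n S f \<longleftrightarrow> continuous_on S f \<and>
    (\<forall>i<n. \<forall>b\<in>Basis. (\<forall>x\<in>S. has_pd f i b x (pd i b f x)) \<and> Ck_on k n S (pd i b f))"
    (is "_ \<longleftrightarrow> ?R")
proof
  assume L: "Ck_on (Suc k) n S f"
  have "(\<forall>x\<in>S. has_pd f i b x (pd i b f x)) \<and> Ck_on k n S (pd i b f)" if ib: "i < n" "b \<in> Basis" for i b
  proof -
    obtain g where g: "\<forall>x\<in>S. has_pd f i b x (g x)" "Ck_on k n S g"
      using L ib unfolding Ck_on.simps by blast
    then have "\<forall>x\<in>S. pd i b f x = g x" using has_pd_imp_pd by blast
    then show ?thesis using g Ck_on_cong[OF assms, of "pd i b f" g] by auto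
  qed
  then show ?R using L by auto
qed auto

lemma Ck_on_continuous: "Ck_on k n S f \<Longrightarrow> continuous_on S f"
  by (cases k) auto

lemma Ck_on_SucD:
  assumes "Ck_on (Suc k) n S f" "i < n" "b \<in> Basis"
  obtains g where "\<And>x. x \<in> S \<Longrightarrow> has_pd f i b x (g x)" "Ck_on k n S g"
  using assms unfolding Ck_on.simps by blast

lemma Ck_on_SucI:
  assumes "continuous_on S f"
    and "\<And>i b. i < n \<Longrightarrow> b \<in> Basis \<Longrightarrow> \<exists>g. (\<forall>x\<in>S. has_pd f i b x (g x)) \<and> Ck_on k n S g"
  shows "Ck_on (Suc k) n S f"
  using assms unfolding Ck_on.simps by blast

lemma Ck_on_lower: "Ck_on (Suc k) n S f \<Longrightarrow> Ck_on k n S f"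
proof (induction k arbitrary: f)
  case (Suc k)
  show ?case
  proof (rule Ck_on_SucI[OF Ck_on_continuous[OF Suc.prems]])
    fix i b assume "i < n" "b \<in> (Basis::'a set)"
    from Suc.prems this obtain g where g: "\<And>x. x \<in> S \<Longrightarrow> has_pd f i b x (g x)" "Ck_on (Suc k) n S g"
      by (rule Ck_on_SucD) blast
    show "\<exists>g. (\<forall>x\<in>S. has_pd f i b x (g x)) \<and> Ck_on k n S g"
      by (intro exI[of _ g] conjI ballI g(1) Suc.IH g(2))
  qed
qed simp

lemma Ck_on_subset: "Ck_on k n S f \<Longrightarrow> T \<subseteq> S \<Longrightarrow> Ck_on k n T f"
proof (induction k arbitrary: f)
  case (Suc k)
  show ?case
  proof (rule Ck_on_SucI[OF continuous_on_subset[OF Ck_on_continuous[OF Suc.prems(1)] Suc.prems(2)]])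
    fix i b assume "i < n" "b \<in> (Basis::'a set)"
    from Suc.prems(1) this obtain g where g: "\<And>x. x \<in> S \<Longrightarrow> has_pd f i b x (g x)" "Ck_on k n S g"
      by (rule Ck_on_SucD) blast
    show "\<exists>g. (\<forall>x\<in>T. has_pd f i b x (g x)) \<and> Ck_on k n T g"
      by (intro exI[of _ g] conjI ballI g(1) Suc.IH g(2) Suc.prems(2)) (use Suc.prems(2) in auto)
  qed
qed (auto intro: continuous_on_subset)

text \<open>Partial derivatives are determined by the function, so the local ones patch together.\<close>
lemma Ck_on_local:
  fixes f :: "(nat \<Rightarrow> 'e::euclidean_space) \<Rightarrow> 'c::real_normed_vector"
  assumes "open_n n S" "\<And>x. x \<in> S \<Longrightarrow> \<exists>T. open_n n T \<and> x \<in> T \<and> Ck_on k n T f"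
  shows "Ck_on k n S f"
  using assms(2)
proof (induction k arbitrary: f)
  case 0
  show ?case unfolding Ck_on.simps
    unfolding continuous_on_eq_continuous_within
  proof
    fix x assume x: "x \<in> S"
    obtain T where T: "open_n n T" "x \<in> T" "continuous_on T f" using 0 x by auto
    obtain O' where O': "open O'" "T = En n \<inter> O'" using T(1) by (auto simp: openin_open)
    have "continuous (at x within S \<inter> O') f"
      using T O' assms(1) by (auto simp: continuous_on_eq_continuous_within openin_open intro: continuous_within_subset)
    moreover have "at x within S \<inter> O' = at x within S"
      using O' T(2) by (intro at_within_nhd[of x O']) auto
    ultimately show "continuous (at x within S) f" by simp
  qed
next
  case (Suc k)
  have "continuous_on S f \<and>
    (\<forall>i<n. \<forall>b\<in>Basis. (\<forall>x\<in>S. has_pd f i b x (pd i b f x)) \<and> Ck_on k n S (pd i b f))"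
  proof (intro conjI allI impI ballI)
    have "\<exists>T. open_n n T \<and> x \<in> T \<and> Ck_on k n T f" if "x \<in> S" for x
      using Suc.prems[OF that] Ck_on_lower[of k n _ f] by auto
    then have "Ck_on k n S f" by (rule Suc.IH)
    then show "continuous_on S f" by (rule Ck_on_continuous)
  next
    fix i b x assume *: "i < n" "b \<in> (Basis::'e set)" "x \<in> S"
    from Suc.prems[OF *(3)] obtain T where T: "open_n n T" "x \<in> T" "Ck_on (Suc k) n T f" by auto
    then show "has_pd f i b x (pd i b f x)"
      using Ck_on_Suc_iff[OF T(1), of k f] * by simp
  next
    fix i b assume *: "i < n" "b \<in> (Basis::'e set)"
    have "\<exists>T. open_n n T \<and> x \<in> T \<and> Ck_on k n T (pd i b f)" if x: "x \<in> S" for x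
    proof -
      from Suc.prems[OF x] obtain T where T: "open_n n T" "x \<in> T" "Ck_on (Suc k) n T f" by auto
      then show ?thesis using Ck_on_Suc_iff[OF T(1), of k f] * by auto
    qed
    then show "Ck_on k n S (pd i b f)" by (rule Suc.IH)
  qed
  then show ?case unfolding Ck_on.simps by blast
qed

lemma Ck_on_const: "Ck_on k n S (\<lambda>x. c)"
proof (induction k arbitrary: c)
  case (Suc k)
  show ?case
    by (rule Ck_on_SucI[OF continuous_on_const]) (intro exI[of _ "\<lambda>x. 0"] conjI ballI Suc.IH has_vector_derivative_const)
qed simp

lemma Ck_on_bounded_linear:
  fixes f :: "(nat \<Rightarrow> 'e::euclidean_space) \<Rightarrow> 'c::real_normed_vector"
    and L :: "'c \<Rightarrow> 'd::real_normed_vector"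
  assumes L: "bounded_linear L"
  shows "Ck_on k n S f \<Longrightarrow> Ck_on k n S (\<lambda>x. L (f x))"
proof (induction k arbitrary: f)
  case 0
  then show ?case using L by (simp add: bounded_linear.continuous_on)
next
  case (Suc k)
  show ?case
  proof (rule Ck_on_SucI)
    show "continuous_on S (\<lambda>x. L (f x))"
      by (rule bounded_linear.continuous_on[OF L Ck_on_continuous[OF Suc.prems]])
    fix i b assume "i < n" "b \<in> (Basis::'e set)"
    from Suc.prems this obtain g where g: "\<And>x. x \<in> S \<Longrightarrow> has_pd f i b x (g x)" "Ck_on k n S g"
      by (rule Ck_on_SucD) blast
    show "\<exists>g. (\<forall>x\<in>S. has_pd (\<lambda>x. L (f x)) i b x (g x)) \<and> Ck_on k n S g"
      using bounded_linear.has_vector_derivative[OF L g(1)] Suc.IH[OF g(2)]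
      by (intro exI[of _ "\<lambda>x. L (g x)"] conjI ballI)
  qed
qed

lemma Ck_on_add:
  fixes f g :: "(nat \<Rightarrow> 'e::euclidean_space) \<Rightarrow> 'c::real_normed_vector"
  shows "Ck_on k n S f \<Longrightarrow> Ck_on k n S g \<Longrightarrow> Ck_on k n S (\<lambda>x. f x + g x)"
proof (induction k arbitrary: f g)
  case 0
  then show ?case by (simp add: continuous_on_add)
next
  case (Suc k)
  show ?case
  proof (rule Ck_on_SucI)
    show "continuous_on S (\<lambda>x. f x + g x)"
      by (rule continuous_on_add[OF Suc.prems[THEN Ck_on_continuous]])
    fix i b assume ib: "i < n" "b \<in> (Basis::'e set)"
    from Suc.prems(1) ib obtain f' where f': "\<And>x. x \<in> S \<Longrightarrow> has_pd f i b x (f' x)" "Ck_on k n S f'"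
      by (rule Ck_on_SucD) blast
    from Suc.prems(2) ib obtain g' where g': "\<And>x. x \<in> S \<Longrightarrow> has_pd g i b x (g' x)" "Ck_on k n S g'"
      by (rule Ck_on_SucD) blast
    show "\<exists>h. (\<forall>x\<in>S. has_pd (\<lambda>x. f x + g x) i b x (h x)) \<and> Ck_on k n S h"
      using has_vector_derivative_add[OF f'(1) g'(1)] Suc.IH[OF f'(2) g'(2)]
      by (intro exI[of _ "\<lambda>x. f' x + g' x"] conjI ballI)
  qed
qed

lemma Ck_on_sum:
  assumes "\<And>j. j \<in> J \<Longrightarrow> Ck_on k n S (f j)"
  shows "Ck_on k n S (\<lambda>x. \<Sum>j\<in>J. f j x)"
  using assms
proof (induction J rule: infinite_finite_induct)
  case (insert j J)
  have "Ck_on k n S (\<lambda>x. f j x + (\<Sum>j\<in>J. f j x))"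
    by (rule Ck_on_add) (use insert in auto)
  then show ?case using insert by simp
qed (simp_all add: Ck_on_const)

lemma Ck_on_bilinear:
  fixes f :: "(nat \<Rightarrow> 'e::euclidean_space) \<Rightarrow> 'c::real_normed_vector"
    and g :: "(nat \<Rightarrow> 'e) \<Rightarrow> 'd::real_normed_vector" and B :: "'c \<Rightarrow> 'd \<Rightarrow> 'f::real_normed_vector"
  assumes B: "bounded_bilinear B"
  shows "Ck_on k n S f \<Longrightarrow> Ck_on k n S g \<Longrightarrow> Ck_on k n S (\<lambda>x. B (f x) (g x))"
proof (induction k arbitrary: f g)
  case 0
  then show ?case using B by (simp add: bounded_bilinear.continuous_on)
next
  case (Suc k)
  show ?case
  proof (rule Ck_on_SucI)
    show "continuous_on S (\<lambda>x. B (f x) (g x))"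
      by (rule bounded_bilinear.continuous_on[OF B Suc.prems[THEN Ck_on_continuous]])
    fix i b assume ib: "i < n" "b \<in> (Basis::'e set)"
    from Suc.prems(1) ib obtain f' where f': "\<And>x. x \<in> S \<Longrightarrow> has_pd f i b x (f' x)" "Ck_on k n S f'"
      by (rule Ck_on_SucD) blast
    from Suc.prems(2) ib obtain g' where g': "\<And>x. x \<in> S \<Longrightarrow> has_pd g i b x (g' x)" "Ck_on k n S g'"
      by (rule Ck_on_SucD) blast
    have "has_pd (\<lambda>x. B (f x) (g x)) i b x (B (f x) (g' x) + B (f' x) (g x))" if "x \<in> S" for x
      using bounded_bilinear.has_vector_derivative[OF B f'(1)[OF that] g'(1)[OF that]] by simp
    moreover have "Ck_on k n S (\<lambda>x. B (f x) (g' x) + B (f' x) (g x))"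
      by (rule Ck_on_add[OF Suc.IH[OF Ck_on_lower[OF Suc.prems(1)] g'(2)]
            Suc.IH[OF f'(2) Ck_on_lower[OF Suc.prems(2)]]])
    ultimately show "\<exists>h. (\<forall>x\<in>S. has_pd (\<lambda>x. B (f x) (g x)) i b x (h x)) \<and> Ck_on k n S h"
      by (intro exI[of _ "\<lambda>x. B (f x) (g' x) + B (f' x) (g x)"] conjI ballI)
  qed
qed

lemma Ck_on_mult:
  fixes f g :: "(nat \<Rightarrow> 'e::euclidean_space) \<Rightarrow> 'c::real_normed_algebra"
  shows "Ck_on k n S f \<Longrightarrow> Ck_on k n S g \<Longrightarrow> Ck_on k n S (\<lambda>x. f x * g x)"
  by (rule Ck_on_bilinear[OF bounded_bilinear_mult])

lemma Ck_on_prod: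
  fixes f :: "'j \<Rightarrow> (nat \<Rightarrow> 'e::euclidean_space) \<Rightarrow> real"
  assumes "\<And>j. j \<in> J \<Longrightarrow> Ck_on k n S (f j)"
  shows "Ck_on k n S (\<lambda>x. \<Prod>j\<in>J. f j x)"
  using assms
proof (induction J rule: infinite_finite_induct)
  case (insert j J)
  have "Ck_on k n S (\<lambda>x. f j x * (\<Prod>j\<in>J. f j x))"
    by (rule Ck_on_mult) (use insert in auto)
  then show ?case using insert by simp
qed (simp_all add: Ck_on_const)

lemma Ck_on_coordinate:
  fixes L :: "'e::euclidean_space \<Rightarrow> 'c::real_normed_vector"
  assumes L: "bounded_linear L"
  shows "Ck_on k n S (\<lambda>x. L (x i))"
proof -
  have c: "continuous_on S (\<lambda>x. L (x i))"
    by (rule bounded_linear.continuous_on[OF L])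
       (rule continuous_on_subset[OF continuous_on_product_coordinates subset_UNIV])
  show ?thesis
  proof (cases k)
    case 0
    then show ?thesis using c by simp
  next
    case (Suc k)
    show ?thesis unfolding Suc Ck_on.simps
    proof (intro conjI allI impI ballI c)
      fix j b assume "j < n" "b \<in> (Basis::'e set)"
      have d: "((\<lambda>t. (x(j := x j + t *\<^sub>R b)) i) has_vector_derivative (if i = j then b else 0)) (at 0)"
        for x :: "nat \<Rightarrow> 'e"
        by (auto intro!: derivative_eq_intros)
      show "\<exists>g. (\<forall>x\<in>S. has_pd (\<lambda>x. L (x i)) j b x (g x)) \<and> Ck_on k n S g"
        using bounded_linear.has_vector_derivative[OF L d]
        by (intro exI[of _ "\<lambda>x. L (if i = j then b else 0)"] conjI ballI Ck_on_const)
    qed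
  qed
qed

text \<open>The norm of a Weil algebra need not be submultiplicative, but in finite dimension
  bilinearity suffices.\<close>
lemma bounded_bilinear_times:
  "bounded_bilinear ((*) :: 'a::{real_algebra_1, euclidean_space} \<Rightarrow> 'a \<Rightarrow> 'a)"
  by (auto simp: bilinear_conv_bounded_bilinear[symmetric] bilinear_def algebra_simps intro!: linearI)

lemma bounded_linear_of_real:
  "bounded_linear (of_real :: real \<Rightarrow> 'a::{real_algebra_1, euclidean_space})"
  by (auto simp: linear_conv_bounded_linear[symmetric] scaleR_conv_of_real intro!: linearI)

lemma pd_const: "pd i b (\<lambda>_. c) = (\<lambda>_. 0)"
  by (rule ext, rule has_pd_imp_pd) simp

lemma pd_coordinate: "pd k 1 (\<lambda>x. x i) = (\<lambda>_. if k = i then 1 else 0 :: real)"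
  by (rule ext, rule has_pd_imp_pd) (auto intro!: derivative_eq_intros)

lemma pd_scale_left:
  fixes f :: "(nat \<Rightarrow> 'e::euclidean_space) \<Rightarrow> 'a::{real_algebra_1, euclidean_space}"
  assumes "has_pd f i b x D" shows "has_pd (\<lambda>x. a * f x) i b x (a * D)"
  using bounded_linear.has_vector_derivative[OF bounded_bilinear.bounded_linear_right[OF bounded_bilinear_times] assms] .

lemma smooth_on_congI:
  assumes "smooth_on n S g" "open_n n S" "\<And>y. y \<in> S \<Longrightarrow> f y = g y"
  shows "smooth_on n S f"
  using Ck_on_congI[OF _ assms(2,3)] assms(1) by (simp add: smooth_on_def)

lemma smooth_on_const: "smooth_on n S (\<lambda>_. r)"
  by (simp add: smooth_on_def Ck_on_const)

lemma smooth_on_pd: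
  assumes "open_n n S" "smooth_on n S f" "i < n" "b \<in> Basis"
  shows "smooth_on n S (pd i b f)" "x \<in> S \<Longrightarrow> has_pd f i b x (pd i b f x)"
  using assms Ck_on_Suc_iff[OF assms(1), of _ f] unfolding smooth_on_def by blast+

lemma smooth_on_add: "smooth_on n S f \<Longrightarrow> smooth_on n S g \<Longrightarrow> smooth_on n S (\<lambda>x. f x + g x)"
  by (simp add: smooth_on_def Ck_on_add)

lemma smooth_on_mult:
  fixes f g :: "(nat \<Rightarrow> 'e::euclidean_space) \<Rightarrow> 'a::{real_algebra_1, euclidean_space}"
  shows "smooth_on n S f \<Longrightarrow> smooth_on n S g \<Longrightarrow> smooth_on n S (\<lambda>x. f x * g x)"
  by (simp add: smooth_on_def Ck_on_bilinear[OF bounded_bilinear_times])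

lemma Ck_on_minus_coordinate:
  "Ck_on k n S (\<lambda>x. x j - c)" for S :: "(nat \<Rightarrow> real) set"
  using Ck_on_add[OF Ck_on_coordinate[OF bounded_linear_ident] Ck_on_const[of k n S "- c"]] by simp

section \<open>The chain rule\<close>

lemma has_vector_derivative_shift_at:
  "((\<lambda>t. f (a + t)) has_vector_derivative D) (at b) \<longleftrightarrow> (f has_vector_derivative D) (at (a + b))"
proof -
  have 1: "((\<lambda>t. g (c + t)) has_vector_derivative D) (at d)"
    if "(g has_vector_derivative D) (at (c + d))" for g :: "real \<Rightarrow> 'a" and c d
  proof -
    have "((\<lambda>t. c + t) has_vector_derivative 1) (at d)" by (auto intro!: derivative_eq_intros)
    from vector_diff_chain_at[OF this that] show ?thesis by (simp add: o_def)
  qed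
  show ?thesis using 1[of f a b] 1[of "\<lambda>t. f (a + t)" "- a" "a + b"] by auto
qed

text \<open>The inductive step of the chain rule: along \<open>(t, \<sigma> t)\<close> it is enough that \<open>f\<close> is differentiable in
  \<open>t\<close> at one point and continuously differentiable in the second variable.\<close>
lemma has_vector_derivative_two_variables:
  fixes f :: "real \<Rightarrow> real \<Rightarrow> 'c::real_normed_vector"
  assumes f0: "((\<lambda>t. f t 0) has_vector_derivative A) (at 0)"
    and fs: "\<forall>\<^sub>F p in nhds (0, 0). ((\<lambda>s. f (fst p) s) has_vector_derivative g (fst p) (snd p)) (at (snd p))"
    and gc: "((\<lambda>p. g (fst p) (snd p)) \<longlongrightarrow> g 0 0) (nhds (0, 0))"
    and \<sigma>: "\<sigma> 0 = 0" "(\<sigma> has_real_derivative s') (at 0)"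
  shows "((\<lambda>t. f t (\<sigma> t)) has_vector_derivative A + s' *\<^sub>R g 0 0) (at 0)"
proof -
  obtain W where W: "open W" "(0, 0) \<in> W"
    "\<And>p. p \<in> W \<Longrightarrow> ((\<lambda>s. f (fst p) s) has_vector_derivative g (fst p) (snd p)) (at (snd p))"
    using fs unfolding eventually_nhds by blast
  obtain A' B' where AB: "open A'" "open B'" "0 \<in> A'" "0 \<in> B'" "A' \<times> B' \<subseteq> W"
    using W(1,2) by (metis open_prod_elim mem_Sigma_iff)
  obtain d where d: "d > 0" "ball 0 d \<subseteq> B'" using AB by (meson open_contains_ball)
  define Y where "Y = ball (0::real) d"
  have Y: "open Y" "convex Y" "0 \<in> Y" using d by (auto simp: Y_def)
  have "((\<lambda>(x, y). f x y) has_derivative (\<lambda>(tx, ty). tx *\<^sub>R A + blinfun_apply (blinfun_scaleR_left (g 0 0)) ty))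
          (at (0, 0) within A' \<times> Y)"
  proof (rule has_derivative_partialsI[where fy = "\<lambda>t s. blinfun_scaleR_left (g t s)"])
    show "((\<lambda>x. f x 0) has_derivative (\<lambda>tx. tx *\<^sub>R A)) (at 0 within A')"
      using f0 unfolding has_vector_derivative_def by (rule has_derivative_at_withinI)
    fix x y assume "x \<in> A'" "y \<in> Y"
    then have "(x, y) \<in> W" using AB d by (auto simp: Y_def)
    from W(3)[OF this] show "(f x has_derivative blinfun_apply (blinfun_scaleR_left (g x y))) (at y within Y)"
      by (auto simp: has_vector_derivative_def intro: has_derivative_at_withinI)
  next
    have "((\<lambda>p. blinfun_scaleR_left (g (fst p) (snd p))) \<longlongrightarrow> blinfun_scaleR_left (g 0 0)) (nhds (0, 0))"
      by (rule bounded_linear.tendsto[OF bounded_linear_blinfun_scaleR_left gc])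
    then show "continuous (at (0, 0) within A' \<times> Y) (\<lambda>(x, y). blinfun_scaleR_left (g x y))"
      unfolding continuous_within case_prod_unfold
      by (auto intro: tendsto_mono[rotated] simp: at_within_def)
  qed (use Y in auto)
  then have D: "((\<lambda>p. f (fst p) (snd p)) has_derivative (\<lambda>p. fst p *\<^sub>R A + snd p *\<^sub>R g 0 0)) (at (0, 0))"
    using at_within_open[of "(0,0)" "A' \<times> Y"] AB Y by (simp add: case_prod_unfold open_Times)
  have "((\<lambda>t. (t, \<sigma> t)) has_derivative (\<lambda>t. (t, t * s'))) (at 0)"
    using has_derivative_Pair[OF has_derivative_ident \<sigma>(2)[unfolded has_field_derivative_def]]
    by (simp add: mult.commute)
  then have "((\<lambda>t. f t (\<sigma> t)) has_derivative (\<lambda>t. t *\<^sub>R A + (t * s') *\<^sub>R g 0 0)) (at 0)"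
    using diff_chain_at[of "\<lambda>t. (t, \<sigma> t)" _ 0 "\<lambda>p. f (fst p) (snd p)"] D \<sigma>(1) by (fastforce simp: o_def)
  then show ?thesis by (simp add: has_vector_derivative_def scaleR_add_right)
qed

text \<open>Continuous partial derivatives imply the chain rule along a curve. The real coordinates, indexed by
  pairs \<open>(i, b)\<close>, are released one at a time: the curve \<open>mix D\<close> follows \<open>\<gamma>\<close> in the coordinates in \<open>D\<close>
  and stays at \<open>\<gamma> 0\<close> in the others.\<close>
lemma has_vector_derivative_along_curve_0:
  fixes h :: "(nat \<Rightarrow> 'e::euclidean_space) \<Rightarrow> 'c::real_normed_vector"
  assumes S: "open_n n S" and h: "Ck_on (Suc 0) n S h" and x: "\<gamma> 0 \<in> S"
    and \<gamma>En: "\<And>t. \<gamma> t \<in> En n"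
    and \<gamma>: "\<And>i. i < n \<Longrightarrow> ((\<lambda>t. \<gamma> t i) has_vector_derivative \<gamma>' i) (at 0)"
  shows "((\<lambda>t. h (\<gamma> t)) has_vector_derivative (\<Sum>i<n. \<Sum>b\<in>Basis. (\<gamma>' i \<bullet> b) *\<^sub>R pd i b h (\<gamma> 0))) (at 0)"
proof -
  define mix where "mix D t = (\<lambda>i. \<gamma> 0 i + (\<Sum>b\<in>{b\<in>Basis. (i, b) \<in> D}. ((\<gamma> t i - \<gamma> 0 i) \<bullet> b) *\<^sub>R b))"
    for D t
  have \<gamma>lim: "((\<lambda>t. \<gamma> t i) \<longlongrightarrow> \<gamma> 0 i) (nhds 0)" for i
  proof (cases "i < n")
    case True
    have "isCont (\<lambda>t. \<gamma> t i) 0"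
      using \<gamma>[OF True] by (rule has_vector_derivative_continuous)
    then show ?thesis using tendsto_at_iff_tendsto_nhds[of "\<lambda>t. \<gamma> t i" 0] by (simp add: isCont_def)
  next
    case False
    then show ?thesis using \<gamma>En by (simp add: En_def)
  qed
  have mix0: "mix D 0 = \<gamma> 0" for D by (simp add: mix_def)
  have mixEn: "mix D t \<in> En n" for D t
    using \<gamma>En by (auto simp: mix_def En_def)
  \<comment> \<open>releasing the coordinate \<open>(i, b)\<close> moves \<open>mix D t\<close> by \<open>\<sigma> t\<close> in direction \<open>b\<close>\<close>
  have step: "((\<lambda>t. h (mix D t)) has_vector_derivative
      (\<Sum>(i, b)\<in>D. (\<gamma>' i \<bullet> b) *\<^sub>R pd i b h (\<gamma> 0))) (at 0)"
    if "finite D" "D \<subseteq> {..<n} \<times> Basis" for D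
    using that
  proof (induction D rule: finite_subset_induct)
    case empty
    show ?case by (simp add: mix_def has_vector_derivative_const)
  next
    case (insert a D)
    obtain i b where a: "a = (i, b)" by (cases a)
    with insert have ib: "i < n" "b \<in> Basis" by auto
    define P where "P p = (mix D (fst p))(i := mix D (fst p) i + snd p *\<^sub>R b)" for p
    define \<sigma> where "\<sigma> t = (\<gamma> t i - \<gamma> 0 i) \<bullet> b" for t
    have P0: "P (0, 0) = \<gamma> 0" by (simp add: P_def mix0)
    have Plim: "(P \<longlongrightarrow> \<gamma> 0) (nhds (0, 0))"
    proof (rule tendsto_coordinatewise)
      fix j
      have f: "filterlim fst (nhds 0) (nhds (0::real, 0::real))" "filterlim snd (nhds 0) (nhds (0::real, 0::real))"
        using tendsto_fst[OF filterlim_ident, of "(0::real, 0::real)"] tendsto_snd[OF filterlim_ident, of "(0::real, 0::real)"] by auto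
      have "((\<lambda>p. mix D (fst p) j) \<longlongrightarrow> mix D 0 j) (nhds (0, 0::real))" for j
        unfolding mix_def by (intro tendsto_intros filterlim_compose[OF \<gamma>lim f(1)])
      note this[unfolded mix0]
      moreover from this have "((\<lambda>p. mix D (fst p) i + snd p *\<^sub>R b) \<longlongrightarrow> \<gamma> 0 i + 0 *\<^sub>R b) (nhds (0, 0))"
        by (intro tendsto_intros f(2))
      ultimately show "((\<lambda>p. P p j) \<longlongrightarrow> \<gamma> 0 j) (nhds (0, 0))"
        by (cases "j = i") (simp_all add: P_def)
    qed
    have PEn: "P p \<in> En n" for p
      using mixEn ib by (auto simp: P_def En_def)
    have PS: "\<forall>\<^sub>F p in nhds (0, 0). P p \<in> S"
      by (rule eventually_in_open_n[OF S x Plim]) (simp add: PEn)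
    have hS: "continuous_on S (pd i b h)" "\<And>y. y \<in> S \<Longrightarrow> has_pd h i b y (pd i b h y)"
      using h ib unfolding Ck_on_Suc_iff[OF S] by auto
    have "((\<lambda>t. h (P (t, \<sigma> t))) has_vector_derivative
       (\<Sum>(i, b)\<in>D. (\<gamma>' i \<bullet> b) *\<^sub>R pd i b h (\<gamma> 0)) + (\<gamma>' i \<bullet> b) *\<^sub>R pd i b h (P (0, 0))) (at 0)"
    proof (rule has_vector_derivative_two_variables[where g = "\<lambda>t s. pd i b h (P (t, s))" and f = "\<lambda>t s. h (P (t, s))" and \<sigma> = \<sigma>])
      show "((\<lambda>t. h (P (t, 0))) has_vector_derivative (\<Sum>(i, b)\<in>D. (\<gamma>' i \<bullet> b) *\<^sub>R pd i b h (\<gamma> 0))) (at 0)"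
        using insert.IH by (simp add: P_def)
      show "\<forall>\<^sub>F p in nhds (0, 0). ((\<lambda>s. h (P (fst p, s))) has_vector_derivative pd i b h (P (fst p, snd p))) (at (snd p))"
        using PS
      proof eventually_elim
        case (elim p)
        have "(P p)(i := P p i + r *\<^sub>R b) = P (fst p, snd p + r)" for r
          by (auto simp: P_def scaleR_add_left)
        with hS(2)[OF elim] have "((\<lambda>r. h (P (fst p, snd p + r))) has_vector_derivative pd i b h (P p)) (at 0)"
          by simp
        then show ?case using has_vector_derivative_shift_at[of "\<lambda>s. h (P (fst p, s))" "snd p" _ 0] by simp
      qed
      show "((\<lambda>p. pd i b h (P (fst p, snd p))) \<longlongrightarrow> pd i b h (P (0, 0))) (nhds (0, 0))"
        using continuous_on_tendsto_compose[OF hS(1) Plim x PS] by (simp add: P0)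
      show "\<sigma> 0 = 0" by (simp add: \<sigma>_def)
      have "((\<lambda>t. (\<gamma> t i - \<gamma> 0 i) \<bullet> b) has_vector_derivative ((\<gamma>' i - 0) \<bullet> b)) (at 0)"
        by (rule bounded_linear.has_vector_derivative[OF bounded_linear_inner_left])
           (intro derivative_intros \<gamma> ib)
      then show "(\<sigma> has_real_derivative \<gamma>' i \<bullet> b) (at 0)"
        by (simp add: \<sigma>_def[abs_def] has_real_derivative_iff_has_vector_derivative)
    qed
    moreover have "P (t, \<sigma> t) = mix (insert a D) t" for t
    proof
      fix j
      have "{b' \<in> Basis. (i, b') \<in> insert a D} = insert b {b' \<in> Basis. (i, b') \<in> D}"
        using a ib by auto
      moreover have "{b' \<in> Basis. (j, b') \<in> insert a D} = {b' \<in> Basis. (j, b') \<in> D}" if "j \<noteq> i"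
        using a that by auto
      ultimately show "P (t, \<sigma> t) j = mix (insert a D) t j"
        using insert.hyps a by (cases "j = i") (auto simp: P_def mix_def \<sigma>_def finite_subset[OF _ finite_Basis])
    qed
    ultimately show ?case using insert.hyps a by (simp add: P0 add.commute)
  qed
  have "mix ({..<n} \<times> Basis) t = \<gamma> t" for t
  proof
    fix i
    show "mix ({..<n} \<times> Basis) t i = \<gamma> t i"
    proof (cases "i < n")
      case True
      then show ?thesis by (simp add: mix_def euclidean_representation)
    next
      case False
      then show ?thesis using \<gamma>En[of t] \<gamma>En[of 0] by (simp add: mix_def En_def)
    qed
  qed
  with step[of "{..<n} \<times> Basis"] show ?thesis by (simp add: sum.cartesian_product)
qed

lemma has_vector_derivative_along_curve:
  fixes h :: "(nat \<Rightarrow> 'e::euclidean_space) \<Rightarrow> 'c::real_normed_vector"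
  assumes S: "open_n n S" and h: "Ck_on (Suc 0) n S h" and x: "\<gamma> s \<in> S"
    and \<gamma>En: "\<And>t. \<gamma> t \<in> En n"
    and \<gamma>: "\<And>i. i < n \<Longrightarrow> ((\<lambda>t. \<gamma> t i) has_vector_derivative \<gamma>' i) (at s)"
  shows "((\<lambda>t. h (\<gamma> t)) has_vector_derivative (\<Sum>i<n. \<Sum>b\<in>Basis. (\<gamma>' i \<bullet> b) *\<^sub>R pd i b h (\<gamma> s))) (at s)"
proof -
  have "((\<lambda>t. \<gamma> (s + t) i) has_vector_derivative \<gamma>' i) (at 0)" if "i < n" for i
    using \<gamma>[OF that] has_vector_derivative_shift_at[of "\<lambda>t. \<gamma> t i" s _ 0] by simp
  then have "((\<lambda>t. h (\<gamma> (s + t))) has_vector_derivative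
      (\<Sum>i<n. \<Sum>b\<in>Basis. (\<gamma>' i \<bullet> b) *\<^sub>R pd i b h (\<gamma> (s + 0)))) (at 0)"
    by (intro has_vector_derivative_along_curve_0[OF S h]) (use x \<gamma>En in auto)
  then show ?thesis using has_vector_derivative_shift_at[of "\<lambda>t. h (\<gamma> t)" s _ 0] by simp
qed

text \<open>By the chain rule, each partial derivative of \<open>h \<circ> T\<close> is a sum of products of derivatives of \<open>T\<close> and of
  compositions with \<open>T\<close> of derivatives of \<open>h\<close>, to which the induction hypothesis applies.\<close>
lemma Ck_on_compose:
  fixes h :: "(nat \<Rightarrow> 'd::euclidean_space) \<Rightarrow> 'c::real_normed_vector"
    and T :: "(nat \<Rightarrow> 'e::euclidean_space) \<Rightarrow> nat \<Rightarrow> 'd"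
  assumes S: "open_n n S" and S': "open_n m S'" and TS: "\<And>x. x \<in> S \<Longrightarrow> T x \<in> S'"
  shows "Ck_on k m S' h \<Longrightarrow> (\<And>j. j < m \<Longrightarrow> Ck_on k n S (\<lambda>x. T x j)) \<Longrightarrow> Ck_on k n S (\<lambda>x. h (T x))"
proof (induction k arbitrary: h)
  case 0
  have "continuous_on S (\<lambda>x. T x j)" for j
  proof (cases "j < m")
    case True
    then show ?thesis using 0 by simp
  next
    case False
    then have "T x j = 0" if "x \<in> S" for x using open_n_subset[OF S' TS[OF that]] by simp
    then show ?thesis using continuous_on_cong[of S S "\<lambda>x. T x j" "\<lambda>_. 0"] by simp
  qed
  then have "continuous_on S T" by (rule continuous_on_coordinatewise_then_product)
  with 0 show ?case unfolding Ck_on.simps by (intro continuous_on_compose2[of S' h S T]) (use TS in auto)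
next
  case (Suc k)
  have T: "Ck_on k n S (\<lambda>x. T x j)" if "j < m" for j
    using Suc.prems(2)[OF that] by (rule Ck_on_lower)
  have h1: "Ck_on (Suc 0) m S' h"
    using Suc.prems(1) unfolding Ck_on_Suc_iff[OF S'] by (auto dest: Ck_on_continuous)
  show ?case
  proof (rule Ck_on_SucI)
    show "continuous_on S (\<lambda>x. h (T x))"
      by (rule Ck_on_continuous[OF Suc.IH[OF Ck_on_lower[OF Suc.prems(1)] T]])
    fix i b assume ib: "i < n" "b \<in> (Basis::'e set)"
    define T' where "T' j x = pd i b (\<lambda>x. T x j) x" for j x
    define D where "D x = (\<Sum>j<m. \<Sum>b'\<in>Basis. (T' j x \<bullet> b') *\<^sub>R pd j b' h (T x))" for x
    have T': "has_pd (\<lambda>x. T x j) i b x (T' j x)" "Ck_on k n S (T' j)" if "j < m" "x \<in> S" for j x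
      using Suc.prems(2)[OF that(1)] that ib unfolding Ck_on_Suc_iff[OF S] T'_def by auto
    have "has_pd (\<lambda>x. h (T x)) i b x (D x)" if x: "x \<in> S" for x
    proof -
      \<comment> \<open>the default value \<open>T x\<close> keeps the curve inside \<open>S'\<close> for all \<open>t\<close>\<close>
      define \<gamma> where "\<gamma> t = (let y = x(i := x i + t *\<^sub>R b) in if y \<in> S then T y else T x)" for t
      have ev: "\<forall>\<^sub>F t in nhds 0. x(i := x i + t *\<^sub>R b) \<in> S" by (rule eventually_line[OF S x ib(1)])
      have "((\<lambda>t. h (\<gamma> t)) has_vector_derivative (\<Sum>j<m. \<Sum>b'\<in>Basis. (T' j x \<bullet> b') *\<^sub>R pd j b' h (\<gamma> 0))) (at 0)"
      proof (rule has_vector_derivative_along_curve[OF S' h1])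
        show "\<gamma> 0 \<in> S'" using TS[OF x] by (simp add: \<gamma>_def Let_def)
        show "\<gamma> t \<in> En m" for t using TS[OF x] TS[of "x(i := x i + t *\<^sub>R b)"] S'
          by (auto simp: \<gamma>_def Let_def openin_open)
        fix j assume "j < m"
        have "((\<lambda>t. \<gamma> t j) has_vector_derivative T' j x) (at 0) \<longleftrightarrow> has_pd (\<lambda>x. T x j) i b x (T' j x)"
          by (rule has_vector_derivative_cong_ev)
             (use ev in eventually_elim, auto simp: \<gamma>_def Let_def)
        then show "((\<lambda>t. \<gamma> t j) has_vector_derivative T' j x) (at 0)" using T'(1)[OF \<open>j < m\<close> x] by simp
      qed
      moreover have "\<gamma> 0 = T x" by (simp add: \<gamma>_def Let_def)
      moreover have "((\<lambda>t. h (\<gamma> t)) has_vector_derivative D x) (at 0) \<longleftrightarrow> has_pd (\<lambda>x. h (T x)) i b x (D x)"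
        by (rule has_vector_derivative_cong_ev)
           (use ev in eventually_elim, auto simp: \<gamma>_def Let_def)
      ultimately show ?thesis by (simp add: D_def)
    qed
    moreover have "Ck_on k n S D"
    proof (cases "S = {}")
      case True
      then show ?thesis using Ck_on_cong[OF S, of D "\<lambda>_. 0"] Ck_on_const by auto
    next
      case False
      then obtain x where x: "x \<in> S" by auto
      show ?thesis unfolding D_def[abs_def]
      proof (intro Ck_on_sum Ck_on_bilinear[OF bounded_bilinear_scaleR])
        fix j and b' :: 'd assume jb: "j \<in> {..<m}" "b' \<in> Basis"
        then show "Ck_on k n S (\<lambda>x. T' j x \<bullet> b')"
          by (intro Ck_on_bounded_linear[OF bounded_linear_inner_left] T'(2)[OF _ x]) auto
        show "Ck_on k n S (\<lambda>x. pd j b' h (T x))"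
          using Suc.IH[of "pd j b' h"] T Suc.prems(1) jb unfolding Ck_on_Suc_iff[OF S'] by auto
      qed
    qed
    ultimately show "\<exists>g. (\<forall>x\<in>S. has_pd (\<lambda>x. h (T x)) i b x (g x)) \<and> Ck_on k n S g"
      by (intro exI[of _ D] conjI ballI)
  qed
qed

text \<open>Smoothness of an outer function of one variable is expressed by a family that contains
  it and is closed under differentiation.\<close>
lemma Ck_on_compose_real:
  fixes u :: "(nat \<Rightarrow> 'e::euclidean_space) \<Rightarrow> real"
  assumes G: "\<And>g. g \<in> G \<Longrightarrow> \<exists>g'\<in>G. \<forall>s\<in>D. (g has_real_derivative g' s) (at s)"
    and uD: "\<And>x. x \<in> S \<Longrightarrow> u x \<in> D"
  shows "g \<in> G \<Longrightarrow> Ck_on k n S u \<Longrightarrow> Ck_on k n S (\<lambda>x. g (u x))"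
proof (induction k arbitrary: g)
  have c: "continuous_on S (\<lambda>x. g (u x))" if "g \<in> G" "continuous_on S u" for g
  proof (rule continuous_on_compose2[OF _ that(2)])
    show "continuous_on D g"
      using G[OF that(1)] by (meson DERIV_isCont continuous_at_imp_continuous_on)
  qed (use uD in auto)
  {
    case 0
    then show ?case using c by simp
  next
    case (Suc k)
    show ?case
    proof (rule Ck_on_SucI[OF c[OF Suc.prems(1) Ck_on_continuous[OF Suc.prems(2)]]])
      fix i b assume ib: "i < n" "b \<in> (Basis::'e set)"
      from Suc.prems(2) ib obtain u' where u': "\<And>x. x \<in> S \<Longrightarrow> has_pd u i b x (u' x)" "Ck_on k n S u'"
        by (rule Ck_on_SucD) blast
      obtain g' where g': "g' \<in> G" "\<And>s. s \<in> D \<Longrightarrow> (g has_real_derivative g' s) (at s)"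
        using G[OF Suc.prems(1)] by blast
      have "has_pd (\<lambda>x. g (u x)) i b x (u' x * g' (u x))" if x: "x \<in> S" for x
        using vector_diff_chain_at[OF u'(1)[OF x], of g "g' (u x)"] g'(2)[OF uD[OF x]]
        by (simp add: o_def has_real_derivative_iff_has_vector_derivative)
      moreover have "Ck_on k n S (\<lambda>x. u' x * g' (u x))"
        by (rule Ck_on_mult[OF u'(2) Suc.IH[OF g'(1) Ck_on_lower[OF Suc.prems(2)]]])
      ultimately show "\<exists>h. (\<forall>x\<in>S. has_pd (\<lambda>x. g (u x)) i b x (h x)) \<and> Ck_on k n S h"
        by (intro exI[of _ "\<lambda>x. u' x * g' (u x)"] conjI ballI)
    qed
  }
qed

section \<open>A smooth step function\<close>

text \<open>The functions \<open>p(1/t) exp(-1/t)\<close>, extended by zero to \<open>t \<le> 0\<close>; with all polynomials \<open>p\<close>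
  they form a family closed under differentiation.\<close>
definition flat_exp :: "real poly \<Rightarrow> real \<Rightarrow> real" where
  "flat_exp p t = (if t > 0 then poly p (1 / t) * exp (- (1 / t)) else 0)"

lemma poly_exp_tendsto_0: "((\<lambda>s. poly p s * exp (- s)) \<longlongrightarrow> 0) at_top" for p :: "real poly"
proof -
  have "((\<lambda>s. \<Sum>i\<le>degree p. coeff p i * (s ^ i / exp s)) \<longlongrightarrow> (\<Sum>i\<le>degree p. coeff p i * 0)) at_top"
    by (intro tendsto_sum tendsto_mult tendsto_const tendsto_power_div_exp_0)
  then show ?thesis
    by (simp add: poly_altdef exp_minus divide_inverse sum_distrib_right mult.assoc)
qed

lemma flat_exp_tendsto_0: "(flat_exp p \<longlongrightarrow> 0) (at 0)"
proof -
  have "filterlim (\<lambda>t::real. 1 / t) at_top (at_right 0)"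
    using filterlim_inverse_at_top_right by (simp add: inverse_eq_divide)
  from filterlim_compose[OF poly_exp_tendsto_0 this]
  have "((\<lambda>t. poly p (1 / t) * exp (- (1 / t))) \<longlongrightarrow> 0) (at_right 0)" .
  then have "(flat_exp p \<longlongrightarrow> 0) (at_right 0)"
    by (rule Lim_transform_eventually) (auto simp: flat_exp_def eventually_at_filter)
  moreover have "(flat_exp p \<longlongrightarrow> 0) (at_left 0)"
    by (rule Lim_transform_eventually[OF tendsto_const]) (auto simp: flat_exp_def eventually_at_filter)
  ultimately show ?thesis by (simp add: filterlim_split_at)
qed

text \<open>At \<open>0\<close> the difference quotient of \<open>p(1/t) exp(-1/t)\<close> is \<open>(1/t) p(1/t) exp(-1/t)\<close>, again a function of
  the family, and tends to \<open>0\<close>.\<close>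
lemma flat_exp_DERIV:
  "(flat_exp p has_real_derivative flat_exp (monom 1 2 * (p - pderiv p)) t) (at t)"
proof -
  consider "t > 0" | "t < 0" | "t = 0" by linarith
  then show ?thesis
  proof cases
    case 1
    have "((\<lambda>t. poly p (1 / t) * exp (- (1 / t))) has_real_derivative
        flat_exp (monom 1 2 * (p - pderiv p)) t) (at t)"
      using 1 by (auto intro!: derivative_eq_intros simp: flat_exp_def poly_monom field_simps power2_eq_square)
    moreover have "\<forall>\<^sub>F s in nhds t. s > 0" using eventually_nhds_in_open[of "{0<..}" t] 1 by simp
    ultimately show ?thesis
      by (subst DERIV_cong_ev[OF refl _ refl]) (auto elim: eventually_mono simp: flat_exp_def)
  next
    case 2
    have "((\<lambda>t. 0) has_real_derivative flat_exp (monom 1 2 * (p - pderiv p)) t) (at t)"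
      using 2 by (simp add: flat_exp_def)
    moreover have "\<forall>\<^sub>F s in nhds t. s < 0" using eventually_nhds_in_open[of "{..<0}" t] 2 by simp
    ultimately show ?thesis
      by (subst DERIV_cong_ev[OF refl _ refl]) (auto elim: eventually_mono simp: flat_exp_def)
  next
    case 3
    have "((\<lambda>h. (flat_exp p (0 + h) - flat_exp p 0) / h) \<longlongrightarrow> 0) (at 0)"
      by (rule Lim_transform_eventually[OF flat_exp_tendsto_0[of "[:0, 1:] * p"]])
         (auto simp: flat_exp_def eventually_at_filter)
    then show ?thesis by (simp add: 3 DERIV_def) (simp add: flat_exp_def)
  qed
qed

definition smooth_step :: "real \<Rightarrow> real" where
  "smooth_step t = flat_exp 1 t * inverse (flat_exp 1 t + flat_exp 1 (1 - t))"

lemma smooth_step_1: "t \<ge> 1 \<Longrightarrow> smooth_step t = 1"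
  by (simp add: smooth_step_def flat_exp_def)

lemma smooth_step_0: "t \<le> 0 \<Longrightarrow> smooth_step t = 0"
  by (simp add: smooth_step_def flat_exp_def)

lemma Ck_on_flat_exp: "Ck_on k n S u \<Longrightarrow> Ck_on k n S (\<lambda>x. flat_exp p (u x))"
  by (rule Ck_on_compose_real[where G = "range flat_exp" and D = UNIV])
     (use flat_exp_DERIV in auto)

lemma Ck_on_inverse:
  fixes u :: "(nat \<Rightarrow> 'e::euclidean_space) \<Rightarrow> real"
  assumes "Ck_on k n S u" "\<And>x. x \<in> S \<Longrightarrow> u x > 0"
  shows "Ck_on k n S (\<lambda>x. inverse (u x))"
proof (rule Ck_on_compose_real[where G = "{\<lambda>s. c * inverse s ^ m |c m. True}" and D = "{0<..}" and g = inverse])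
  fix g assume "g \<in> {\<lambda>s::real. c * inverse s ^ m |c m. True}"
  then obtain c m where g: "g = (\<lambda>s::real. c * inverse s ^ m)" by auto
  have "(g has_real_derivative (- real m * c) * inverse s ^ (m + 1)) (at s)" if "s > 0" for s
  proof -
    have "real m * (- (inverse s ^ Suc (Suc 0)) * inverse s ^ (m - Suc 0)) = - real m * inverse s ^ (m + 1)"
      by (cases m) (simp_all add: algebra_simps)
    then have eq: "c * (real m * (- (inverse s ^ Suc (Suc 0)) * inverse s ^ (m - Suc 0))) = (- real m * c) * inverse s ^ (m + 1)"
      by simp
    show ?thesis unfolding g eq[symmetric]
      by (intro DERIV_cmult DERIV_power DERIV_inverse) (use that in simp)
  qed
  then show "\<exists>g'\<in>{\<lambda>s. c * inverse s ^ m |c m. True}. \<forall>s\<in>{0<..}. (g has_real_derivative g' s) (at s)"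
    by (intro bexI[of _ "\<lambda>s. (- real m * c) * inverse s ^ (m + 1)"] ballI) (simp, blast)
next
  show "inverse \<in> {\<lambda>s::real. c * inverse s ^ m |c m. True}"
    by (auto intro!: exI[of _ 1])
qed (use assms in auto)

lemma Ck_on_smooth_step:
  assumes u: "Ck_on k n S u"
  shows "Ck_on k n S (\<lambda>x. smooth_step (u x))"
proof -
  have "Ck_on k n S (\<lambda>x. 1 + (- u x))"
    by (rule Ck_on_add[OF Ck_on_const Ck_on_bounded_linear[OF bounded_linear_minus[OF bounded_linear_ident] u]])
  then have u': "Ck_on k n S (\<lambda>x. 1 - u x)" by simp
  have "flat_exp 1 t + flat_exp 1 (1 - t) > 0" for t
    by (auto simp: flat_exp_def add_pos_pos)
  then show ?thesis unfolding smooth_step_def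
    by (intro Ck_on_mult Ck_on_inverse Ck_on_add Ck_on_flat_exp u u')
qed

section \<open>Hadamard's lemma\<close>

definition segment_pt :: "(nat \<Rightarrow> real) \<Rightarrow> (nat \<Rightarrow> real) \<Rightarrow> real \<Rightarrow> nat \<Rightarrow> real" where
  "segment_pt x y t = (\<lambda>i. x i + t * (y i - x i))"

lemma continuous_on_segment_pt: "continuous_on A (\<lambda>p. segment_pt x (fst p) (snd p))"
proof (rule continuous_on_coordinatewise_then_product)
  fix i
  have "continuous_on A (\<lambda>p. fst p i)"
    by (rule continuous_on_compose2[OF continuous_on_product_coordinates, of _ fst])
       (auto intro: continuous_intros)
  then show "continuous_on A (\<lambda>p. segment_pt x (fst p) (snd p) i)"
    unfolding segment_pt_def by (intro continuous_intros)
qed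

text \<open>Differentiation under the integral sign multiplies the integrand by another factor \<open>t\<close>; the
  weight \<open>t ^ m\<close> keeps the statement closed under this step.\<close>
lemma Ck_on_segment_integral:
  fixes h :: "(nat \<Rightarrow> real) \<Rightarrow> real"
  assumes S: "open_n n S" and star: "\<And>y t. y \<in> S \<Longrightarrow> t \<in> {0..1} \<Longrightarrow> segment_pt x y t \<in> S"
  shows "Ck_on (Suc k) n S h \<Longrightarrow> Ck_on k n S (\<lambda>y. integral (cbox 0 1) (\<lambda>t. t ^ m * h (segment_pt x y t)))"
proof (induction k arbitrary: h m)
  have c: "continuous_on (S \<times> cbox 0 1) (\<lambda>(y, t). t ^ m * h (segment_pt x y t))"
    if "continuous_on S h" for h m
    unfolding case_prod_unfold
    by (intro continuous_intros continuous_on_compose2[OF that continuous_on_segment_pt])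
       (use star in auto)
  note I = integral_continuous_on_param[OF c]
  {
    case 0
    show ?case using I[of h m] Ck_on_continuous[OF 0] by simp
  next
    case (Suc k)
    have hc: "continuous_on S h" by (rule Ck_on_continuous[OF Suc.prems])
    have h1: "Ck_on (Suc 0) n S h"
      using Suc.prems unfolding Ck_on_Suc_iff[OF S] by (auto dest: Ck_on_continuous)
    show ?case
    proof (rule Ck_on_SucI[OF I[OF hc]])
      fix i and b :: real assume "i < n" "b \<in> Basis"
      then have ib: "i < n" "b = 1" by auto
      have h': "Ck_on (Suc k) n S (pd i 1 h)" "\<And>y. y \<in> S \<Longrightarrow> has_pd h i 1 y (pd i 1 h y)"
        using Suc.prems ib unfolding Ck_on_Suc_iff[OF S, of "Suc k"] by auto
      have "has_pd (\<lambda>y. integral (cbox 0 1) (\<lambda>t. t ^ m * h (segment_pt x y t))) i b y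
         (integral (cbox 0 1) (\<lambda>t. t ^ (m + 1) * pd i 1 h (segment_pt x y t)))" if y: "y \<in> S" for y
      proof -
        obtain W where W: "open W" "0 \<in> W" "\<And>s. s \<in> W \<Longrightarrow> y(i := y i + s *\<^sub>R b) \<in> S"
          using eventually_line[OF S y ib(1), of b] unfolding eventually_nhds by auto
        obtain d where d: "d > 0" "ball 0 d \<subseteq> W" using W(1,2) by (meson open_contains_ball)
        define Y where "Y = ball (0::real) d"
        have Y: "open Y" "convex Y" "0 \<in> Y" using d by (auto simp: Y_def)
        define L where "L s = y(i := y i + s *\<^sub>R b)" for s
        have LS: "L s \<in> S" if "s \<in> Y" for s using W(3) d that by (auto simp: L_def Y_def)
        have Lc: "continuous_on A L" for A
        proof (rule continuous_on_coordinatewise_then_product)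
          show "continuous_on A (\<lambda>s. L s j)" for j
            by (cases "j = i") (auto simp: L_def intro!: continuous_intros)
        qed
        have "((\<lambda>s. integral (cbox 0 1) (\<lambda>t. t ^ m * h (segment_pt x (L s) t))) has_vector_derivative
           integral (cbox 0 1) (\<lambda>t. t ^ (m + 1) * pd i 1 h (segment_pt x (L 0) t))) (at 0 within Y)"
        proof (rule leibniz_rule_vector_derivative[where U = Y])
          fix s t :: real assume st: "s \<in> Y" "t \<in> cbox 0 1"
          have P: "segment_pt x (L s) t \<in> S" using star[OF LS[OF st(1)]] st(2) by auto
          have eq: "segment_pt x (L (s + r)) t = (segment_pt x (L s) t)(i := segment_pt x (L s) t i + (t * r) *\<^sub>R 1)" for r
            by (auto simp: segment_pt_def L_def ib fun_eq_iff algebra_simps)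
          have "((\<lambda>r. t * r) has_vector_derivative t) (at 0)"
            by (auto intro!: derivative_eq_intros)
          from vector_diff_chain_at[OF this, of "\<lambda>r. h ((segment_pt x (L s) t)(i := segment_pt x (L s) t i + r *\<^sub>R 1))"]
          have "((\<lambda>r. h (segment_pt x (L (s + r)) t)) has_vector_derivative t * pd i 1 h (segment_pt x (L s) t)) (at 0)"
            unfolding eq using h'(2)[OF P] by (simp add: o_def)
          then have "((\<lambda>s. h (segment_pt x (L s) t)) has_vector_derivative t * pd i 1 h (segment_pt x (L s) t)) (at s)"
            using has_vector_derivative_shift_at[of "\<lambda>s. h (segment_pt x (L s) t)" s _ 0] by simp
          then have "((\<lambda>s. t ^ m * h (segment_pt x (L s) t)) has_vector_derivative t ^ m * (t * pd i 1 h (segment_pt x (L s) t))) (at s)"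
            by (rule has_vector_derivative_mult_right)
          then show "((\<lambda>s. t ^ m * h (segment_pt x (L s) t)) has_vector_derivative t ^ (m + 1) * pd i 1 h (segment_pt x (L s) t)) (at s within Y)"
            by (simp add: mult_ac has_vector_derivative_at_within)
        next
          fix s assume s: "s \<in> Y"
          have "continuous_on (cbox 0 1) (\<lambda>t. segment_pt x (fst (L s, t)) (snd (L s, t)))"
            by (rule continuous_on_compose2[OF continuous_on_segment_pt[of UNIV]]) (auto intro!: continuous_intros)
          then have "continuous_on (cbox 0 1) (\<lambda>t. t ^ m * h (segment_pt x (L s) t))"
            by (intro continuous_on_mult continuous_on_power continuous_on_id continuous_on_compose2[OF hc])
               (use star LS[OF s] in auto)
          then show "(\<lambda>t. t ^ m * h (segment_pt x (L s) t)) integrable_on cbox 0 1"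
            by (rule integrable_continuous)
        next
          have "continuous_on (Y \<times> cbox 0 1) (\<lambda>p. (L (fst p), snd p))"
            by (intro continuous_intros continuous_on_compose2[OF Lc]) auto
          moreover have "(\<lambda>p. (L (fst p), snd p)) ` (Y \<times> cbox 0 1) \<subseteq> S \<times> cbox 0 1"
            using LS by auto
          ultimately show "continuous_on (Y \<times> cbox 0 1) (\<lambda>(s, t). t ^ (m + 1) * pd i 1 h (segment_pt x (L s) t))"
            using continuous_on_compose2[OF c[OF Ck_on_continuous[OF h'(1)], of "m + 1"]]
            unfolding case_prod_unfold by fastforce
        qed (use Y in auto)
        then show ?thesis using Y at_within_open[of 0 Y] by (simp add: L_def)
      qed
      then show "\<exists>g. (\<forall>y\<in>S. has_pd (\<lambda>y. integral (cbox 0 1) (\<lambda>t. t ^ m * h (segment_pt x y t))) i b y (g y)) \<and> Ck_on k n S g"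
        by (intro exI[of _ "\<lambda>y. integral (cbox 0 1) (\<lambda>t. t ^ (m + 1) * pd i 1 h (segment_pt x y t))"] conjI ballI Suc.IH h'(1))
    qed
  }
qed

text \<open>The functions \<open>g i\<close> are the averages of the partial derivatives of \<open>f\<close> over the segment from \<open>x\<close>
  to \<open>y\<close>; the identity is the fundamental theorem of calculus along that segment.\<close>
lemma Hadamard:
  fixes f :: "(nat \<Rightarrow> real) \<Rightarrow> real"
  assumes S: "open_n n S" and star: "\<And>y t. y \<in> S \<Longrightarrow> t \<in> {0..1} \<Longrightarrow> segment_pt x y t \<in> S"
    and x: "x \<in> S" and f: "smooth_on n S f"
  obtains g where "\<And>i. i < n \<Longrightarrow> smooth_on n S (g i)"
    and "\<And>y. y \<in> S \<Longrightarrow> f y = f x + (\<Sum>i<n. (y i - x i) * g i y)"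
proof
  define g where "g i y = integral (cbox 0 1) (\<lambda>t. t ^ 0 * pd i 1 f (segment_pt x y t))" for i y
  have f': "Ck_on k n S (pd i 1 f)" if "i < n" for i k
    using f that Ck_on_Suc_iff[OF S, of k f] by (auto simp: smooth_on_def)
  show "smooth_on n S (g i)" if "i < n" for i
    unfolding smooth_on_def g_def by (intro allI Ck_on_segment_integral[OF S star] f' that)
  fix y assume y: "y \<in> S"
  have E: "x \<in> En n" "y \<in> En n" using S x y by (auto simp: openin_open)
  have "((\<lambda>t. f (segment_pt x y t)) has_vector_derivative
      (\<Sum>i<n. (y i - x i) * pd i 1 f (segment_pt x y t))) (at t)" if t: "t \<in> {0..1}" for t
  proof -
    have "((\<lambda>t. f (segment_pt x y t)) has_vector_derivative
        (\<Sum>i<n. \<Sum>b\<in>Basis. ((y i - x i) \<bullet> b) *\<^sub>R pd i b f (segment_pt x y t))) (at t)"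
    proof (rule has_vector_derivative_along_curve[OF S])
      show "Ck_on (Suc 0) n S f" using f by (simp add: smooth_on_def del: Ck_on.simps)
      show "segment_pt x y t \<in> S" using star y t by auto
      show "segment_pt x y t \<in> En n" for t using E by (auto simp: segment_pt_def En_def)
      show "((\<lambda>t. segment_pt x y t i) has_vector_derivative y i - x i) (at t)" for i
        unfolding segment_pt_def by (auto intro!: derivative_eq_intros)
    qed
    then show ?thesis by simp
  qed
  note d = has_vector_derivative_at_within[OF this]
  have "((\<lambda>t. \<Sum>i<n. (y i - x i) * pd i 1 f (segment_pt x y t)) has_integral
      f (segment_pt x y 1) - f (segment_pt x y 0)) {0..1}"
    by (rule fundamental_theorem_of_calculus[OF zero_le_one d])
  moreover have "((\<lambda>t. \<Sum>i<n. (y i - x i) * pd i 1 f (segment_pt x y t)) has_integral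
      (\<Sum>i<n. (y i - x i) * g i y)) {0..1}"
  proof (intro has_integral_sum has_integral_mult_right)
    fix i assume "i \<in> {..<n}"
    then have c: "continuous_on S (pd i 1 f)" using f'[of i 0] by simp
    have "continuous_on {0..1} (\<lambda>t. segment_pt x (fst (y, t)) (snd (y, t)))"
      by (rule continuous_on_compose2[OF continuous_on_segment_pt[of UNIV]]) (auto intro!: continuous_intros)
    then have "continuous_on {0..1} (\<lambda>t. pd i 1 f (segment_pt x y t))"
      by (intro continuous_on_compose2[OF c]) (use star y in auto)
    then show "((\<lambda>t. pd i 1 f (segment_pt x y t)) has_integral g i y) {0..1}"
      using integrable_integral[OF integrable_continuous_interval] by (simp add: g_def)
  qed auto
  ultimately have "f (segment_pt x y 1) - f (segment_pt x y 0) = (\<Sum>i<n. (y i - x i) * g i y)"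
    by (rule has_integral_unique)
  then show "f y = f x + (\<Sum>i<n. (y i - x i) * g i y)" by (simp add: segment_pt_def)
qed

section \<open>Units and nilpotents of a Weil algebra\<close>

lemma ideal_of_ring_subspace:
  fixes I :: "'a::{comm_ring_1, real_algebra_1} set"
  assumes "ideal_of_ring I" shows "subspace I"
proof (rule subspaceI)
  fix c x assume "x \<in> I"
  then have "of_real c * x \<in> I" using assms by (auto simp: ideal_of_ring_def)
  then show "c *\<^sub>R x \<in> I" by (simp add: scaleR_conv_of_real)
qed (use assms in \<open>auto simp: ideal_of_ring_def\<close>)

lemma ideal_of_ring_range_mult: "ideal_of_ring (range ((*) x))" for x :: "'a::comm_ring_1"
  unfolding ideal_of_ring_def
proof (intro conjI ballI allI)
  show "0 \<in> range ((*) x)" by (auto intro: range_eqI[of _ _ 0])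
  show "u + v \<in> range ((*) x)" if "u \<in> range ((*) x)" "v \<in> range ((*) x)" for u v
    using that by (auto simp: distrib_left[symmetric])
  show "a * u \<in> range ((*) x)" if u: "u \<in> range ((*) x)" for a u
  proof -
    obtain w where "u = x * w" using u by auto
    then have "a * u = x * (a * w)" by (simp add: mult.left_commute)
    then show ?thesis by blast
  qed
qed

text \<open>Ideals are subspaces, so a proper ideal of largest dimension is maximal.\<close>
lemma exists_maximal_ideal_of_ring:
  fixes I :: "'a::{comm_ring_1, real_algebra_1, euclidean_space} set"
  assumes "ideal_of_ring I" "I \<noteq> UNIV"
  obtains J where "maximal_ideal_of_ring J" "I \<subseteq> J"
proof -
  let ?P = "\<lambda>J. ideal_of_ring J \<and> J \<noteq> UNIV \<and> I \<subseteq> J"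
  have "\<exists>J. ?P J \<and> (\<forall>K. ?P K \<longrightarrow> dim K \<le> dim J)"
  proof (rule Lattices_Big.ex_has_greatest_nat)
    show "?P I" using assms by simp
    show "\<forall>K. ?P K \<longrightarrow> dim K < Suc DIM('a)"
      by (simp add: dim_subset_UNIV less_Suc_eq_le)
  qed
  then obtain J where J: "?P J" "\<And>K. ?P K \<Longrightarrow> dim K \<le> dim J" by blast
  have "maximal_ideal_of_ring J"
    unfolding maximal_ideal_of_ring_def
  proof (intro conjI allI impI)
    fix K assume K: "ideal_of_ring K \<and> J \<subseteq> K"
    show "K = J \<or> K = UNIV"
    proof (rule disjCI)
      assume "K \<noteq> UNIV"
      then have "dim K \<le> dim J" using J K by auto
      then show "K = J"
        using subspace_dim_equal[of J K] J(1) K ideal_of_ring_subspace by blast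
    qed
  qed (use J in auto)
  then show ?thesis using J that by blast
qed

context weil_algebra
begin

lemma ideal_m: "ideal_of_ring \<mm>"
  using maximal by (simp add: maximal_ideal_of_ring_def)

lemma m_closed:
  shows m_zero: "0 \<in> \<mm>" and m_add: "x \<in> \<mm> \<Longrightarrow> y \<in> \<mm> \<Longrightarrow> x + y \<in> \<mm>"
    and m_mult: "x \<in> \<mm> \<Longrightarrow> a * x \<in> \<mm>"
  using ideal_m by (auto simp: ideal_of_ring_def)

lemma subspace_m: "subspace \<mm>" by (rule ideal_of_ring_subspace[OF ideal_m])

lemma m_diff: "x \<in> \<mm> \<Longrightarrow> y \<in> \<mm> \<Longrightarrow> x - y \<in> \<mm>"
  by (rule subspace_diff[OF subspace_m])

lemma one_notin_m: "1 \<notin> \<mm>"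
proof
  assume "1 \<in> \<mm>"
  then have "a \<in> \<mm>" for a using m_mult[of 1 a] by simp
  then show False using maximal by (auto simp: maximal_ideal_of_ring_def)
qed

text \<open>The principal ideal of a non-unit is proper, hence lies in a maximal ideal, of which there is
  only one.\<close>
lemma unit_if_notin_m:
  assumes "x \<notin> \<mm>" obtains y where "x * y = 1"
proof (cases "range ((*) x) = UNIV")
  case True
  then have "1 \<in> range ((*) x)" by simp
  then show ?thesis using that by (metis imageE)
next
  case False
  from ideal_of_ring_range_mult False obtain J where J: "maximal_ideal_of_ring J" "range ((*) x) \<subseteq> J"
    by (rule exists_maximal_ideal_of_ring)
  moreover have "x \<in> range ((*) x)" by (auto intro: range_eqI[of _ _ 1])
  ultimately show ?thesis using unique assms by blast
qed

text \<open>As long as \<open>x ^ k\<close> is nonzero, the principal ideals of \<open>1, x, x\<^sup>2, \<dots>, x ^ k\<close> have strictly decreasing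
  dimensions: if two consecutive ones were equal, \<open>x ^ k = x ^ (k + 1) * a\<close>, and \<open>1 - x * a\<close> is a unit.\<close>
lemma nilpotent:
  assumes x: "x \<in> \<mm>" shows "x ^ DIM('a) = 0"
proof -
  have dim: "x ^ k \<noteq> 0 \<Longrightarrow> dim (range ((*) (x ^ k))) + k \<le> DIM('a)" for k
  proof (induction k)
    case 0
    then show ?case by (simp add: dim_subset_UNIV)
  next
    case (Suc k)
    let ?V = "\<lambda>k. range ((*) (x ^ k))"
    have sub: "?V (Suc k) \<subseteq> ?V k"
    proof
      fix y assume "y \<in> ?V (Suc k)"
      then obtain a where "y = x ^ k * (x * a)" by (auto simp: mult_ac)
      then show "y \<in> ?V k" by blast
    qed
    have "?V (Suc k) \<noteq> ?V k"
    proof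
      assume "?V (Suc k) = ?V k"
      moreover have "x ^ k \<in> ?V k" by (auto intro: range_eqI[of _ _ 1])
      ultimately obtain a where a: "x ^ k = x ^ Suc k * a" by auto
      have "1 - x * a \<notin> \<mm>"
        using m_add[of "1 - x * a" "a * x"] m_mult[OF x, of a] one_notin_m by (auto simp: mult.commute)
      then obtain y where y: "(1 - x * a) * y = 1" by (rule unit_if_notin_m)
      have "x ^ k = x ^ k * ((1 - x * a) * y)" using y by simp
      also have "\<dots> = (x ^ k - x ^ Suc k * a) * y" by (simp add: algebra_simps)
      also have "\<dots> = 0" using a by simp
      finally show False using Suc.prems by simp
    qed
    then have "dim (?V (Suc k)) \<noteq> dim (?V k)"
      using sub subspace_dim_equal[of "?V (Suc k)" "?V k"] ideal_of_ring_subspace[OF ideal_of_ring_range_mult]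
      by (metis order_refl)
    then have "dim (?V (Suc k)) < dim (?V k)" using dim_subset[OF sub] by linarith
    moreover have "x ^ k \<noteq> 0" using Suc.prems by auto
    ultimately show ?case using Suc.IH by linarith
  qed
  \<comment> \<open>a nonzero power \<open>x ^ DIM('a)\<close> would generate an ideal of dimension zero\<close>
  show ?thesis
  proof (rule ccontr)
    assume nz: "x ^ DIM('a) \<noteq> 0"
    then have "dim (range ((*) (x ^ DIM('a)))) = 0" using dim[of "DIM('a)"] by simp
    then have "range ((*) (x ^ DIM('a))) \<subseteq> {0}" by simp
    then show False using nz by (metis mult.right_neutral rangeI singletonD subsetD)
  qed
qed

text \<open>The projection onto the real part along the maximal ideal.\<close>
definition body :: "'a \<Rightarrow> real" where
  "body x = (THE r. x - of_real r \<in> \<mm>)"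

lemma of_real_in_m: "of_real r \<in> \<mm> \<longleftrightarrow> r = 0"
proof
  assume r: "of_real r \<in> \<mm>"
  show "r = 0"
  proof (rule ccontr)
    assume "r \<noteq> 0"
    then have "of_real (1 / r) * of_real r = (1::'a)" by (simp flip: of_real_mult)
    then show False using m_mult[OF r, of "of_real (1 / r)"] one_notin_m by simp
  qed
qed (simp add: m_zero)

lemma body_unique: "x - of_real r \<in> \<mm> \<Longrightarrow> x - of_real s \<in> \<mm> \<Longrightarrow> r = s"
  using m_diff[of "x - of_real r" "x - of_real s"] of_real_in_m[of "s - r"] by simp

lemma minus_body_in_m: "x - of_real (body x) \<in> \<mm>"
proof -
  have "dim (insert 1 \<mm>) = DIM('a)"
    using codimension_1 one_notin_m subspace_m by (simp add: dim_insert span_eq_iff[THEN iffD2])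
  then have "span (insert 1 \<mm>) = UNIV" using dim_eq_full by blast
  then have "x \<in> span (insert 1 \<mm>)" by simp
  then obtain k where "x - k *\<^sub>R 1 \<in> span \<mm>" by (auto simp: span_breakdown_eq)
  then have "x - of_real k \<in> \<mm>" using subspace_m by (simp add: of_real_def span_eq_iff[THEN iffD2])
  then show ?thesis unfolding body_def using body_unique by (metis (mono_tags, lifting) theI)
qed

lemma body_eqI: "x - of_real r \<in> \<mm> \<Longrightarrow> body x = r"
  using body_unique minus_body_in_m by blast

lemma body_of_real [simp]: "body (of_real r) = r"
  by (rule body_eqI) (simp add: m_zero)

lemma body_0 [simp]: "body 0 = 0" using body_of_real[of 0] by simp

lemma linear_body: "linear body"
proof (rule linearI)
  fix x y :: 'a and r
  show "body (x + y) = body x + body y"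
    using m_add[OF minus_body_in_m[of x] minus_body_in_m[of y]] by (intro body_eqI) (simp add: algebra_simps)
  show "body (r *\<^sub>R x) = r *\<^sub>R body x"
    using m_mult[OF minus_body_in_m[of x], of "of_real r"]
    by (intro body_eqI) (simp add: algebra_simps scaleR_conv_of_real)
qed

lemma bounded_linear_body: "bounded_linear body"
  using linear_body by (simp add: linear_conv_bounded_linear)

end

section \<open>Prolongation of smooth functions to the Weil algebra\<close>

definition bodies :: "'a set \<Rightarrow> (nat \<Rightarrow> 'a::{comm_ring_1, real_algebra_1, euclidean_space}) \<Rightarrow> nat \<Rightarrow> real"
  where "bodies \<mm> a = (\<lambda>i. weil_algebra.body \<mm> (a i))"

definition nils :: "'a set \<Rightarrow> (nat \<Rightarrow> 'a::{comm_ring_1, real_algebra_1, euclidean_space}) \<Rightarrow> nat \<Rightarrow> 'a"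
  where "nils \<mm> a = (\<lambda>i. a i - of_real (weil_algebra.body \<mm> (a i)))"

text \<open>By the pigeonhole principle one of the \<open>n\<close> factors occurs at least \<open>d\<close> times.\<close>
lemma prod_mset_nilpotent:
  fixes \<nu> :: "nat \<Rightarrow> 'a::comm_ring_1"
  assumes "\<And>i. i < n \<Longrightarrow> \<nu> i ^ d = 0" "set_mset M \<subseteq> {..<n}" "size M > n * d"
  shows "(\<Prod>i\<in>#M. \<nu> i) = 0"
proof -
  have "\<exists>i<n. count M i \<ge> d"
  proof (rule ccontr)
    assume "\<not> ?thesis"
    then have "(\<Sum>i<n. count M i) \<le> (\<Sum>i<n. d)" by (intro sum_mono) (auto simp: not_le)
    moreover have "size M = (\<Sum>i<n. count M i)"
      unfolding size_multiset_overloaded_eq using assms(2)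
      by (intro sum.mono_neutral_left) (auto simp: not_in_iff)
    ultimately show False using assms(3) by simp
  qed
  then obtain i where i: "i < n" "count M i \<ge> d" by auto
  then have "replicate_mset d i \<subseteq># M" by (simp add: count_le_replicate_mset_subset_eq)
  then obtain R where "M = replicate_mset d i + R" by (auto simp: subset_mset.le_iff_add)
  then show ?thesis using assms(1)[OF i(1)] by simp
qed

text \<open>The \<open>j\<close>-th power of the derivation \<open>\<Sum>i<n. \<nu>\<^sub>i \<partial>\<^sub>i\<close>, divided by \<open>j!\<close>, applied to \<open>f\<close> and evaluated at \<open>x\<close>.\<close>
primrec taylor_term ::
  "nat \<Rightarrow> nat \<Rightarrow> ((nat \<Rightarrow> real) \<Rightarrow> real) \<Rightarrow> (nat \<Rightarrow> real) \<Rightarrow> (nat \<Rightarrow> 'a::{comm_ring_1, real_algebra_1}) \<Rightarrow> 'a"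
where
  "taylor_term n 0 f x \<nu> = of_real (f x)"
| "taylor_term n (Suc j) f x \<nu> = (1 / Suc j) *\<^sub>R (\<Sum>i<n. \<nu> i * taylor_term n j (pd i 1 f) x \<nu>)"

text \<open>The exponential series breaks off after \<open>j = n * DIM('a)\<close>, because longer products of the
  entries of \<open>nils \<mm> a\<close> vanish.\<close>
definition prolong ::
  "'a set \<Rightarrow> nat \<Rightarrow> ((nat \<Rightarrow> real) \<Rightarrow> real) \<Rightarrow> (nat \<Rightarrow> 'a::{comm_ring_1, real_algebra_1, euclidean_space}) \<Rightarrow> 'a"
where
  "prolong \<mm> n f a = (\<Sum>j\<le>n * DIM('a). taylor_term n j f (bodies \<mm> a) (nils \<mm> a))"

lemma taylor_term_cong:
  assumes "open_n n S" "x \<in> S"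
  shows "(\<And>y. y \<in> S \<Longrightarrow> f y = g y) \<Longrightarrow> taylor_term n j f x \<nu> = taylor_term n j g x \<nu>"
proof (induction j arbitrary: f g)
  case 0
  then show ?case using assms by simp
next
  case (Suc j)
  have "taylor_term n j (pd i 1 f) x \<nu> = taylor_term n j (pd i 1 g) x \<nu>" if "i < n" for i
    by (rule Suc.IH) (rule pd_cong[OF assms(1) Suc.prems _ that])
  then show ?case by simp
qed

text \<open>Every term of the Taylor sum of order \<open>j\<close> is a combination of products of \<open>j\<close> nilpotents; the
  multiset collects the factors that have already been split off.\<close>
lemma taylor_term_vanish:
  fixes \<nu> :: "nat \<Rightarrow> 'a::{comm_ring_1, real_algebra_1}"
  assumes "\<And>i. i < n \<Longrightarrow> \<nu> i ^ d = 0"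
  shows "set_mset M \<subseteq> {..<n} \<Longrightarrow> size M + j > n * d \<Longrightarrow> (\<Prod>i\<in>#M. \<nu> i) * taylor_term n j f x \<nu> = 0"
proof (induction j arbitrary: M f)
  case 0
  then show ?case using prod_mset_nilpotent[where n = n and d = d and \<nu> = \<nu> and M = M] assms by simp
next
  case (Suc j)
  have "(\<Prod>i\<in>#M. \<nu> i) * (\<nu> i * taylor_term n j (pd i 1 f) x \<nu>) = 0" if "i < n" for i
    using Suc.IH[of "add_mset i M" "pd i 1 f"] Suc.prems that by (simp add: mult_ac)
  then show ?case by (simp add: sum_distrib_left)
qed

lemma taylor_term_mult_vanish:
  fixes \<nu> :: "nat \<Rightarrow> 'a::{comm_ring_1, real_algebra_1}"
  assumes "\<And>i. i < n \<Longrightarrow> \<nu> i ^ d = 0"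
  shows "set_mset M \<subseteq> {..<n} \<Longrightarrow> size M + j + l > n * d \<Longrightarrow>
    (\<Prod>i\<in>#M. \<nu> i) * (taylor_term n j f x \<nu> * taylor_term n l g x \<nu>) = 0"
proof (induction j arbitrary: M f)
  case 0
  then have "(\<Prod>i\<in>#M. \<nu> i) * taylor_term n l g x \<nu> = 0"
    using taylor_term_vanish[of n \<nu> d M l g x] assms by simp
  then show ?case by (simp add: mult.left_commute)
next
  case (Suc j)
  have "(\<Prod>i\<in>#M. \<nu> i) * (\<nu> i * taylor_term n j (pd i 1 f) x \<nu> * taylor_term n l g x \<nu>) = 0" if "i < n" for i
    using Suc.IH[of "add_mset i M" "pd i 1 f"] Suc.prems that by (simp add: mult_ac)
  then show ?case by (simp add: sum_distrib_left sum_distrib_right)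
qed

lemma taylor_term_add:
  assumes "open_n n S" "x \<in> S"
  shows "smooth_on n S f \<Longrightarrow> smooth_on n S g \<Longrightarrow>
    taylor_term n j (\<lambda>y. f y + g y) x \<nu> = taylor_term n j f x \<nu> + taylor_term n j g x \<nu>"
proof (induction j arbitrary: f g)
  case (Suc j)
  have "taylor_term n j (pd i 1 (\<lambda>y. f y + g y)) x \<nu> =
      taylor_term n j (pd i 1 f) x \<nu> + taylor_term n j (pd i 1 g) x \<nu>" if "i < n" for i
  proof -
    have "pd i 1 (\<lambda>y. f y + g y) y = pd i 1 f y + pd i 1 g y" if "y \<in> S" for y
      using smooth_on_pd(2)[OF assms(1) _ \<open>i < n\<close> _ that, of _ 1] Suc.prems
      by (intro has_pd_imp_pd has_vector_derivative_add) auto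
    then have "taylor_term n j (pd i 1 (\<lambda>y. f y + g y)) x \<nu> = taylor_term n j (\<lambda>y. pd i 1 f y + pd i 1 g y) x \<nu>"
      by (rule taylor_term_cong[OF assms])
    also have "\<dots> = taylor_term n j (pd i 1 f) x \<nu> + taylor_term n j (pd i 1 g) x \<nu>"
      by (rule Suc.IH) (use smooth_on_pd(1)[OF assms(1) _ that, of _ 1] Suc.prems in auto)
    finally show ?thesis .
  qed
  then show ?case by (simp add: distrib_left sum.distrib scaleR_add_right)
qed simp

text \<open>The general Leibniz rule; the factor \<open>1/j!\<close> in \<open>taylor_term\<close> removes the binomial coefficients.\<close>
lemma taylor_term_mult:
  assumes "open_n n S" "x \<in> S"
  shows "smooth_on n S f \<Longrightarrow> smooth_on n S g \<Longrightarrow>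
    taylor_term n k (\<lambda>y. f y * g y) x \<nu> = (\<Sum>j\<le>k. taylor_term n j f x \<nu> * taylor_term n (k - j) g x \<nu>)"
proof (induction k arbitrary: f g)
  case (Suc k)
  let ?t = "\<lambda>j f. taylor_term n j f x \<nu>"
  have S: "real (Suc j) *\<^sub>R ?t (Suc j) f = (\<Sum>i<n. \<nu> i * ?t j (pd i 1 f))" for j f
    by simp
  have step: "?t k (pd i 1 (\<lambda>y. f y * g y)) =
      (\<Sum>j\<le>k. ?t j (pd i 1 f) * ?t (k - j) g) + (\<Sum>j\<le>k. ?t j f * ?t (k - j) (pd i 1 g))" if i: "i < n" for i
  proof -
    have sm: "smooth_on n S (pd i 1 f)" "smooth_on n S (pd i 1 g)"
      using smooth_on_pd(1)[OF assms(1) _ i, of _ 1] Suc.prems by auto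
    have "pd i 1 (\<lambda>y. f y * g y) y = pd i 1 f y * g y + f y * pd i 1 g y" if "y \<in> S" for y
    proof (rule has_pd_imp_pd)
      define L where "L t = y(i := y i + t *\<^sub>R 1)" for t
      have "((\<lambda>t. f (L t)) has_vector_derivative pd i 1 f y) (at 0)"
        "((\<lambda>t. g (L t)) has_vector_derivative pd i 1 g y) (at 0)"
        unfolding L_def by (rule smooth_on_pd(2)[OF assms(1) _ i _ that]; use Suc.prems in simp)+
      from has_vector_derivative_mult[OF this]
      have "((\<lambda>t. f (L t) * g (L t)) has_vector_derivative pd i 1 f y * g y + f y * pd i 1 g y) (at 0)"
        by (simp add: add.commute L_def)
      then show "has_pd (\<lambda>y. f y * g y) i 1 y (pd i 1 f y * g y + f y * pd i 1 g y)" unfolding L_def .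
    qed
    then have "?t k (pd i 1 (\<lambda>y. f y * g y)) = ?t k (\<lambda>y. pd i 1 f y * g y + f y * pd i 1 g y)"
      by (rule taylor_term_cong[OF assms])
    also have "\<dots> = ?t k (\<lambda>y. pd i 1 f y * g y) + ?t k (\<lambda>y. f y * pd i 1 g y)"
      by (intro taylor_term_add[OF assms] smooth_on_mult sm Suc.prems)
    also have "\<dots> = (\<Sum>j\<le>k. ?t j (pd i 1 f) * ?t (k - j) g) + (\<Sum>j\<le>k. ?t j f * ?t (k - j) (pd i 1 g))"
      by (simp add: Suc.IH sm Suc.prems)
    finally show ?thesis .
  qed
  have "real (Suc k) *\<^sub>R ?t (Suc k) (\<lambda>y. f y * g y) =
      (\<Sum>i<n. \<nu> i * ((\<Sum>j\<le>k. ?t j (pd i 1 f) * ?t (k - j) g) + (\<Sum>j\<le>k. ?t j f * ?t (k - j) (pd i 1 g))))"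
    unfolding S using step by simp
  also have "\<dots> = (\<Sum>j\<le>k. (\<Sum>i<n. \<nu> i * ?t j (pd i 1 f)) * ?t (k - j) g)
      + (\<Sum>j\<le>k. ?t j f * (\<Sum>i<n. \<nu> i * ?t (k - j) (pd i 1 g)))"
    by (simp add: distrib_left sum.distrib sum_distrib_left sum_distrib_right mult_ac sum.swap[of _ _ "{..k}"])
  also have "\<dots> = (\<Sum>j\<le>k. real (Suc j) *\<^sub>R (?t (Suc j) f * ?t (k - j) g))
      + (\<Sum>j\<le>k. real (Suc (k - j)) *\<^sub>R (?t j f * ?t (Suc (k - j)) g))"
    unfolding S[symmetric] by (simp only: mult_scaleR_left mult_scaleR_right)
  \<comment> \<open>extend both sums by terms with coefficient zero to a common index range\<close>
  also have "(\<Sum>j\<le>k. real (Suc j) *\<^sub>R (?t (Suc j) f * ?t (k - j) g)) =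
      (\<Sum>j\<le>Suc k. real j *\<^sub>R (?t j f * ?t (Suc k - j) g))"
    by (subst sum.atMost_Suc_shift) (simp del: taylor_term.simps)
  also have "(\<Sum>j\<le>k. real (Suc (k - j)) *\<^sub>R (?t j f * ?t (Suc (k - j)) g)) =
      (\<Sum>j\<le>Suc k. real (Suc k - j) *\<^sub>R (?t j f * ?t (Suc k - j) g))"
    by (simp add: Suc_diff_le add_diff_eq del: taylor_term.simps)
  also have "(\<Sum>j\<le>Suc k. real j *\<^sub>R (?t j f * ?t (Suc k - j) g)) + \<dots> =
      real (Suc k) *\<^sub>R (\<Sum>j\<le>Suc k. ?t j f * ?t (Suc k - j) g)"
    unfolding scaleR_sum_right sum.distrib[symmetric]
    by (intro sum.cong refl) (simp add: scaleR_add_left[symmetric] of_nat_diff del: taylor_term.simps)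
  finally show ?case by (simp del: taylor_term.simps sum.atMost_Suc)
qed simp

lemma taylor_term_const: "taylor_term n (Suc j) (\<lambda>_. c) x \<nu> = 0"
proof -
  have "taylor_term n j (\<lambda>_. 0) x \<nu> = 0" for j by (induction j) (simp_all add: pd_const)
  then show ?thesis by (simp add: pd_const)
qed

lemma taylor_term_coordinate:
  "i < n \<Longrightarrow> taylor_term n (Suc j) (\<lambda>x. x i) x \<nu> = (if j = 0 then \<nu> i else 0)"
proof (cases j)
  case 0
  assume "i < n"
  then show ?thesis by (simp add: 0 pd_coordinate if_distrib[of of_real] if_distrib[of "(*) _"] cong: if_cong)
next
  case (Suc j')
  then show ?thesis
    by (simp only: taylor_term.simps(2)[of n "Suc j'"] pd_coordinate taylor_term_const) simp
qed

context weil_algebra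
begin

lemma nils_nilpotent: "nils \<mm> a i ^ DIM('a) = 0"
  by (rule nilpotent) (simp add: nils_def minus_body_in_m)

lemma prolong_cong:
  assumes "open_n n S" "bodies \<mm> a \<in> S" "\<And>y. y \<in> S \<Longrightarrow> f y = g y"
  shows "prolong \<mm> n f a = prolong \<mm> n g a"
  unfolding prolong_def by (intro sum.cong refl taylor_term_cong[OF assms(1,2)] assms(3))

lemma prolong_add:
  assumes "open_n n S" "bodies \<mm> a \<in> S" "smooth_on n S f" "smooth_on n S g"
  shows "prolong \<mm> n (\<lambda>y. f y + g y) a = prolong \<mm> n f a + prolong \<mm> n g a"
  unfolding prolong_def by (simp add: sum.distrib taylor_term_add[OF assms])

text \<open>The exponential of a nilpotent derivation is multiplicative: in the product of the two sums
  the terms of total order above \<open>n * DIM('a)\<close> vanish.\<close>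
lemma prolong_mult:
  assumes "open_n n S" "bodies \<mm> a \<in> S" "smooth_on n S f" "smooth_on n S g"
  shows "prolong \<mm> n (\<lambda>y. f y * g y) a = prolong \<mm> n f a * prolong \<mm> n g a"
proof -
  let ?N = "n * DIM('a)"
  let ?t = "\<lambda>j f. taylor_term n j f (bodies \<mm> a) (nils \<mm> a)"
  have van: "?t j f * ?t l g = 0" if "j + l > ?N" for j l
    using taylor_term_mult_vanish[of n "nils \<mm> a" "DIM('a)" "{#}" j l] nils_nilpotent that by simp
  have "prolong \<mm> n (\<lambda>y. f y * g y) a = (\<Sum>k\<le>?N. \<Sum>j\<le>k. ?t j f * ?t (k - j) g)"
    unfolding prolong_def by (simp add: taylor_term_mult[OF assms])
  also have "\<dots> = (\<Sum>(j, l)\<in>{(j, l). j + l \<le> ?N}. ?t j f * ?t l g)"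
    by (rule sum.triangle_reindex_eq[symmetric])
  also have "\<dots> = (\<Sum>(j, l)\<in>{..?N} \<times> {..?N}. ?t j f * ?t l g)"
    by (rule sum.mono_neutral_left) (auto intro: van)
  also have "\<dots> = prolong \<mm> n f a * prolong \<mm> n g a"
    by (simp add: prolong_def sum_product sum.cartesian_product)
  finally show ?thesis .
qed

lemma prolong_const: "prolong \<mm> n (\<lambda>_. c) a = of_real c"
  unfolding prolong_def atMost_atLeast0 by (subst sum.atLeast_Suc_atMost) (auto simp: taylor_term_const gr0_conv_Suc Suc_le_eq simp del: taylor_term.simps(2) intro!: sum.neutral)

lemma prolong_coordinate:
  assumes "i < n" shows "prolong \<mm> n (\<lambda>x. x i) a = a i"
proof -
  have "n * DIM('a) > 0" using assms by simp
  then obtain N where N: "n * DIM('a) = Suc N" by (cases "n * DIM('a)") auto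
  have "prolong \<mm> n (\<lambda>x. x i) a = of_real (bodies \<mm> a i) + nils \<mm> a i"
    unfolding prolong_def N by (subst sum.atMost_Suc_shift)
      (simp add: taylor_term_coordinate[OF assms] del: taylor_term.simps(2))
  then show ?thesis by (simp add: bodies_def nils_def)
qed

lemma prolong_minus_value_in_m: "prolong \<mm> n f a - of_real (f (bodies \<mm> a)) \<in> \<mm>"
proof -
  let ?t = "\<lambda>j. taylor_term n j f (bodies \<mm> a) (nils \<mm> a)"
  have nm: "nils \<mm> a i \<in> \<mm>" for i by (simp add: nils_def minus_body_in_m)
  have "?t (Suc j) \<in> \<mm>" for j
    unfolding taylor_term.simps
    by (intro subspace_mul[OF subspace_m] subspace_sum[OF subspace_m]) (metis m_mult mult.commute nm)
  then have "(\<Sum>j\<in>{1..n * DIM('a)}. ?t j) \<in> \<mm>"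
    by (intro subspace_sum[OF subspace_m]) (metis Suc_pred' atLeastAtMost_iff less_eq_Suc_le One_nat_def)
  moreover have "prolong \<mm> n f a = of_real (f (bodies \<mm> a)) + (\<Sum>j\<in>{1..n * DIM('a)}. ?t j)"
    unfolding prolong_def atMost_atLeast0 by (subst sum.atLeast_Suc_atMost) simp_all
  ultimately show ?thesis by simp
qed

definition over :: "nat \<Rightarrow> (nat \<Rightarrow> real) set \<Rightarrow> (nat \<Rightarrow> 'a) set" where
  "over n S = {a \<in> En n. bodies \<mm> a \<in> S}"

lemma continuous_on_bodies: "continuous_on A (bodies \<mm>)"
  unfolding bodies_def
  by (intro continuous_on_coordinatewise_then_product bounded_linear.continuous_on[OF bounded_linear_body]
      continuous_on_subset[OF continuous_on_product_coordinates]) auto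

lemma bodies_En: "a \<in> En n \<Longrightarrow> bodies \<mm> a \<in> En n"
  by (auto simp: En_def bodies_def)

lemma open_n_over: assumes "open_n n S" shows "open_n n (over n S)"
proof -
  obtain T where T: "open T" "S = En n \<inter> T" using assms by (auto simp: openin_open)
  have "over n S = En n \<inter> bodies \<mm> -` T" using T(2) bodies_En by (auto simp: over_def)
  moreover have "open (bodies \<mm> -` T)"
    using continuous_on_bodies[of UNIV] T(1) by (simp add: continuous_on_open_vimage)
  ultimately show ?thesis by (auto simp: openin_open)
qed

text \<open>The body and the nilpotent part are linear in \<open>a\<close>, and \<open>taylor_term\<close> is polynomial in the latter with
  coefficients that are derivatives of \<open>f\<close> at the former.\<close>
lemma smooth_on_prolong:
  assumes S: "open_n n S" and f: "smooth_on n S f"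
  shows "smooth_on n (over n S) (prolong \<mm> n f)"
proof -
  note SA = open_n_over[OF S]
  have nil: "Ck_on k n (over n S) (\<lambda>a. nils \<mm> a i)" for i k
    unfolding nils_def
    by (rule Ck_on_coordinate)
       (intro bounded_linear_sub bounded_linear_ident bounded_linear_compose[OF bounded_linear_of_real bounded_linear_body])
  have "Ck_on k n (over n S) (\<lambda>a. taylor_term n j f (bodies \<mm> a) (nils \<mm> a))"
    if "smooth_on n S f" for f j k
    using that
  proof (induction j arbitrary: f)
    case 0
    have "Ck_on k n (over n S) (\<lambda>a. f (bodies \<mm> a))"
    proof (rule Ck_on_compose[where h = f and T = "bodies \<mm>", OF SA S])
      show "Ck_on k n S f" using 0 by (simp add: smooth_on_def)
      show "Ck_on k n (over n S) (\<lambda>a. bodies \<mm> a j)" for j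
        unfolding bodies_def by (rule Ck_on_coordinate[OF bounded_linear_body])
    qed (simp add: over_def)
    then show ?case by (simp add: Ck_on_bounded_linear[OF bounded_linear_of_real])
  next
    case (Suc j)
    have "Ck_on k n (over n S) (\<lambda>a. nils \<mm> a i * taylor_term n j (pd i 1 f) (bodies \<mm> a) (nils \<mm> a))"
      if "i < n" for i
      by (intro Ck_on_bilinear[OF bounded_bilinear_times] nil Suc.IH smooth_on_pd(1)[OF S Suc.prems that]) simp
    then have "Ck_on k n (over n S) (\<lambda>a. \<Sum>i<n. nils \<mm> a i * taylor_term n j (pd i 1 f) (bodies \<mm> a) (nils \<mm> a))"
      by (intro Ck_on_sum) simp
    from Ck_on_bounded_linear[OF bounded_linear_scaleR_right this] show ?case
      by (simp only: taylor_term.simps)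
  qed
  from this[OF f] have "Ck_on k n (over n S) (\<lambda>a. \<Sum>j\<le>n * DIM('a). taylor_term n j f (bodies \<mm> a) (nils \<mm> a))" for k
    by (intro Ck_on_sum)
  then show ?thesis by (simp add: smooth_on_def prolong_def[abs_def])
qed

end

section \<open>Bump functions on the manifold\<close>

lemma smooth_functionsD:
  assumes "f \<in> smooth_functions S n \<A>"
  shows "(U, c) \<in> \<A> \<Longrightarrow> smooth_on n (c ` U) (\<lambda>x. f (inv_into U c x))" "p \<notin> S \<Longrightarrow> f p = 0"
  using assms by (auto simp: smooth_functions_def)

lemma smooth_functionsI:
  assumes "\<And>U c. (U, c) \<in> \<A> \<Longrightarrow> smooth_on n (c ` U) (\<lambda>x. f (inv_into U c x))" "\<And>p. p \<notin> S \<Longrightarrow> f p = 0"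
  shows "f \<in> smooth_functions S n \<A>"
  using assms by (auto simp: smooth_functions_def)

lemma smooth_functions_add:
  "f \<in> smooth_functions S n \<A> \<Longrightarrow> g \<in> smooth_functions S n \<A> \<Longrightarrow> (\<lambda>p. f p + g p) \<in> smooth_functions S n \<A>"
  by (auto intro!: smooth_functionsI smooth_on_add dest: smooth_functionsD(1) simp: smooth_functionsD(2))

lemma smooth_functions_mult:
  fixes f g :: "'q \<Rightarrow> 'a::{real_algebra_1, euclidean_space}"
  shows "f \<in> smooth_functions S n \<A> \<Longrightarrow> g \<in> smooth_functions S n \<A> \<Longrightarrow> (\<lambda>p. f p * g p) \<in> smooth_functions S n \<A>"
  by (auto intro!: smooth_functionsI smooth_on_mult dest: smooth_functionsD(1) simp: smooth_functionsD(2))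

lemma smooth_functions_cmult:
  fixes f :: "'q \<Rightarrow> 'a::{real_algebra_1, euclidean_space}"
  shows "f \<in> smooth_functions S n \<A> \<Longrightarrow> (\<lambda>p. a * f p) \<in> smooth_functions S n \<A>"
  by (auto intro!: smooth_functionsI smooth_on_mult[where f = "\<lambda>_. a"] smooth_on_const
      dest: smooth_functionsD(1) simp: smooth_functionsD(2))

lemma smooth_functions_zero: "(\<lambda>p. 0) \<in> smooth_functions S n \<A>"
  by (auto intro!: smooth_functionsI smooth_on_const)

lemma smooth_functions_sum:
  assumes "\<And>j. j \<in> J \<Longrightarrow> f j \<in> smooth_functions S n \<A>"
  shows "(\<lambda>p. \<Sum>j\<in>J. f j p) \<in> smooth_functions S n \<A>"
  using assms
proof (induction J rule: infinite_finite_induct)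
  case (insert j J)
  have "(\<lambda>p. f j p + (\<Sum>j\<in>J. f j p)) \<in> smooth_functions S n \<A>"
    by (rule smooth_functions_add) (use insert in auto)
  then show ?case using insert by simp
qed (simp_all add: smooth_functions_zero)

context smooth_manifold
begin

abbreviation R where "R \<equiv> real_functions X n \<A>"

lemma chart_subset: "(U, c) \<in> \<A> \<Longrightarrow> U \<subseteq> topspace X"
  using chart_domain openin_subset by blast

lemma chart_inj: "(U, c) \<in> \<A> \<Longrightarrow> inj_on c U"
  using homeomorphic_imp_injective_map[OF chart_homeomorphism] chart_subset
  by (metis topspace_subtopology_subset)

lemma chart_open_image:
  assumes "(U, c) \<in> \<A>" "openin X W" "W \<subseteq> U" shows "open_n n (c ` W)"
proof -
  have "openin (subtopology X U) W"
    using assms by (auto simp: openin_subtopology_alt)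
  then have "openin (subtopology (Euclidean_space n) (c ` U)) (c ` W)"
    using homeomorphic_imp_open_map[OF chart_homeomorphism[OF assms(1)]] by (auto simp: open_map_def)
  then show ?thesis
    using openin_trans_full chart_image[OF assms(1)] unfolding Euclidean_space_eq by blast
qed

lemma chart_open: "(U, c) \<in> \<A> \<Longrightarrow> open_n n (c ` U)"
  by (rule chart_open_image[OF _ chart_domain]) auto

lemma chart_En: "(U, c) \<in> \<A> \<Longrightarrow> x \<in> U \<Longrightarrow> c x \<in> En n"
  using chart_open[of U c] by (auto simp: openin_open)

lemma chart_open_preimage:
  assumes "(U, c) \<in> \<A>" "open_n n T" shows "openin X {p \<in> U. c p \<in> T}"
proof -
  have cm: "continuous_map (subtopology X U) (Euclidean_space n) c"
    using homeomorphic_imp_continuous_map[OF chart_homeomorphism[OF assms(1)]]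
    by (simp add: continuous_map_in_subtopology)
  have "openin (subtopology X U) {p \<in> U. c p \<in> T}"
  proof -
    have "{p \<in> topspace (subtopology X U). c p \<in> T} = {p \<in> U. c p \<in> T}"
      using chart_subset[OF assms(1)] by auto
    with openin_continuous_map_preimage[OF cm, of T] assms(2) show ?thesis
      by (simp add: Euclidean_space_eq)
  qed
  then show ?thesis by (rule openin_trans_full[OF _ chart_domain[OF assms(1)]])
qed

lemma exists_chart: "x \<in> topspace X \<Longrightarrow> \<exists>U c. (U, c) \<in> \<A> \<and> x \<in> U"
  by (force simp: charts_cover[symmetric])

lemma inv_chart: "(U, c) \<in> \<A> \<Longrightarrow> x \<in> U \<Longrightarrow> inv_into U c (c x) = x"
  by (simp add: chart_inj)

lemma unit_in_R: "unit_on (topspace X) \<in> R"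
proof (rule smooth_functionsI)
  fix U c assume Uc: "(U, c) \<in> \<A>"
  have "unit_on (topspace X) (inv_into U c y) = (1::real)" if "y \<in> c ` U" for y
    using chart_subset[OF Uc] inv_into_into[OF that] by (auto simp: unit_on_def)
  then show "smooth_on n (c ` U) (\<lambda>y. unit_on (topspace X) (inv_into U c y) :: real)"
    by (rule smooth_on_congI[OF smooth_on_const chart_open[OF Uc]])
qed (auto simp: unit_on_def)

text \<open>A function supported in a set \<open>K\<close> that is closed in the whole manifold is smooth as soon as
  it is smooth in one chart around \<open>K\<close>: in any other chart, points outside \<open>W\<close> have a neighbourhood
  disjoint from \<open>K\<close>.\<close>
lemma extension_in_R:
  assumes Uc: "(U, c) \<in> \<A>" and W: "openin X W" "W \<subseteq> U" and K: "closedin X K" "K \<subseteq> W"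
    and h: "smooth_on n (c ` W) (\<lambda>y. h (inv_into U c y))" and h0: "\<And>p. p \<notin> K \<Longrightarrow> h p = 0"
  shows "h \<in> R"
proof (rule smooth_functionsI)
  show "p \<notin> topspace X \<Longrightarrow> h p = 0" for p using h0 openin_subset[OF W(1)] K(2) by blast
  fix V d assume Vd: "(V, d) \<in> \<A>"
  show "smooth_on n (d ` V) (\<lambda>y. h (inv_into V d y))"
    unfolding smooth_on_def
  proof (intro allI Ck_on_local[OF chart_open[OF Vd]])
    fix k y assume "y \<in> d ` V"
    then obtain p where p: "p \<in> V" "y = d p" by auto
    show "\<exists>T. open_n n T \<and> y \<in> T \<and> Ck_on k n T (\<lambda>y. h (inv_into V d y))"
    proof (cases "p \<in> W")
      case True
      let ?T = "d ` (V \<inter> W)"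
      have T: "open_n n ?T" using chart_open_image[OF Vd, of "V \<inter> W"] chart_domain[OF Vd] W by blast
      have cW: "open_n n (c ` W)" by (rule chart_open_image[OF Uc W])
      have "Ck_on k n ?T (\<lambda>y. h (inv_into U c (c (inv_into V d y))))"
      proof (rule Ck_on_compose[where h = "\<lambda>y. h (inv_into U c y)" and T = "\<lambda>y. c (inv_into V d y)", OF T cW])
        show "c (inv_into V d y) \<in> c ` W" if "y \<in> ?T" for y
          using that inv_chart[OF Vd] by auto
        show "Ck_on k n (c ` W) (\<lambda>y. h (inv_into U c y))" using h by (simp add: smooth_on_def)
        show "Ck_on k n ?T (\<lambda>y. c (inv_into V d y) j)" if "j < n" for j
          using charts_compatible[OF Vd Uc that] W by (auto simp: smooth_on_def intro: Ck_on_subset)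
      qed
      then have "Ck_on k n ?T (\<lambda>y. h (inv_into V d y))"
        by (rule Ck_on_congI[OF _ T]) (use inv_chart[OF Vd] inv_chart[OF Uc] W in auto)
      then show ?thesis using T p True by blast
    next
      case False
      let ?T = "d ` (V - K)"
      have "openin X (V - K)" by (rule openin_diff[OF chart_domain[OF Vd] K(1)])
      then have T: "open_n n ?T" by (rule chart_open_image[OF Vd]) auto
      have "Ck_on k n ?T (\<lambda>y. h (inv_into V d y))"
        by (rule Ck_on_congI[OF Ck_on_const T]) (use inv_chart[OF Vd] h0 in auto)
      then show ?thesis using T p False K by blast
    qed
  qed
qed

text \<open>Take a product of step functions of the coordinates. Its support lies in the preimage \<open>K\<close> of a
  compact cube, which is closed in the whole manifold because the manifold is Hausdorff.\<close>
lemma bump: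
  assumes Uc: "(U, c) \<in> \<A>" and W: "openin X W" "W \<subseteq> U" and x: "x \<in> W"
  obtains \<beta> N K where "\<beta> \<in> R" "openin X N" "x \<in> N" "N \<subseteq> K" "K \<subseteq> W" "closedin X K"
    "\<And>y. y \<in> N \<Longrightarrow> \<beta> y = 1" "\<And>y. y \<notin> K \<Longrightarrow> \<beta> y = 0"
proof -
  have cW: "open_n n (c ` W)" by (rule chart_open_image[OF Uc W])
  obtain r where r: "r > 0" "{y \<in> En n. \<forall>j<n. \<bar>y j - c x j\<bar> \<le> r} \<subseteq> c ` W" (is "?Q \<subseteq> _")
    using open_n_cube[OF cW] x by blast
  define K where "K = {p \<in> U. \<forall>j<n. \<bar>c p j - c x j\<bar> \<le> r}"
  define N where "N = {p \<in> U. \<forall>j<n. \<bar>c p j - c x j\<bar> < r / 2}"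
  \<comment> \<open>the argument of the step function is at least \<open>1\<close> up to distance \<open>r / 2\<close> and nonpositive from
    distance \<open>r / sqrt 2 < r\<close> on\<close>
  define \<beta> where "\<beta> p = (if p \<in> U then \<Prod>j<n. smooth_step (2 - (2 / r)\<^sup>2 * (c p j - c x j)\<^sup>2) else 0)" for p
  have KW: "K \<subseteq> W"
  proof
    fix p assume p: "p \<in> K"
    then have "c p \<in> c ` W" using r(2) chart_En[OF Uc] by (auto simp: K_def)
    then show "p \<in> W" using p W chart_inj[OF Uc] by (auto simp: K_def dest: inj_onD)
  qed
  have cK: "c ` K = ?Q"
  proof
    show "c ` K \<subseteq> ?Q" using chart_En[OF Uc] by (auto simp: K_def)
    show "?Q \<subseteq> c ` K"
    proof
      fix y assume y: "y \<in> ?Q"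
      with r(2) obtain p where "p \<in> W" "y = c p" by blast
      with y W show "y \<in> c ` K" by (auto simp: K_def)
    qed
  qed
  have "?Q \<subseteq> c ` U" using r(2) W by blast
  then have "compactin (subtopology (Euclidean_space n) (c ` U)) (c ` K)"
    unfolding cK Euclidean_space_eq using compact_cube[where x = "c x" and r = r and n = n]
    by (auto simp: compactin_subtopology)
  then have "compactin (subtopology X U) K"
    using homeomorphic_map_compactness[OF chart_homeomorphism[OF Uc], of K] chart_subset[OF Uc]
    by (auto simp: K_def)
  then have clK: "closedin X K"
    by (intro compactin_imp_closedin[OF Hausdorff]) (simp add: compactin_subtopology)
  have NK: "N \<subseteq> K" using r(1) by (fastforce simp: N_def K_def)
  have "open_n n {y \<in> En n. \<forall>j<n. \<bar>y j - c x j\<bar> < r / 2}"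
    by (rule open_n_open_cube)
  from chart_open_preimage[OF Uc this] have oN: "openin X N"
    using chart_En[OF Uc] by (simp add: N_def cong: conj_cong)
  have xN: "x \<in> N" using x W r(1) by (auto simp: N_def)
  have \<beta>1: "\<beta> y = 1" if "y \<in> N" for y
  proof -
    have "smooth_step (2 - (2 / r)\<^sup>2 * (c y j - c x j)\<^sup>2) = 1" if "j < n" for j
    proof (rule smooth_step_1)
      have "\<bar>(2 / r) * (c y j - c x j)\<bar> \<le> 1"
      proof -
        have "\<bar>c y j - c x j\<bar> \<le> r / 2" using \<open>y \<in> N\<close> that by (force simp: N_def)
        then show ?thesis unfolding abs_mult using r(1) by (simp add: field_simps)
      qed
      then have "((2 / r) * (c y j - c x j))\<^sup>2 \<le> 1" by (simp only: abs_square_le_1)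
      then have "(2 / r)\<^sup>2 * (c y j - c x j)\<^sup>2 \<le> 1" by (simp only: power_mult_distrib)
      then show "1 \<le> 2 - (2 / r)\<^sup>2 * (c y j - c x j)\<^sup>2" by linarith
    qed
    then show ?thesis using that by (simp add: \<beta>_def N_def)
  qed
  have \<beta>0: "\<beta> y = 0" if yK: "y \<notin> K" for y
  proof (cases "y \<in> U")
    case True
    then obtain j where j: "j < n" "\<bar>c y j - c x j\<bar> > r" using yK by (auto simp: K_def not_le)
    have "smooth_step (2 - (2 / r)\<^sup>2 * (c y j - c x j)\<^sup>2) = 0"
    proof (rule smooth_step_0)
      have "2 \<le> \<bar>(2 / r) * (c y j - c x j)\<bar>"
        using j r(1) by (auto simp: abs_mult divide_simps)
      then have "2\<^sup>2 \<le> ((2 / r) * (c y j - c x j))\<^sup>2"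
        by (metis abs_le_square_iff abs_numeral)
      then have "2\<^sup>2 \<le> (2 / r)\<^sup>2 * (c y j - c x j)\<^sup>2" by (simp only: power_mult_distrib)
      then show "2 - (2 / r)\<^sup>2 * (c y j - c x j)\<^sup>2 \<le> 0" by simp
    qed
    then show ?thesis using j True by (auto simp: \<beta>_def intro!: prod_zero)
  qed (simp add: \<beta>_def)
  have "\<beta> \<in> R"
  proof (rule extension_in_R[OF Uc W clK KW _ \<beta>0])
    have "Ck_on k n (c ` W) (\<lambda>y. \<Prod>j<n. smooth_step (2 - (2 / r)\<^sup>2 * (y j - c x j)\<^sup>2))" for k
    proof (intro Ck_on_prod Ck_on_smooth_step)
      fix j
      have "Ck_on k n (c ` W) (\<lambda>y. 2 + (- ((2 / r)\<^sup>2)) * ((y j - c x j) * (y j - c x j)))"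
        by (intro Ck_on_add Ck_on_const Ck_on_mult Ck_on_minus_coordinate)
      then show "Ck_on k n (c ` W) (\<lambda>y. 2 - (2 / r)\<^sup>2 * (y j - c x j)\<^sup>2)"
        by (simp add: power2_eq_square)
    qed
    then have sm: "smooth_on n (c ` W) (\<lambda>y. \<Prod>j<n. smooth_step (2 - (2 / r)\<^sup>2 * (y j - c x j)\<^sup>2))"
      by (simp add: smooth_on_def)
    have "\<beta> (inv_into U c y) = (\<Prod>j<n. smooth_step (2 - (2 / r)\<^sup>2 * (y j - c x j)\<^sup>2))"
      if "y \<in> c ` W" for y
      using that inv_chart[OF Uc] W by (auto simp: \<beta>_def)
    then show "smooth_on n (c ` W) (\<lambda>y. \<beta> (inv_into U c y))"
      by (rule smooth_on_congI[OF sm cW])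
  qed
  then show ?thesis using that[of \<beta> N K] oN xN NK KW clK \<beta>1 \<beta>0 by blast
qed

lemma germ_extension:
  assumes Uc: "(U, c) \<in> \<A>" and W: "openin X W" "W \<subseteq> U" and x: "x \<in> W"
    and h: "smooth_on n (c ` W) (\<lambda>y. h (inv_into U c y))"
  obtains e N where "e \<in> R" "openin X N" "x \<in> N" "N \<subseteq> W" "\<And>y. y \<in> N \<Longrightarrow> e y = h y"
proof -
  obtain \<beta> N K where b: "\<beta> \<in> R" "openin X N" "x \<in> N" "N \<subseteq> K" "K \<subseteq> W" "closedin X K"
    "\<And>y. y \<in> N \<Longrightarrow> \<beta> y = 1" "\<And>y. y \<notin> K \<Longrightarrow> \<beta> y = 0"
    by (rule bump[OF Uc W x]) blast
  have "(\<lambda>p. \<beta> p * h p) \<in> R"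
  proof (rule extension_in_R[OF Uc W b(6,5)])
    have "smooth_on n (c ` W) (\<lambda>y. \<beta> (inv_into U c y))"
      using smooth_functionsD(1)[OF b(1) Uc] W by (auto simp: smooth_on_def intro: Ck_on_subset)
    then show "smooth_on n (c ` W) (\<lambda>y. \<beta> (inv_into U c y) * h (inv_into U c y))"
      using h by (rule smooth_on_mult)
  qed (use b in auto)
  with b show ?thesis using that[of "\<lambda>p. \<beta> p * h p" N] by auto
qed

lemma coordinate_germ:
  assumes Uc: "(U, c) \<in> \<A>" and x: "x \<in> U"
  obtains e N where "e \<in> R" "openin X N" "x \<in> N" "N \<subseteq> U" "\<And>y. y \<in> N \<Longrightarrow> e y = c y i"
proof -
  have "smooth_on n (c ` U) (\<lambda>y. c (inv_into U c y) i)"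
    unfolding smooth_on_def
  proof
    fix k
    have "Ck_on k n (c ` U) (\<lambda>y. y i)" by (rule Ck_on_coordinate[OF bounded_linear_ident])
    moreover have "c (inv_into U c y) i = y i" if "y \<in> c ` U" for y
      using that by (simp add: f_inv_into_f)
    ultimately show "Ck_on k n (c ` U) (\<lambda>y. c (inv_into U c y) i)"
      by (rule Ck_on_congI[OF _ chart_open[OF Uc]])
  qed
  from germ_extension[OF Uc chart_domain[OF Uc] order_refl x this] that show ?thesis by blast
qed

end

section \<open>Near points and their coordinates\<close>

locale weil_manifold = smooth_manifold X n \<A> + weil_algebra \<mm>
  for X :: "'p topology" and n \<A> and \<mm> :: "'a::{comm_ring_1, real_algebra_1, euclidean_space} set"
begin

abbreviation np where "np \<equiv> near_point X n \<A> \<mm>"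

abbreviation wchart where "wchart \<equiv> weil_chart X n \<A> \<mm>"

lemma near_pointD:
  assumes "np x \<xi>"
  shows np_add: "f \<in> R \<Longrightarrow> g \<in> R \<Longrightarrow> \<xi> (\<lambda>p. f p + g p) = \<xi> f + \<xi> g"
    and np_scale: "f \<in> R \<Longrightarrow> \<xi> (\<lambda>p. r * f p) = r *\<^sub>R \<xi> f"
    and np_mult: "f \<in> R \<Longrightarrow> g \<in> R \<Longrightarrow> \<xi> (\<lambda>p. f p * g p) = \<xi> f * \<xi> g"
    and np_unit: "\<xi> (unit_on (topspace X)) = 1"
    and np_body: "f \<in> R \<Longrightarrow> \<xi> f - of_real (f x) \<in> \<mm>"
    and np_ext: "f \<notin> R \<Longrightarrow> \<xi> f = 0"
  using assms by (auto simp: near_point_def)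

lemma np_zero: "np x \<xi> \<Longrightarrow> \<xi> (\<lambda>p. 0) = 0"
  using np_scale[of x \<xi> "\<lambda>p. 0" 0] by (simp add: smooth_functions_zero)

lemma np_sum:
  assumes "np x \<xi>" "\<And>j. j \<in> J \<Longrightarrow> f j \<in> R"
  shows "\<xi> (\<lambda>p. \<Sum>j\<in>J. f j p) = (\<Sum>j\<in>J. \<xi> (f j))"
  using assms(2)
  by (induction J rule: infinite_finite_induct)
     (auto simp: np_zero[OF assms(1)] np_add[OF assms(1)] smooth_functions_sum smooth_functions_zero)

text \<open>Multiply the difference \<open>h\<close> of the two functions by a bump function \<open>\<beta>\<close>: \<open>\<xi> \<beta>\<close> is a unit because its
  body is \<open>1\<close>, and \<open>\<beta> h = 0\<close>.\<close>
lemma np_germ: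
  assumes \<xi>: "np x \<xi>" and f: "f \<in> R" "g \<in> R" and N: "openin X N" "x \<in> N" "\<And>y. y \<in> N \<Longrightarrow> f y = g y"
  shows "\<xi> f = \<xi> g"
proof -
  obtain U c where Uc: "(U, c) \<in> \<A>" "x \<in> U"
    using exists_chart openin_subset[OF N(1)] N(2) by blast
  obtain \<beta> N' K where b: "\<beta> \<in> R" "openin X N'" "x \<in> N'" "N' \<subseteq> K" "K \<subseteq> U \<inter> N" "closedin X K"
    "\<And>y. y \<in> N' \<Longrightarrow> \<beta> y = 1" "\<And>y. y \<notin> K \<Longrightarrow> \<beta> y = 0"
    using bump[OF Uc(1), of "U \<inter> N" x] chart_domain[OF Uc(1)] N Uc by blast
  let ?m = "\<lambda>p. (-1) * g p"
  let ?h = "\<lambda>p. f p + ?m p"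
  have h: "?m \<in> R" "?h \<in> R" using f by (intro smooth_functions_add smooth_functions_cmult; simp)+
  have eq: "\<xi> ?h = \<xi> f - \<xi> g" using np_add[OF \<xi> f(1) h(1)] np_scale[OF \<xi> f(2), of "-1"] by simp
  have "(\<lambda>p. \<beta> p * ?h p) = (\<lambda>p. 0)"
  proof
    show "\<beta> p * ?h p = 0" for p using b(5,8) N(3) by (cases "p \<in> K") auto
  qed
  then have z: "\<xi> \<beta> * \<xi> ?h = 0" using np_mult[OF \<xi> b(1) h(2)] np_zero[OF \<xi>] by simp
  have "\<xi> \<beta> \<notin> \<mm>"
  proof
    assume "\<xi> \<beta> \<in> \<mm>"
    moreover have "\<xi> \<beta> - 1 \<in> \<mm>" using np_body[OF \<xi> b(1)] b by simp
    ultimately show False using m_diff[of "\<xi> \<beta>" "\<xi> \<beta> - 1"] one_notin_m by simp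
  qed
  then obtain u where u: "\<xi> \<beta> * u = 1" by (rule unit_if_notin_m)
  have "\<xi> ?h = (\<xi> \<beta> * u) * \<xi> ?h" unfolding u by simp
  also have "\<dots> = u * (\<xi> \<beta> * \<xi> ?h)" by (simp only: mult_ac)
  also have "\<dots> = 0" unfolding z by simp
  finally show ?thesis using eq by simp
qed

text \<open>A bump function that separates the points would be mapped both into \<open>\<mm>\<close> and into \<open>1 + \<mm>\<close>.\<close>
lemma np_base_unique:
  assumes \<xi>: "np x \<xi>" "np y \<xi>" and xy: "x \<in> topspace X" "y \<in> topspace X"
  shows "x = y"
proof (rule ccontr)
  assume ne: "x \<noteq> y"
  obtain U c where Uc: "(U, c) \<in> \<A>" "x \<in> U" using exists_chart xy(1) by blast
  have "openin X (U - {y})"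
    using closedin_Hausdorff_sing_eq[OF Hausdorff, of y] xy(2) openin_diff[OF chart_domain[OF Uc(1)]] by blast
  from bump[OF Uc(1) this, of x] Uc ne obtain \<beta> N K where
    b: "\<beta> \<in> R" "x \<in> N" "K \<subseteq> U - {y}" "\<And>y. y \<in> N \<Longrightarrow> \<beta> y = 1" "\<And>y. y \<notin> K \<Longrightarrow> \<beta> y = 0"
    by (metis Diff_iff Diff_subset singletonD)
  have "\<beta> x = 1" "\<beta> y = 0" using b by blast+
  then have "\<xi> \<beta> - 1 \<in> \<mm>" "\<xi> \<beta> \<in> \<mm>"
    using np_body[OF \<xi>(1) b(1)] np_body[OF \<xi>(2) b(1)] by auto
  then show False using m_diff[of "\<xi> \<beta>" "\<xi> \<beta> - 1"] one_notin_m by simp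
qed

lemma near_point_value_eq:
  assumes \<xi>: "np x \<xi>" and f: "f \<in> R" and N: "openin X N" "x \<in> N" "\<And>y. y \<in> N \<Longrightarrow> f y = h y"
  shows "near_point_value X n \<A> \<mm> \<xi> h = \<xi> f"
  unfolding near_point_value_def
proof (rule the_equality)
  have x: "x \<in> topspace X" using N openin_subset by blast
  then show "\<exists>x\<in>topspace X. \<exists>W. \<exists>f'\<in>R. np x \<xi> \<and> openin X W \<and> x \<in> W \<and> (\<forall>y\<in>W. f' y = h y) \<and> \<xi> f = \<xi> f'"
    using assms by blast
  fix a assume "\<exists>x\<in>topspace X. \<exists>W. \<exists>f'\<in>R. np x \<xi> \<and> openin X W \<and> x \<in> W \<and> (\<forall>y\<in>W. f' y = h y) \<and> a = \<xi> f'"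
  then obtain z W f' where z: "z \<in> topspace X" "f' \<in> R" "np z \<xi>" "openin X W" "z \<in> W" "\<forall>y\<in>W. f' y = h y" "a = \<xi> f'"
    by blast
  have "z = x" by (rule np_base_unique[OF z(3) \<xi> z(1) x])
  then have "\<xi> f' = \<xi> f"
    using np_germ[OF \<xi> z(2) f openin_Int[OF z(4) N(1)]] z N by auto
  then show "a = \<xi> f" using z by simp
qed

lemma wchart_coordinate:
  assumes "np x \<xi>" "i < n" "e \<in> R" "openin X N" "x \<in> N" "\<And>y. y \<in> N \<Longrightarrow> e y = c y i"
  shows "wchart c \<xi> i = \<xi> e"
  using near_point_value_eq[OF assms(1,3-5), of "\<lambda>x. c x i"] assms(2,6) by (simp add: weil_chart_def)

lemma bodies_wchart:
  assumes Uc: "(U, c) \<in> \<A>" and x: "x \<in> U" and \<xi>: "np x \<xi>"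
  shows "bodies \<mm> (wchart c \<xi>) = c x"
proof
  fix i
  show "bodies \<mm> (wchart c \<xi>) i = c x i"
  proof (cases "i < n")
    case True
    obtain e N where e: "e \<in> R" "openin X N" "x \<in> N" "N \<subseteq> U" "\<And>y. y \<in> N \<Longrightarrow> e y = c y i"
      using coordinate_germ[OF Uc x] by blast
    have "wchart c \<xi> i = \<xi> e" by (rule wchart_coordinate[where c = c, OF \<xi> True e(1-3,5)])
    then show ?thesis using np_body[OF \<xi> e(1)] e(5)[OF e(3)] by (simp add: bodies_def body_eqI)
  next
    case False
    then show ?thesis using chart_En[OF Uc x] by (simp add: weil_chart_def bodies_def En_def)
  qed
qed

text \<open>Hadamard's lemma near \<open>x\<close>, evaluated at a near point. The functions \<open>G i\<close> do not depend
  on the near point, which makes it possible to compare two of them.\<close>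
lemma Hadamard_near_point:
  assumes Uc: "(U, c) \<in> \<A>" and x: "x \<in> U" and f: "f \<in> R"
  obtains G where "\<And>i. i < n \<Longrightarrow> G i \<in> R"
    and "\<And>\<xi>. np x \<xi> \<Longrightarrow> \<xi> f = of_real (f x) + (\<Sum>i<n. nils \<mm> (wchart c \<xi>) i * \<xi> (G i))"
proof -
  obtain r where r: "r > 0" "{y \<in> En n. \<forall>j<n. \<bar>y j - c x j\<bar> \<le> r} \<subseteq> c ` U"
    using open_n_cube[OF chart_open[OF Uc]] x by blast
  define S where "S = {y \<in> En n. \<forall>j<n. \<bar>y j - c x j\<bar> < r}"
  have SU: "S \<subseteq> c ` U" using r(2) by (force simp: S_def)
  have S: "open_n n S"
    unfolding S_def by (rule open_n_open_cube)
  have xS: "c x \<in> S" using chart_En[OF Uc x] r(1) by (simp add: S_def)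
  have star: "segment_pt (c x) y t \<in> S" if "y \<in> S" "t \<in> {0..1}" for y t
  proof -
    have "\<bar>t * (y j - c x j)\<bar> < r" if "j < n" for j
    proof -
      have "\<bar>t * (y j - c x j)\<bar> \<le> 1 * \<bar>y j - c x j\<bar>"
        unfolding abs_mult using \<open>t \<in> {0..1}\<close> by (intro mult_right_mono) auto
      also have "\<dots> < r" using \<open>y \<in> S\<close> that by (auto simp: S_def)
      finally show ?thesis .
    qed
    then show ?thesis using that chart_En[OF Uc x] by (auto simp: S_def segment_pt_def En_def)
  qed
  have "smooth_on n S (\<lambda>y. f (inv_into U c y))"
    using smooth_functionsD(1)[OF f Uc] SU by (auto simp: smooth_on_def intro: Ck_on_subset)
  from Hadamard[OF S star xS this] obtain g where g: "\<And>i. i < n \<Longrightarrow> smooth_on n S (g i)"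
    "\<And>y. y \<in> S \<Longrightarrow> f (inv_into U c y) = f (inv_into U c (c x)) + (\<Sum>i<n. (y i - c x i) * g i y)"
    by blast
  define W where "W = {p \<in> U. c p \<in> S}"
  have W: "openin X W" "W \<subseteq> U" "x \<in> W" using chart_open_preimage[OF Uc S] x xS by (auto simp: W_def)
  have cW: "c ` W = S" using SU by (auto simp: W_def)
  have "\<exists>e N. e \<in> R \<and> openin X N \<and> x \<in> N \<and> N \<subseteq> W \<and> (\<forall>y\<in>N. e y = g i (c y))" if "i < n" for i
  proof -
    have "smooth_on n (c ` W) (\<lambda>y. g i (c (inv_into U c y)))"
      unfolding cW by (rule smooth_on_congI[OF g(1)[OF that] S])
        (use SU in \<open>simp add: f_inv_into_f subset_iff\<close>)
    then obtain e N where "e \<in> R" "openin X N" "x \<in> N" "N \<subseteq> W" "\<And>y. y \<in> N \<Longrightarrow> e y = g i (c y)"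
      by (rule germ_extension[OF Uc W]) blast
    then show ?thesis by (intro exI[of _ e] exI[of _ N] conjI ballI)
  qed
  then obtain G M where G: "\<And>i. i < n \<Longrightarrow> G i \<in> R" "\<And>i. i < n \<Longrightarrow> openin X (M i)" "\<And>i. i < n \<Longrightarrow> x \<in> M i"
    "\<And>i. i < n \<Longrightarrow> M i \<subseteq> W" "\<And>i y. i < n \<Longrightarrow> y \<in> M i \<Longrightarrow> G i y = g i (c y)"
    by metis
  have "\<exists>e N. e \<in> R \<and> openin X N \<and> x \<in> N \<and> N \<subseteq> U \<and> (\<forall>y\<in>N. e y = c y i)" for i
    using coordinate_germ[OF Uc x, of i] by metis
  then obtain e N where e: "\<And>i. e i \<in> R" "\<And>i. openin X (N i)" "\<And>i. x \<in> N i" "\<And>i y. y \<in> N i \<Longrightarrow> e i y = c y i"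
    by metis
  let ?u = "unit_on (topspace X) :: 'p \<Rightarrow> real"
  let ?d = "\<lambda>i p. e i p + (- c x i) * ?u p"
  let ?F = "\<lambda>p. f x * ?u p + (\<Sum>i<n. ?d i p * G i p)"
  have d: "?d i \<in> R" for i by (intro smooth_functions_add smooth_functions_cmult e unit_in_R)
  have dG: "(\<lambda>p. ?d i p * G i p) \<in> R" if "i < n" for i by (intro smooth_functions_mult d G that)
  have sR: "(\<lambda>p. \<Sum>i<n. ?d i p * G i p) \<in> R" by (intro smooth_functions_sum dG) simp
  have uR: "(\<lambda>p. f x * ?u p) \<in> R" by (intro smooth_functions_cmult unit_in_R)
  have F: "?F \<in> R" by (intro smooth_functions_add sR uR)
  have "\<xi> f = of_real (f x) + (\<Sum>i<n. nils \<mm> (wchart c \<xi>) i * \<xi> (G i))" if \<xi>: "np x \<xi>" for \<xi>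
  proof -
    let ?O = "W \<inter> (\<Inter>i\<in>{..<n}. M i \<inter> N i)"
    have O: "openin X ?O" "x \<in> ?O"
    proof -
      show "openin X ?O"
      proof (cases "n = 0")
        case False
        then have "openin X (\<Inter>i\<in>{..<n}. M i \<inter> N i)" by (intro openin_Inter) (use G e in auto)
        then show ?thesis using W by blast
      qed (use W in simp)
      show "x \<in> ?O" using W G e by auto
    qed
    have "\<xi> f = \<xi> ?F"
    proof (rule np_germ[OF \<xi> f F O])
      fix p assume p: "p \<in> ?O"
      then have pU: "p \<in> U" "c p \<in> S" "p \<in> topspace X" using chart_subset[OF Uc] by (auto simp: W_def)
      have "f p = f x + (\<Sum>i<n. (c p i - c x i) * g i (c p))"
        using g(2)[OF pU(2)] inv_chart[OF Uc] pU x by simp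
      also have "(\<Sum>i<n. (c p i - c x i) * g i (c p)) = (\<Sum>i<n. ?d i p * G i p)"
        using p G(5) e(4) pU by (intro sum.cong) (auto simp: unit_on_def)
      finally show "f p = ?F p" using pU by (simp add: unit_on_def)
    qed
    also have "\<dots> = f x *\<^sub>R 1 + (\<Sum>i<n. \<xi> (?d i) * \<xi> (G i))"
      using np_add[OF \<xi> uR sR] np_scale[OF \<xi> unit_in_R] np_unit[OF \<xi>] np_sum[OF \<xi>, of "{..<n}" "\<lambda>i p. ?d i p * G i p"] dG
        np_mult[OF \<xi> d G(1)] by simp
    also have "(\<Sum>i<n. \<xi> (?d i) * \<xi> (G i)) = (\<Sum>i<n. nils \<mm> (wchart c \<xi>) i * \<xi> (G i))"
    proof (rule sum.cong[OF refl])
      fix i assume "i \<in> {..<n}"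
      then have i: "i < n" by simp
      have "\<xi> (?d i) = \<xi> (e i) + (- c x i) *\<^sub>R 1"
        by (simp only: np_add[OF \<xi> e(1) smooth_functions_cmult[OF unit_in_R]] np_scale[OF \<xi> unit_in_R] np_unit[OF \<xi>])
      also have "\<xi> (e i) = wchart c \<xi> i" using wchart_coordinate[where c = c, OF \<xi> i e(1,2,3,4)] by simp
      also have "wchart c \<xi> i + (- c x i) *\<^sub>R 1 = nils \<mm> (wchart c \<xi>) i"
        using bodies_wchart[OF Uc x \<xi>] by (simp add: nils_def bodies_def fun_eq_iff scaleR_conv_of_real)
      finally show "\<xi> (?d i) * \<xi> (G i) = nils \<mm> (wchart c \<xi>) i * \<xi> (G i)" by simp
    qed
    finally show ?thesis by (simp add: scaleR_conv_of_real)
  qed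
  then show ?thesis using that[of G] G(1) by blast
qed

text \<open>Iterating \<open>Hadamard_near_point\<close>, the difference of the two near points becomes a combination of
  arbitrarily long products of the nilpotent parts \<open>\<nu>\<close> of the common coordinates. The induction runs
  downwards on the length of such a product \<open>M\<close>, and starts where the product itself is zero.\<close>
lemma near_point_eqI:
  assumes Uc: "(U, c) \<in> \<A>" and x: "x \<in> U" and \<xi>: "np x \<xi>" and \<eta>: "np x \<eta>"
    and eq: "wchart c \<xi> = wchart c \<eta>"
  shows "\<xi> = \<eta>"
proof
  let ?\<nu> = "nils \<mm> (wchart c \<xi>)"
  let ?N = "n * DIM('a)"
  have key: "(\<Prod>i\<in>#M. ?\<nu> i) * (\<xi> f - \<eta> f) = 0" if "set_mset M \<subseteq> {..<n}" "f \<in> R" for M f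
    using that
  proof (induction "Suc ?N - size M" arbitrary: M f)
    case 0
    then show ?case using prod_mset_nilpotent[of n ?\<nu> "DIM('a)" M] nils_nilpotent by simp
  next
    case (Suc k)
    obtain G where G: "\<And>i. i < n \<Longrightarrow> G i \<in> R"
      "\<And>\<xi>. np x \<xi> \<Longrightarrow> \<xi> f = of_real (f x) + (\<Sum>i<n. nils \<mm> (wchart c \<xi>) i * \<xi> (G i))"
      using Hadamard_near_point[OF Uc x Suc.prems(2)] by blast
    have "\<xi> f - \<eta> f = (\<Sum>i<n. ?\<nu> i * (\<xi> (G i) - \<eta> (G i)))"
      using G(2)[OF \<xi>] G(2)[OF \<eta>] eq by (simp add: sum_subtractf right_diff_distrib)
    moreover have "(\<Prod>i\<in>#M. ?\<nu> i) * (?\<nu> i * (\<xi> (G i) - \<eta> (G i))) = 0" if "i < n" for i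
      using Suc.hyps(1)[of "add_mset i M" "G i"] Suc.hyps(2) Suc.prems(1) G(1) that by (simp add: mult_ac)
    ultimately show ?case by (simp add: sum_distrib_left)
  qed
  fix f
  show "\<xi> f = \<eta> f"
  proof (cases "f \<in> R")
    case True
    then show ?thesis using key[of "{#}" f] by simp
  next
    case False
    then show ?thesis using np_ext[OF \<xi>] np_ext[OF \<eta>] by simp
  qed
qed

text \<open>The near point with coordinates \<open>a\<close> in the chart \<open>(U, c)\<close>.\<close>
definition near_point_at where
  "near_point_at U c a = (\<lambda>f. if f \<in> R then prolong \<mm> n (\<lambda>y. f (inv_into U c y)) a else 0)"

lemma np_near_point_at:
  assumes Uc: "(U, c) \<in> \<A>" and a: "a \<in> over n (c ` U)"
  shows "np (inv_into U c (bodies \<mm> a)) (near_point_at U c a)"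
proof -
  note S = chart_open[OF Uc]
  have b: "bodies \<mm> a \<in> c ` U" using a by (simp add: over_def)
  note sm = smooth_functionsD(1)[OF _ Uc]
  have u: "unit_on (topspace X) (inv_into U c y) = (1::real)" if "y \<in> c ` U" for y
    using chart_subset[OF Uc] inv_into_into[OF that] by (auto simp: unit_on_def)
  note c = smooth_on_const[of n "c ` U"]
  have "prolong \<mm> n (\<lambda>y. unit_on (topspace X) (inv_into U c y)) a = 1"
    using prolong_cong[OF S b, of "\<lambda>y. unit_on (topspace X) (inv_into U c y)" "\<lambda>_. 1"] u prolong_const[of n 1 a] by simp
  then have 1: "near_point_at U c a (unit_on (topspace X)) = 1" by (simp add: near_point_at_def unit_in_R)
  let ?x = "inv_into U c (bodies \<mm> a)"
  show ?thesis
    unfolding near_point_def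
  proof (intro conjI ballI allI impI 1)
    fix f g r
    assume f: "f \<in> R"
    show "near_point_at U c a f - of_real (f ?x) \<in> \<mm>"
      using prolong_minus_value_in_m[of n "\<lambda>y. f (inv_into U c y)" a] f by (simp add: near_point_at_def)
    show "near_point_at U c a (\<lambda>p. r * f p) = r *\<^sub>R near_point_at U c a f"
      using prolong_mult[OF S b c sm[OF f], of r] f
      by (simp add: near_point_at_def smooth_functions_cmult prolong_const scaleR_conv_of_real)
    assume g: "g \<in> R"
    show "near_point_at U c a (\<lambda>p. f p + g p) = near_point_at U c a f + near_point_at U c a g"
      using prolong_add[OF S b sm[OF f] sm[OF g]] f g by (simp add: near_point_at_def smooth_functions_add)
    show "near_point_at U c a (\<lambda>p. f p * g p) = near_point_at U c a f * near_point_at U c a g"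
      using prolong_mult[OF S b sm[OF f] sm[OF g]] f g by (simp add: near_point_at_def smooth_functions_mult)
  qed (simp add: near_point_at_def)
qed

lemma wchart_near_point_at:
  assumes Uc: "(U, c) \<in> \<A>" and a: "a \<in> over n (c ` U)"
  shows "wchart c (near_point_at U c a) = a"
proof
  fix i
  let ?x = "inv_into U c (bodies \<mm> a)"
  have b: "bodies \<mm> a \<in> c ` U" using a by (simp add: over_def)
  have x: "?x \<in> U" "c ?x = bodies \<mm> a" using b by (auto simp: inv_into_into f_inv_into_f)
  show "wchart c (near_point_at U c a) i = a i"
  proof (cases "i < n")
    case True
    obtain e N where e: "e \<in> R" "openin X N" "?x \<in> N" "N \<subseteq> U" "\<And>y. y \<in> N \<Longrightarrow> e y = c y i"
      using coordinate_germ[OF Uc x(1)] by blast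
    have "wchart c (near_point_at U c a) i = near_point_at U c a e"
      by (rule wchart_coordinate[where c = c, OF np_near_point_at[OF Uc a] True e(1-3,5)])
    also have "\<dots> = prolong \<mm> n (\<lambda>y. e (inv_into U c y)) a" using e(1) by (simp add: near_point_at_def)
    also have "\<dots> = prolong \<mm> n (\<lambda>y. y i) a"
    proof (rule prolong_cong)
      show "open_n n (c ` N)" by (rule chart_open_image[OF Uc e(2,4)])
      show "bodies \<mm> a \<in> c ` N" using e(3) x(2) by (metis image_eqI)
      show "e (inv_into U c y) = y i" if "y \<in> c ` N" for y
        using that e(4,5) inv_chart[OF Uc] by auto
    qed
    also have "\<dots> = a i" by (rule prolong_coordinate[OF True])
    finally show ?thesis .
  next
    case False
    then show ?thesis using a by (simp add: weil_chart_def over_def En_def)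
  qed
qed

end

section \<open>Smooth functions and derivations on the Weil bundle\<close>

context weil_manifold
begin

abbreviation MA where "MA \<equiv> weil_bundle X n \<A> \<mm>"

abbreviation F where "F \<equiv> weil_functions X n \<A> \<mm>"

abbreviation over_pts where "over_pts \<equiv> near_points_over X n \<A> \<mm>"

abbreviation dom where "dom U c \<equiv> over n (c ` U)"

lemma over_pts_subset: "(U, c) \<in> \<A> \<Longrightarrow> over_pts U \<subseteq> MA"
  using chart_subset by (auto simp: weil_bundle_def near_points_over_def)

lemma MA_chart: "\<xi> \<in> MA \<Longrightarrow> \<exists>U c x. (U, c) \<in> \<A> \<and> x \<in> U \<and> np x \<xi>"
  using exists_chart by (fastforce simp: weil_bundle_def near_points_over_def)

lemma open_dom: "(U, c) \<in> \<A> \<Longrightarrow> open_n n (dom U c)"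
  by (rule open_n_over[OF chart_open])

lemma wchart_in_dom:
  assumes Uc: "(U, c) \<in> \<A>" and \<xi>: "\<xi> \<in> over_pts U" shows "wchart c \<xi> \<in> dom U c"
proof -
  obtain x where x: "x \<in> U" "np x \<xi>" using \<xi> by (auto simp: near_points_over_def)
  have "wchart c \<xi> \<in> En n" by (simp add: weil_chart_def En_def)
  then show ?thesis using bodies_wchart[OF Uc x] x by (simp add: over_def)
qed

lemma near_point_at_in_over_pts:
  assumes Uc: "(U, c) \<in> \<A>" and a: "a \<in> dom U c" shows "near_point_at U c a \<in> over_pts U"
proof -
  have "inv_into U c (bodies \<mm> a) \<in> U" using a by (simp add: over_def inv_into_into)
  then show ?thesis using np_near_point_at[OF Uc a] by (auto simp: near_points_over_def)
qed

text \<open>The bodies of the coordinates determine the base point, and then \<open>near_point_eqI\<close> applies.\<close>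
lemma inj_wchart: assumes Uc: "(U, c) \<in> \<A>" shows "inj_on (wchart c) (over_pts U)"
proof (rule inj_onI)
  fix \<xi> \<eta> assume "\<xi> \<in> over_pts U" "\<eta> \<in> over_pts U" and eq: "wchart c \<xi> = wchart c \<eta>"
  then obtain x y where xy: "x \<in> U" "np x \<xi>" "y \<in> U" "np y \<eta>" by (auto simp: near_points_over_def)
  have "c x = c y" using bodies_wchart[OF Uc xy(1,2)] bodies_wchart[OF Uc xy(3,4)] eq by simp
  then have "x = y" using chart_inj[OF Uc] xy by (auto dest: inj_onD)
  then show "\<xi> = \<eta>" using near_point_eqI[OF Uc xy(1,2) _ eq] xy(4) by simp
qed

lemma near_point_at_wchart:
  assumes Uc: "(U, c) \<in> \<A>" and \<xi>: "\<xi> \<in> over_pts U" shows "near_point_at U c (wchart c \<xi>) = \<xi>"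
  using inj_onD[OF inj_wchart[OF Uc] wchart_near_point_at[OF Uc wchart_in_dom[OF Uc \<xi>]]
      near_point_at_in_over_pts[OF Uc wchart_in_dom[OF Uc \<xi>]] \<xi>] .

lemma wchart_image: assumes Uc: "(U, c) \<in> \<A>" shows "wchart c ` over_pts U = dom U c"
proof
  show "dom U c \<subseteq> wchart c ` over_pts U"
  proof
    fix a assume a: "a \<in> dom U c"
    from wchart_near_point_at[OF Uc a] near_point_at_in_over_pts[OF Uc a] show "a \<in> wchart c ` over_pts U"
      by (metis imageI)
  qed
qed (use wchart_in_dom[OF Uc] in auto)

lemma inv_wchart:
  assumes Uc: "(U, c) \<in> \<A>" and a: "a \<in> dom U c"
  shows "inv_into (over_pts U) (wchart c) a = near_point_at U c a"
  using inv_into_f_f[OF inj_wchart[OF Uc] near_point_at_in_over_pts[OF Uc a]] wchart_near_point_at[OF Uc a] by simp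

text \<open>Membership in \<open>weil_functions\<close> is tested on the explicit inverses of the Weil charts.\<close>
lemma weil_functionsI:
  assumes "\<And>U c. (U, c) \<in> \<A> \<Longrightarrow> smooth_on n (dom U c) (\<lambda>a. \<phi> (near_point_at U c a))"
    and "\<And>\<xi>. \<xi> \<notin> MA \<Longrightarrow> \<phi> \<xi> = 0"
  shows "\<phi> \<in> F"
  unfolding weil_functions_def
proof (rule smooth_functionsI[OF _ assms(2)])
  fix V d assume "(V, d) \<in> weil_atlas X n \<A> \<mm>"
  then obtain U c where Uc: "(U, c) \<in> \<A>" and V: "V = over_pts U" "d = wchart c"
    by (auto simp: weil_atlas_def)
  show "smooth_on n (d ` V) (\<lambda>x. \<phi> (inv_into V d x))"
    unfolding V wchart_image[OF Uc]
    by (rule smooth_on_congI[OF assms(1)[OF Uc] open_dom[OF Uc]]) (simp add: inv_wchart[OF Uc])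
qed

lemma weil_functionsD:
  assumes \<phi>: "\<phi> \<in> F"
  shows "(U, c) \<in> \<A> \<Longrightarrow> smooth_on n (dom U c) (\<lambda>a. \<phi> (near_point_at U c a))" and "\<xi> \<notin> MA \<Longrightarrow> \<phi> \<xi> = 0"
proof -
  assume Uc: "(U, c) \<in> \<A>"
  then have "(over_pts U, wchart c) \<in> weil_atlas X n \<A> \<mm>" by (force simp: weil_atlas_def)
  from smooth_functionsD(1)[OF \<phi>[unfolded weil_functions_def] this]
  have "smooth_on n (dom U c) (\<lambda>a. \<phi> (inv_into (over_pts U) (wchart c) a))"
    unfolding wchart_image[OF Uc] .
  then show "smooth_on n (dom U c) (\<lambda>a. \<phi> (near_point_at U c a))"
    by (rule smooth_on_congI[OF _ open_dom[OF Uc]]) (simp add: inv_wchart[OF Uc])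
next
  assume "\<xi> \<notin> MA"
  then show "\<phi> \<xi> = 0" using smooth_functionsD(2)[OF \<phi>[unfolded weil_functions_def]] by simp
qed

lemma unit_in_F: "unit_on MA \<in> F"
proof (rule weil_functionsI)
  fix U c assume Uc: "(U, c) \<in> \<A>"
  show "smooth_on n (dom U c) (\<lambda>a. unit_on MA (near_point_at U c a) :: 'a)"
    by (rule smooth_on_congI[OF smooth_on_const[of n _ 1] open_dom[OF Uc]])
       (use near_point_at_in_over_pts[OF Uc] over_pts_subset[OF Uc] in \<open>auto simp: unit_on_def\<close>)
qed (simp add: unit_on_def)

text \<open>A smooth function on the manifold as a function on the Weil bundle, by evaluation of near points;
  in coordinates it is the prolongation.\<close>
definition evaluation :: "('p \<Rightarrow> real) \<Rightarrow> (('p \<Rightarrow> real) \<Rightarrow> 'a) \<Rightarrow> 'a" where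
  "evaluation f \<xi> = (if \<xi> \<in> MA then \<xi> f else 0)"

lemma evaluation_in_F: assumes f: "f \<in> R" shows "evaluation f \<in> F"
proof (rule weil_functionsI)
  fix U c assume Uc: "(U, c) \<in> \<A>"
  show "smooth_on n (dom U c) (\<lambda>a. evaluation f (near_point_at U c a))"
    by (rule smooth_on_congI[OF smooth_on_prolong[OF chart_open[OF Uc] smooth_functionsD(1)[OF f Uc]] open_dom[OF Uc]])
       (use near_point_at_in_over_pts[OF Uc] over_pts_subset[OF Uc] f in \<open>auto simp: evaluation_def near_point_at_def\<close>)
qed (simp add: evaluation_def)

text \<open>Transition maps between Weil charts are the prolongations of those of the manifold.\<close>
lemma wchart_transition:
  assumes Uc: "(U, c) \<in> \<A>" and Vd: "(V, d) \<in> \<A>" and a: "a \<in> over n (d ` (V \<inter> U))"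
  shows "near_point_at V d a \<in> over_pts U" "wchart c (near_point_at V d a) \<in> dom U c"
    and "i < n \<Longrightarrow> wchart c (near_point_at V d a) i = prolong \<mm> n (\<lambda>y. c (inv_into V d y) i) a"
proof -
  let ?x = "inv_into V d (bodies \<mm> a)"
  obtain x where x: "x \<in> V" "x \<in> U" "bodies \<mm> a = d x" using a by (auto simp: over_def)
  then have x': "?x = x" using inv_chart[OF Vd] by simp
  have a': "a \<in> dom V d" using a by (auto simp: over_def)
  note np = np_near_point_at[OF Vd a', unfolded x']
  show 1: "near_point_at V d a \<in> over_pts U" using np x by (auto simp: near_points_over_def)
  show "wchart c (near_point_at V d a) \<in> dom U c" by (rule wchart_in_dom[OF Uc 1])
  assume i: "i < n"
  obtain e N where e: "e \<in> R" "openin X N" "x \<in> N" "N \<subseteq> U" "\<And>y. y \<in> N \<Longrightarrow> e y = c y i"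
    using coordinate_germ[OF Uc x(2)] by blast
  have "wchart c (near_point_at V d a) i = near_point_at V d a e"
    by (rule wchart_coordinate[where c = c, OF np i e(1-3,5)])
  also have "\<dots> = prolong \<mm> n (\<lambda>y. e (inv_into V d y)) a" using e(1) by (simp add: near_point_at_def)
  also have "\<dots> = prolong \<mm> n (\<lambda>y. c (inv_into V d y) i) a"
  proof (rule prolong_cong)
    show "open_n n (d ` (N \<inter> V))"
      using chart_open_image[OF Vd openin_Int[OF e(2) chart_domain[OF Vd]]] by simp
    show "bodies \<mm> a \<in> d ` (N \<inter> V)" using e(3) x by auto
    show "e (inv_into V d y) = c (inv_into V d y) i" if "y \<in> d ` (N \<inter> V)" for y
      using that e(5) inv_chart[OF Vd] by auto
  qed
  finally show "wchart c (near_point_at V d a) i = prolong \<mm> n (\<lambda>y. c (inv_into V d y) i) a" .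
qed

text \<open>The analogue of \<open>extension_in_R\<close> on the Weil bundle; the support condition concerns the base points.\<close>
lemma extension_in_F:
  assumes Uc: "(U, c) \<in> \<A>" and K: "closedin X K" "K \<subseteq> U"
    and h: "smooth_on n (dom U c) (\<lambda>a. h (near_point_at U c a))" and h0: "\<And>\<xi>. \<xi> \<notin> over_pts K \<Longrightarrow> h \<xi> = 0"
  shows "h \<in> F"
proof (rule weil_functionsI)
  show "h \<xi> = 0" if "\<xi> \<notin> MA" for \<xi>
    using that h0[of \<xi>] closedin_subset[OF K(1)] by (auto simp: weil_bundle_def near_points_over_def)
  fix V d assume Vd: "(V, d) \<in> \<A>"
  show "smooth_on n (dom V d) (\<lambda>a. h (near_point_at V d a))"
    unfolding smooth_on_def
  proof (intro allI Ck_on_local[OF open_dom[OF Vd]])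
    fix k a assume a: "a \<in> dom V d"
    then obtain p where p: "p \<in> V" "bodies \<mm> a = d p" "a \<in> En n" by (auto simp: over_def)
    show "\<exists>T. open_n n T \<and> a \<in> T \<and> Ck_on k n T (\<lambda>a. h (near_point_at V d a))"
    proof (cases "p \<in> U")
      case True
      let ?T = "over n (d ` (V \<inter> U))"
      have dVU: "open_n n (d ` (V \<inter> U))"
        by (rule chart_open_image[OF Vd openin_Int[OF chart_domain[OF Vd] chart_domain[OF Uc]]]) simp
      note T = open_n_over[OF dVU]
      note tr = wchart_transition[OF Uc Vd]
      have "Ck_on k n ?T (\<lambda>a. h (near_point_at U c (wchart c (near_point_at V d a))))"
      proof (rule Ck_on_compose[where h = "\<lambda>a. h (near_point_at U c a)" and T = "\<lambda>a. wchart c (near_point_at V d a)", OF T open_dom[OF Uc] tr(2)])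
        show "Ck_on k n (dom U c) (\<lambda>a. h (near_point_at U c a))" using h by (simp add: smooth_on_def)
        fix j assume j: "j < n"
        have "smooth_on n ?T (\<lambda>a. wchart c (near_point_at V d a) j)"
          by (rule smooth_on_congI[OF smooth_on_prolong[OF dVU charts_compatible[OF Vd Uc j]] T tr(3)[OF _ j]])
        then show "Ck_on k n ?T (\<lambda>a. wchart c (near_point_at V d a) j)" by (simp add: smooth_on_def)
      qed
      then have "Ck_on k n ?T (\<lambda>a. h (near_point_at V d a))"
        by (rule Ck_on_congI[OF _ T]) (simp add: near_point_at_wchart[OF Uc tr(1)])
      moreover have "a \<in> ?T" using p True by (auto simp: over_def)
      ultimately show ?thesis using T by blast
    next
      case False
      let ?T = "over n (d ` (V - K))"
      have T: "open_n n ?T"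
        by (intro open_n_over chart_open_image[OF Vd openin_diff[OF chart_domain[OF Vd] K(1)]]) auto
      have "Ck_on k n ?T (\<lambda>a. h (near_point_at V d a))"
      proof (rule Ck_on_congI[OF Ck_on_const T])
        fix a assume "a \<in> ?T"
        then obtain q where q: "q \<in> V" "q \<notin> K" "bodies \<mm> a = d q" and a: "a \<in> dom V d"
          by (auto simp: over_def)
        have np: "np q (near_point_at V d a)" using np_near_point_at[OF Vd a] q inv_chart[OF Vd] by simp
        have "near_point_at V d a \<notin> over_pts K"
        proof
          assume "near_point_at V d a \<in> over_pts K"
          then obtain z where "z \<in> K" "np z (near_point_at V d a)" by (auto simp: near_points_over_def)
          then show False
            using np_base_unique[OF np, of z] q chart_subset[OF Vd] closedin_subset[OF K(1)] by blast
        qed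
        then show "h (near_point_at V d a) = 0" by (rule h0)
      qed
      moreover have "a \<in> ?T" using p False K(2) by (auto simp: over_def)
      ultimately show ?thesis using T by blast
    qed
  qed
qed

lemma F_add: "\<phi> \<in> F \<Longrightarrow> \<psi> \<in> F \<Longrightarrow> (\<lambda>p. \<phi> p + \<psi> p) \<in> F"
  and F_mult: "\<phi> \<in> F \<Longrightarrow> \<psi> \<in> F \<Longrightarrow> (\<lambda>p. \<phi> p * \<psi> p) \<in> F"
  and F_cmult: "\<phi> \<in> F \<Longrightarrow> (\<lambda>p. a * \<phi> p) \<in> F"
  unfolding weil_functions_def by (fact smooth_functions_add smooth_functions_mult smooth_functions_cmult)+

text \<open>The partial derivative in direction \<open>b\<close> of the \<open>i\<close>-th coordinate of a Weil chart, cut off by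
  the bump function \<open>\<beta>\<close>.\<close>
definition coordinate_derivation where
  "coordinate_derivation U c \<beta> i b \<phi> \<xi> =
    (if \<phi> \<in> F \<and> \<xi> \<in> over_pts U then \<xi> \<beta> * pd i b (\<lambda>a. \<phi> (near_point_at U c a)) (wchart c \<xi>) else 0)"

text \<open>The derivation law is inherited from partial derivatives; the values are smooth on the whole bundle
  because a near point over a point outside \<open>K\<close> evaluates \<open>\<beta>\<close> to zero.\<close>
lemma coordinate_derivation_in_derivations:
  assumes Uc: "(U, c) \<in> \<A>" and K: "closedin X K" "K \<subseteq> U"
    and \<beta>: "\<beta> \<in> R" "\<And>y. y \<notin> K \<Longrightarrow> \<beta> y = 0" and ib: "i < n" "b \<in> Basis"
  shows "coordinate_derivation U c \<beta> i b \<in> derivations F"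
proof -
  let ?Y = "coordinate_derivation U c \<beta> i b"
  let ?r = "\<lambda>\<phi> a. \<phi> (near_point_at U c a)"
  have sm: "smooth_on n (dom U c) (?r \<phi>)" if "\<phi> \<in> F" for \<phi> by (rule weil_functionsD(1)[OF that Uc])
  have der: "has_pd (?r \<phi>) i b a (pd i b (?r \<phi>) a)" if "\<phi> \<in> F" "a \<in> dom U c" for \<phi> a
    by (rule smooth_on_pd(2)[OF open_dom[OF Uc] sm[OF that(1)] ib that(2)])
  have YF: "?Y \<phi> \<in> F" if \<phi>: "\<phi> \<in> F" for \<phi>
  proof (rule extension_in_F[OF Uc K])
    have "smooth_on n (dom U c) (\<lambda>a. ?r (evaluation \<beta>) a * pd i b (?r \<phi>) a)"
      by (intro smooth_on_mult sm evaluation_in_F \<beta> smooth_on_pd(1)[OF open_dom[OF Uc] sm[OF \<phi>] ib])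
    then show "smooth_on n (dom U c) (\<lambda>a. ?Y \<phi> (near_point_at U c a))"
    proof (rule smooth_on_congI[OF _ open_dom[OF Uc]])
      fix a assume a: "a \<in> dom U c"
      show "?Y \<phi> (near_point_at U c a) = ?r (evaluation \<beta>) a * pd i b (?r \<phi>) a"
        using near_point_at_in_over_pts[OF Uc a] over_pts_subset[OF Uc] wchart_near_point_at[OF Uc a] \<phi>
        by (auto simp: coordinate_derivation_def evaluation_def)
    qed
    fix \<xi> assume \<xi>: "\<xi> \<notin> over_pts K"
    show "?Y \<phi> \<xi> = 0"
    proof (cases "\<xi> \<in> over_pts U")
      case True
      then obtain x where x: "x \<in> U" "np x \<xi>" by (auto simp: near_points_over_def)
      with \<xi> have "x \<in> U - K" by (auto simp: near_points_over_def)
      moreover have "openin X (U - K)" by (rule openin_diff[OF chart_domain[OF Uc] K(1)])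
      ultimately have "\<xi> \<beta> = \<xi> (\<lambda>p. 0)"
        using np_germ[OF x(2) \<beta>(1) smooth_functions_zero] \<beta>(2) by auto
      then show ?thesis using np_zero[OF x(2)] by (simp add: coordinate_derivation_def)
    qed (simp add: coordinate_derivation_def)
  qed
  note simps = coordinate_derivation_def wchart_in_dom[OF Uc]
  have add: "?Y (\<lambda>p. \<phi> p + \<psi> p) = (\<lambda>p. ?Y \<phi> p + ?Y \<psi> p)" if "\<phi> \<in> F" "\<psi> \<in> F" for \<phi> \<psi>
    using that has_pd_imp_pd[OF has_vector_derivative_add[OF der[OF that(1)] der[OF that(2)]]]
    by (intro ext) (simp add: simps F_add distrib_left)
  have cm: "?Y (\<lambda>p. a * \<phi> p) = (\<lambda>p. a * ?Y \<phi> p)" if "\<phi> \<in> F" for a \<phi>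
    using that has_pd_imp_pd[OF pd_scale_left[OF der[OF that]]]
    by (intro ext) (simp add: simps F_cmult mult.left_commute)
  have mult: "?Y (\<lambda>p. \<phi> p * \<psi> p) = (\<lambda>p. ?Y \<phi> p * \<psi> p + \<phi> p * ?Y \<psi> p)" if "\<phi> \<in> F" "\<psi> \<in> F" for \<phi> \<psi>
  proof
    fix \<xi>
    show "?Y (\<lambda>p. \<phi> p * \<psi> p) \<xi> = ?Y \<phi> \<xi> * \<psi> \<xi> + \<phi> \<xi> * ?Y \<psi> \<xi>"
    proof (cases "\<xi> \<in> over_pts U")
      case True
      let ?a = "wchart c \<xi>"
      have "pd i b (\<lambda>a. ?r \<phi> a * ?r \<psi> a) ?a = \<phi> \<xi> * pd i b (?r \<psi>) ?a + pd i b (?r \<phi>) ?a * \<psi> \<xi>"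
        using has_pd_imp_pd[OF bounded_bilinear.has_vector_derivative[OF bounded_bilinear_times
              der[OF that(1) wchart_in_dom[OF Uc True]] der[OF that(2) wchart_in_dom[OF Uc True]]]]
        by (simp add: near_point_at_wchart[OF Uc True])
      then show ?thesis using True that F_mult[OF that]
        by (simp add: coordinate_derivation_def algebra_simps)
    qed (simp add: coordinate_derivation_def)
  qed
  have "?Y \<phi> = (\<lambda>_. 0)" if "\<phi> \<notin> F" for \<phi> using that by (intro ext) (simp add: coordinate_derivation_def)
  then show ?thesis
    unfolding derivations_def linear_operators_def using YF add cm mult by blast
qed

lemma exists_unit_Basis: "\<exists>b\<in>Basis. b \<notin> \<mm>"
proof (rule ccontr)
  assume "\<not> ?thesis"
  then have "span Basis \<subseteq> \<mm>" by (intro span_minimal subspace_m) auto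
  then show False using one_notin_m by auto
qed

text \<open>Differentiate the \<open>0\<close>-th coordinate, extended to a global function, in the direction of a
  basis vector \<open>u\<close> of the Weil algebra: near \<open>\<xi>\<close> the coordinate is \<open>a \<mapsto> a 0\<close>, with derivative \<open>u\<close>. Choosing
  \<open>u\<close> outside the maximal ideal makes this a unit.\<close>
lemma derivation_with_unit_value:
  assumes n: "n > 0" and \<xi>: "\<xi> \<in> MA"
  shows "\<exists>Y\<in>derivations F. \<exists>\<psi>\<in>F. Y \<psi> \<xi> dvd 1"
proof -
  obtain U c x where Uc: "(U, c) \<in> \<A>" and x: "x \<in> U" and np: "np x \<xi>" using MA_chart[OF \<xi>] by blast
  have \<xi>U: "\<xi> \<in> over_pts U" using x np by (auto simp: near_points_over_def)
  obtain \<beta> N K where b: "\<beta> \<in> R" "openin X N" "x \<in> N" "N \<subseteq> K" "K \<subseteq> U" "closedin X K"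
    "\<And>y. y \<in> N \<Longrightarrow> \<beta> y = 1" "\<And>y. y \<notin> K \<Longrightarrow> \<beta> y = 0"
    by (rule bump[OF Uc chart_domain[OF Uc] order_refl x]) blast
  obtain e M where e: "e \<in> R" "openin X M" "x \<in> M" "M \<subseteq> U" "\<And>y. y \<in> M \<Longrightarrow> e y = c y 0"
    using coordinate_germ[OF Uc x] by blast
  obtain u where u: "u \<in> Basis" "u \<notin> \<mm>" using exists_unit_Basis by blast
  let ?Y = "coordinate_derivation U c \<beta> 0 u"
  let ?a = "wchart c \<xi>"
  have Y: "?Y \<in> derivations F" by (rule coordinate_derivation_in_derivations[OF Uc b(6,5,1,8) n u(1)])
  have \<xi>\<beta>: "\<xi> \<beta> = 1"
  proof -
    have "N \<subseteq> topspace X" using b(2) by (rule openin_subset)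
    then have "\<xi> \<beta> = \<xi> (unit_on (topspace X))"
      by (intro np_germ[OF np b(1) unit_in_R b(2,3)]) (auto simp: b(7) unit_on_def)
    then show ?thesis using np_unit[OF np] by simp
  qed
  have "pd 0 u (\<lambda>a. evaluation e (near_point_at U c a)) ?a = pd 0 u (\<lambda>a. a 0) ?a"
  proof (rule pd_cong)
    have cM: "open_n n (c ` M)" by (rule chart_open_image[OF Uc e(2,4)])
    show "open_n n (over n (c ` M))" by (rule open_n_over[OF cM])
    show "?a \<in> over n (c ` M)"
      using wchart_in_dom[OF Uc \<xi>U] bodies_wchart[OF Uc x np] e(3) by (simp add: over_def)
    show "evaluation e (near_point_at U c a) = a 0" if a: "a \<in> over n (c ` M)" for a
    proof -
      have a': "a \<in> dom U c" using a e(4) by (auto simp: over_def)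
      have "evaluation e (near_point_at U c a) = prolong \<mm> n (\<lambda>y. e (inv_into U c y)) a"
        using near_point_at_in_over_pts[OF Uc a'] over_pts_subset[OF Uc] e(1) by (auto simp: evaluation_def near_point_at_def)
      also have "\<dots> = prolong \<mm> n (\<lambda>y. y 0) a"
        by (rule prolong_cong[OF cM]) (use a e(4,5) inv_chart[OF Uc] in \<open>auto simp: over_def\<close>)
      also have "\<dots> = a 0" by (rule prolong_coordinate[OF n])
      finally show ?thesis .
    qed
  qed (rule n)
  also have "\<dots> = u" by (rule has_pd_imp_pd) (auto intro!: derivative_eq_intros)
  finally have "?Y (evaluation e) \<xi> = u"
    using \<xi>U \<xi>\<beta> evaluation_in_F[OF e(1)] by (simp add: coordinate_derivation_def)
  moreover have "u dvd 1" using unit_if_notin_m[OF u(2)] by (metis dvdI)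
  ultimately show ?thesis using Y evaluation_in_F[OF e(1)] by metis
qed

text \<open>A derivation kills the idempotent \<open>\<delta>\<close>, and \<open>\<phi> \<delta>\<close> is a constant multiple of \<open>\<delta>\<close>.\<close>
lemma derivation_zero_if_discrete:
  assumes n: "n = 0" and Y: "Y \<in> derivations F" and \<phi>: "\<phi> \<in> F"
  shows "Y \<phi> = (\<lambda>_. 0)"
proof
  fix \<xi>
  have inF: "f \<in> F" if "\<And>\<eta>. \<eta> \<notin> MA \<Longrightarrow> f \<eta> = 0" for f
  proof (rule weil_functionsI[OF _ that])
    fix U c assume "(U, c) \<in> \<A>"
    have "dom U c \<subseteq> {\<lambda>_. 0}" by (auto simp: over_def En_def n)
    then have "continuous_on (dom U c) g" for g :: "_ \<Rightarrow> 'a"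
      by (metis continuous_on_empty continuous_on_sing subset_singletonD)
    then have "Ck_on k 0 (dom U c) g" for k and g :: "_ \<Rightarrow> 'a" by (cases k) auto
    then show "smooth_on n (dom U c) (\<lambda>a. f (near_point_at U c a))" by (simp add: smooth_on_def n)
  qed
  have Y': "\<And>f g. f \<in> F \<Longrightarrow> g \<in> F \<Longrightarrow> Y (\<lambda>p. f p * g p) = (\<lambda>p. Y f p * g p + f p * Y g p)"
    "\<And>f. f \<in> F \<Longrightarrow> Y f \<in> F" "\<And>f a. f \<in> F \<Longrightarrow> Y (\<lambda>p. a * f p) = (\<lambda>p. a * Y f p)"
    using Y by (auto simp: derivations_def linear_operators_def)
  show "Y \<phi> \<xi> = 0"
  proof (cases "\<xi> \<in> MA")
    case False
    then show ?thesis using weil_functionsD(2)[OF Y'(2)[OF \<phi>]] by simp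
  next
    case True
    define \<delta> where "\<delta> \<eta> = (if \<eta> = \<xi> then 1 else 0 :: 'a)" for \<eta>
    have \<delta>: "\<delta> \<in> F" using True by (intro inF) (auto simp: \<delta>_def)
    have "(\<lambda>p. \<delta> p * \<delta> p) = \<delta>" by (auto simp: \<delta>_def)
    then have "Y \<delta> \<xi> = Y \<delta> \<xi> + Y \<delta> \<xi>" using fun_cong[OF Y'(1)[OF \<delta> \<delta>], of \<xi>] by (simp add: \<delta>_def)
    then have 0: "Y \<delta> \<xi> = 0" by simp
    have "(\<lambda>p. \<phi> p * \<delta> p) = (\<lambda>p. \<phi> \<xi> * \<delta> p)" by (auto simp: \<delta>_def)
    then show ?thesis
      using fun_cong[OF Y'(1)[OF \<phi> \<delta>], of \<xi>] fun_cong[OF Y'(3)[OF \<delta>, of "\<phi> \<xi>"], of \<xi>] 0 by (simp add: \<delta>_def)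
  qed
qed

end

section \<open>The 1-form of a Lie-Rinehart structure\<close>

theorem theorem4:
  fixes X :: "'p topology"
    and n :: nat
    and \<A> :: "('p set \<times> ('p \<Rightarrow> nat \<Rightarrow> real)) set"
    and \<mm> :: "'a::{comm_ring_1, real_algebra_1, euclidean_space} set"
    and \<rho> :: "(('p \<Rightarrow> real) \<Rightarrow> 'a, 'a) operator \<Rightarrow> (('p \<Rightarrow> real) \<Rightarrow> 'a, 'a) operator"
  assumes "smooth_manifold X n \<A>"
    and "paracompact_space X"
    and "weil_algebra \<mm>"
    and "lie_rinehart_structure (weil_bundle X n \<A> \<mm>) (weil_functions X n \<A> \<mm>) \<rho>"
  shows "\<exists>\<alpha>. differential_1_form (weil_functions X n \<A> \<mm>) \<alpha> \<and>
           (\<forall>Y \<in> derivations (weil_functions X n \<A> \<mm>). \<forall>\<phi> \<in> weil_functions X n \<A> \<mm>.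
              \<rho> Y \<phi> = (\<lambda>q. Y \<phi> q + \<phi> q * \<alpha> Y q))"
proof (rule one_form_of_separating_derivations[OF assms(4)])
  interpret weil_manifold X n \<A> \<mm> using assms(1,3) by (simp add: weil_manifold_def)
  show "unit_on MA \<in> F" by (rule unit_in_F)
  show "\<phi> p = 0" if "\<phi> \<in> F" "p \<notin> MA" for \<phi> p by (rule weil_functionsD(2)[OF that])
  show "(\<forall>Y\<in>derivations F. \<forall>\<phi>\<in>F. Y \<phi> = (\<lambda>_. 0)) \<or>
      (\<forall>p\<in>MA. \<exists>Y\<in>derivations F. \<exists>\<psi>\<in>F. Y \<psi> p dvd 1)"
    using derivation_with_unit_value derivation_zero_if_discrete by (cases "n = 0") simp_all
qed

end
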